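(* Let $E,A\in\mathbb{R}^{n\times n}$ with $(E,A)$ regular, $B\in\mathbb{R}^{n\times m}$, $C\in\mathbb{R}^{m\times n}$, $D\in\mathbb{R}^{m\times m}$, and suppose the descriptor system $E\dot x=Ax+Bu$, $y=Cx+Du$ is positive real. Let $\mathcal{E},\mathcal{A}\in\mathbb{R}^{n_1\times n_1}$, $\mathcal{B}\in\mathbb{R}^{n_1\times m}$, $\mathcal{C}\in\mathbb{R}^{m\times n_1}$ be the blocks determined by a staircase form (defined in the context) of $(E,A,B,C)$. Then the following hold. (i) If $D+D^T\ge 0$, then $(\mathcal{E},\mathcal{A},\mathcal{B},\mathcal{C},D)$ is a port-Hamiltonian realization of the system $(E,A,B,C,D)$. (ii) If $D+D^T\not\ge 0$, let $\mathcal{W}\in\mathbb{R}^{n_1\times m}$ satisfy $$\mathcal{E}^T\mathcal{W}=0,\qquad D+D^T-\mathcal{B}^T\mathcal{W}-\mathcal{W}^T\mathcal{B}\ge 0,$$ and be such that $(\mathcal{E},\mathcal{A},\mathcal{C}-\mathcal{W}^T\mathcal{A})$ is completely observable. Then $$(\mathcal{E},\ \mathcal{A},\ \mathcal{B},\ \mathcal{C}-\mathcal{W}^T\mathcal{A},\ D-\mathcal{W}^T\mathcal{B})$$ is a port-Hamiltonian realization of the system $(E,A,B,C,D)$.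
   Context: For a real matrix $M$, $M\ge 0$ (resp. $M\le 0$) means $M$ is symmetric and positive (resp. negative) semidefinite; for complex matrices, Hermitian in place of symmetric. A descriptor system is identified with its quintuple $(E,A,B,C,D)$. Regular: $\det(\alpha E-\beta A)\ne 0$ for some $(\alpha,\beta)\in\mathbb{C}^2$. Completely observable (for a triplet $(E,A,C)$ with $E,A$ of size $n\times n$): $\operatorname{rank}\begin{bmatrix}\alpha E-\beta A \\ C\end{bmatrix}=n$ for all $(\alpha,\beta)\in\mathbb{C}^2\setminus\{(0,0)\}$. Positive real: the transfer function $\mathcal{T}(s)=C(sE-A)^{-1}B+D$ is analytic in $\mathbb{C}_+=\{s\in\mathbb{C}:\operatorname{Re}(s)>0\}$ and $\mathcal{T}(s)+\mathcal{T}(s)^H\ge 0$ for all $s\in\mathbb{C}_+$. Port-Hamiltonian (pH): $(E,A,B,C,D)$ with $E,A\in\mathbb{R}^{n\times n}$ is pH if there exist $J,R,Q\in\mathbb{R}^{n\times n}$ and $G,P\in\mathbb{R}^{n\times m}$ such that, with $S=\frac12(D+D^T)$ and $N=\frac12(D-D^T)$, $$\begin{bmatrix} A & B \\ C & D \end{bmatrix}=\begin{bmatrix} (J-R)Q & G-P \\ (G+P)^TQ & S+N \end{bmatrix},\qquad \begin{bmatrix} J & G \\ -G^T & N \end{bmatrix}=-\begin{bmatrix} J & G \\ -G^T & N \end{bmatrix}^T,$$ $$Q^TE=E^TQ\ge 0,\qquad \begin{bmatrix} Q^TRQ & Q^TP \\ P^TQ & S \end{bmatrix}=\begin{bmatrix}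 Q^TRQ & Q^TP \\ P^TQ & S \end{bmatrix}^T\ge 0.$$ A pH realization of $(E,A,B,C,D)$ is a pH quintuple $(\hat E,\hat A,\hat B,\hat C,\hat D)$ with $\hat E,\hat A\in\mathbb{R}^{\hat n\times\hat n}$, $\hat B,\hat C^T\in\mathbb{R}^{\hat n\times m}$, $\hat D\in\mathbb{R}^{m\times m}$ (the state dimension $\hat n$ may differ from $n$) such that $C(sE-A)^{-1}B+D=\hat C(s\hat E-\hat A)^{-1}\hat B+\hat D$. Staircase form: real orthogonal matrices $U,V\in\mathbb{R}^{n\times n}$ and a partition $n=n_1+n_2+n_3+n_4+n_5$ (rows and columns partitioned conformally) such that $$UEV=\begin{bmatrix} \mathcal{E} & 0 & 0 & E_{14} & E_{15} \\ E_{21} & E_{22} & 0 & E_{24} & E_{25} \\ E_{31} & E_{32} & E_{33} & E_{34} & E_{35} \\ 0 & 0 & 0 & E_{44} & E_{45} \\ 0 & 0 & 0 & 0 & E_{55} \end{bmatrix},\quad UAV=\begin{bmatrix} \mathcal{A} & 0 & 0 & A_{14} & A_{15} \\ A_{21} & A_{22} & 0 & A_{24} & A_{25} \\ A_{31} & A_{32} & A_{33} & A_{34} & A_{35} \\ 0 & 0 & 0 & A_{44} & A_{45} \\ 0 & 0 & 0 & 0 & A_{55} \end{bmatrix},$$ $$UB=\begin{bmatrix} \mathcal{B} \\ B_2 \\ B_3 \\ 0 \\ 0 \end{bmatrix},\qquad CV=\begin{bmatrix} \mathcal{C} & 0 & 0 & C_4 & C_5 \end{bmatrix},$$ where $E_{22}$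 and $E_{44}$ are nonsingular, $sE_{33}-A_{33}$ and $sE_{55}-A_{55}$ are nonsingular for all $s\in\mathbb{C}$, and for all $(\alpha,\beta)\in\mathbb{C}^2\setminus\{(0,0)\}$ $$\operatorname{rank}\begin{bmatrix} \alpha\mathcal{E}-\beta\mathcal{A} & 0 & 0 & \mathcal{B} \\ \alpha E_{21}-\beta A_{21} & \alpha E_{22}-\beta A_{22} & 0 & B_2 \\ \alpha E_{31}-\beta A_{31} & \alpha E_{32}-\beta A_{32} & \alpha E_{33}-\beta A_{33} & B_3 \end{bmatrix}=n_1+n_2+n_3,\qquad \operatorname{rank}\begin{bmatrix} \alpha\mathcal{E}-\beta\mathcal{A} \\ \mathcal{C} \end{bmatrix}=n_1.$$ (Such a form always exists for a regular descriptor system.) *)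

theory Defs
  imports
    "HOL-Complex_Analysis.Complex_Analysis"
    "Jordan_Normal_Form.DL_Rank"
    "Jordan_Normal_Form.Gauss_Jordan_Elimination"
    "Jordan_Normal_Form.Schur_Decomposition"
begin

text \<open>
  Matrices are those of Jordan_Normal_Form, so that sizes are natural numbers and may be 0. The
  names \<open>det\<close>, \<open>rank\<close>, \<open>mat\<close> also exist in HOL-Analysis; \<open>Determinant.det\<close> and
  \<open>vec_space.rank\<close> are the ones for \<open>'a mat\<close>. The first argument of \<open>vec_space.rank\<close> is
  the number of rows.
\<close>

abbreviation cmat :: "real mat \<Rightarrow> complex mat" where
  "cmat \<equiv> map_mat complex_of_real"

text \<open>
  On \<open>real\<close>, \<open>conjugate\<close> is the identity and \<open>mat_adjoint\<close> is transposition, so the next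
  definition is: symmetric positive semidefinite over \<open>real\<close>, Hermitian positive semidefinite
  over \<open>complex\<close>.
\<close>

definition psd :: "'a :: conjugatable_ordered_field mat \<Rightarrow> bool" where
  "psd M \<longleftrightarrow> square_mat M \<and> mat_adjoint M = M \<and>
     (\<forall>v \<in> carrier_vec (dim_row M). (M *\<^sub>v v) \<bullet>c v \<ge> 0)"

definition append_cols :: "'a :: zero mat \<Rightarrow> 'a mat \<Rightarrow> 'a mat" where
  "append_cols M N = four_block_mat M N (0\<^sub>m 0 (dim_col M)) (0\<^sub>m 0 (dim_col N))"

text \<open>The block matrix displayed by a list of block rows.\<close>

definition block_mat :: "'a :: zero mat list list \<Rightarrow> 'a mat" where
  "block_mat rs =
     foldr append_rows (map (\<lambda>row. foldr append_cols row (0\<^sub>m 0 0)) rs) (0\<^sub>m 0 0)"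

definition pencil :: "complex \<Rightarrow> complex \<Rightarrow> real mat \<Rightarrow> real mat \<Rightarrow> complex mat" where
  "pencil \<alpha> \<beta> E A = \<alpha> \<cdot>\<^sub>m cmat E - \<beta> \<cdot>\<^sub>m cmat A"

definition descriptor_system ::
  "nat \<Rightarrow> nat \<Rightarrow> real mat \<Rightarrow> real mat \<Rightarrow> real mat \<Rightarrow> real mat \<Rightarrow> real mat \<Rightarrow> bool" where
  "descriptor_system n m E A B C D \<longleftrightarrow>
     E \<in> carrier_mat n n \<and> A \<in> carrier_mat n n \<and> B \<in> carrier_mat n m \<and>
     C \<in> carrier_mat m n \<and> D \<in> carrier_mat m m"

definition regular :: "real mat \<Rightarrow> real mat \<Rightarrow> bool" where
  "regular E A \<longleftrightarrow> (\<exists>\<alpha> \<beta>. Determinant.det (pencil \<alpha> \<beta> E A) \<noteq> 0)"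

definition completely_observable ::
  "nat \<Rightarrow> nat \<Rightarrow> real mat \<Rightarrow> real mat \<Rightarrow> real mat \<Rightarrow> bool" where
  "completely_observable n m E A C \<longleftrightarrow>
     (\<forall>\<alpha> \<beta>. (\<alpha>, \<beta>) \<noteq> (0, 0) \<longrightarrow>
        vec_space.rank (n + m) (block_mat [[pencil \<alpha> \<beta> E A], [cmat C]]) = n)"

text \<open>
  The formula \<open>C (s E - A)\<inverse> B + D\<close> at a point; meaningful only if \<open>s E - A\<close> is nonsingular.
\<close>

definition transfer_formula ::
  "real mat \<Rightarrow> real mat \<Rightarrow> real mat \<Rightarrow> real mat \<Rightarrow> real mat \<Rightarrow> complex \<Rightarrow> complex mat" where
  "transfer_formula E A B C D s = cmat C * the (mat_inverse (pencil s 1 E A)) * cmat B + cmat D"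

text \<open>
  The transfer function is a matrix of rational functions: an eigenvalue of the pencil at which
  an entry has a removable singularity is not a pole of that entry. Accordingly
  \<open>remove_sings\<close> fills in the limit at removable singularities; at a pole it yields 0, so the
  entry is not analytic there. For regular pencils, equality of these functions is equality as
  rational functions.
\<close>

definition transfer ::
  "real mat \<Rightarrow> real mat \<Rightarrow> real mat \<Rightarrow> real mat \<Rightarrow> real mat \<Rightarrow> complex \<Rightarrow> complex mat" where
  "transfer E A B C D s = Matrix.mat (dim_row D) (dim_col D)
     (\<lambda>(i, j). remove_sings (\<lambda>z. transfer_formula E A B C D z $$ (i, j)) s)"

definition positive_real ::
  "real mat \<Rightarrow> real mat \<Rightarrow> real mat \<Rightarrow> real mat \<Rightarrow> real mat \<Rightarrow> bool" where
  "positive_real E A B C D \<longleftrightarrow>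
     (\<forall>i < dim_row D. \<forall>j < dim_col D.
        (\<lambda>s. transfer E A B C D s $$ (i, j)) analytic_on {s. Re s > 0}) \<and>
     (\<forall>s. Re s > 0 \<longrightarrow> psd (transfer E A B C D s + mat_adjoint (transfer E A B C D s)))"

definition port_Hamiltonian ::
  "nat \<Rightarrow> nat \<Rightarrow> real mat \<Rightarrow> real mat \<Rightarrow> real mat \<Rightarrow> real mat \<Rightarrow> real mat \<Rightarrow> bool" where
  "port_Hamiltonian n m E A B C D \<longleftrightarrow>
     descriptor_system n m E A B C D \<and>
     (\<exists>J \<in> carrier_mat n n. \<exists>R \<in> carrier_mat n n. \<exists>Q \<in> carrier_mat n n.
      \<exists>G \<in> carrier_mat n m. \<exists>P \<in> carrier_mat n m.
        let S = (1/2) \<cdot>\<^sub>m (D + D\<^sup>T);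
            N = (1/2) \<cdot>\<^sub>m (D - D\<^sup>T);
            \<Gamma> = four_block_mat J G (- G\<^sup>T) N
        in four_block_mat A B C D =
             four_block_mat ((J - R) * Q) (G - P) ((G + P)\<^sup>T * Q) (S + N) \<and>
           \<Gamma> = - \<Gamma>\<^sup>T \<and>
           Q\<^sup>T * E = E\<^sup>T * Q \<and> psd (E\<^sup>T * Q) \<and>
           psd (four_block_mat (Q\<^sup>T * R * Q) (Q\<^sup>T * P) (P\<^sup>T * Q) S))"

text \<open>
  \<open>pH_realization n' m E' A' B' C' D' E A B C D\<close>: the first quintuple, with state dimension
  \<open>n'\<close>, is a port-Hamiltonian realization of the second. Regularity of \<open>(E', A')\<close> is what makes
  its transfer function exist.
\<close>

definition pH_realization ::
  "nat \<Rightarrow> nat \<Rightarrow> real mat \<Rightarrow> real mat \<Rightarrow> real mat \<Rightarrow> real mat \<Rightarrow> real mat \<Rightarrow>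
   real mat \<Rightarrow> real mat \<Rightarrow> real mat \<Rightarrow> real mat \<Rightarrow> real mat \<Rightarrow> bool" where
  "pH_realization n' m E' A' B' C' D' E A B C D \<longleftrightarrow>
     port_Hamiltonian n' m E' A' B' C' D' \<and> regular E' A' \<and>
     transfer E A B C D = transfer E' A' B' C' D'"

text \<open>
  \<open>d i\<close> is the size of the \<open>i\<close>-th part of the partition of \<open>n\<close>, \<open>1 \<le> i \<le> 5\<close>. The blocks
  \<open>X i j\<close>, \<open>Y i j\<close> are those of \<open>U * E * V\<close>, \<open>U * A * V\<close>; only those occurring in the
  display matter. Orthogonality is written out because \<open>orthogonal_mat\<close> of
  Jordan_Normal_Form does not normalize the columns.
\<close>

definition staircase_form ::
  "nat \<Rightarrow> nat \<Rightarrow> real mat \<Rightarrow> real mat \<Rightarrow> real mat \<Rightarrow> real mat \<Rightarrow> (nat \<Rightarrow> nat) \<Rightarrow>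
   real mat \<Rightarrow> real mat \<Rightarrow> real mat \<Rightarrow> real mat \<Rightarrow> real mat \<Rightarrow> real mat \<Rightarrow> bool" where
  "staircase_form n m E A B C d U V \<E> \<A> \<B> \<C> \<longleftrightarrow>
     n = d 1 + d 2 + d 3 + d 4 + d 5 \<and>
     U \<in> carrier_mat n n \<and> U\<^sup>T * U = 1\<^sub>m n \<and>
     V \<in> carrier_mat n n \<and> V\<^sup>T * V = 1\<^sub>m n \<and>
     \<E> \<in> carrier_mat (d 1) (d 1) \<and> \<A> \<in> carrier_mat (d 1) (d 1) \<and>
     \<B> \<in> carrier_mat (d 1) m \<and> \<C> \<in> carrier_mat m (d 1) \<and>
     (\<exists>X Y :: nat \<Rightarrow> nat \<Rightarrow> real mat. \<exists>B2 B3 C4 C5.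
        let Z = (\<lambda>i j. 0\<^sub>m (d i) (d j));
            Zc = (\<lambda>i j. 0\<^sub>m (d i) (d j));
            p = (\<lambda>\<alpha> \<beta> i j. pencil \<alpha> \<beta> (X i j) (Y i j))
        in
        (\<forall>i \<in> {1..5}. \<forall>j \<in> {1..5}.
           X i j \<in> carrier_mat (d i) (d j) \<and> Y i j \<in> carrier_mat (d i) (d j)) \<and>
        B2 \<in> carrier_mat (d 2) m \<and> B3 \<in> carrier_mat (d 3) m \<and>
        C4 \<in> carrier_mat m (d 4) \<and> C5 \<in> carrier_mat m (d 5) \<and>
        U * E * V = block_mat
          [[\<E>,     Z 1 2, Z 1 3, X 1 4, X 1 5],
           [X 2 1, X 2 2, Z 2 3, X 2 4, X 2 5],
           [X 3 1, X 3 2, X 3 3, X 3 4, X 3 5],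
           [Z 4 1, Z 4 2, Z 4 3, X 4 4, X 4 5],
           [Z 5 1, Z 5 2, Z 5 3, Z 5 4, X 5 5]] \<and>
        U * A * V = block_mat
          [[\<A>,     Z 1 2, Z 1 3, Y 1 4, Y 1 5],
           [Y 2 1, Y 2 2, Z 2 3, Y 2 4, Y 2 5],
           [Y 3 1, Y 3 2, Y 3 3, Y 3 4, Y 3 5],
           [Z 4 1, Z 4 2, Z 4 3, Y 4 4, Y 4 5],
           [Z 5 1, Z 5 2, Z 5 3, Z 5 4, Y 5 5]] \<and>
        U * B = block_mat [[\<B>], [B2], [B3], [0\<^sub>m (d 4) m], [0\<^sub>m (d 5) m]] \<and>
        C * V = block_mat [[\<C>, 0\<^sub>m m (d 2), 0\<^sub>m m (d 3), C4, C5]] \<and>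
        invertible_mat (X 2 2) \<and> invertible_mat (X 4 4) \<and>
        (\<forall>s. invertible_mat (p s 1 3 3)) \<and> (\<forall>s. invertible_mat (p s 1 5 5)) \<and>
        (\<forall>\<alpha> \<beta>. (\<alpha>, \<beta>) \<noteq> (0, 0) \<longrightarrow>
           vec_space.rank (d 1 + d 2 + d 3) (block_mat
             [[pencil \<alpha> \<beta> \<E> \<A>, Zc 1 2,    Zc 1 3,    cmat \<B>],
              [p \<alpha> \<beta> 2 1,       p \<alpha> \<beta> 2 2, Zc 2 3,    cmat B2],
              [p \<alpha> \<beta> 3 1,       p \<alpha> \<beta> 3 2, p \<alpha> \<beta> 3 3, cmat B3]])
           = d 1 + d 2 + d 3) \<and>
        completely_observable (d 1) m \<E> \<A> \<C>)"

end

theory Submission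
  imports Defs
begin

text \<open>
  A regular, completely controllable and completely observable system is port-Hamiltonian with
  invertible \<open>Q = X\<close> as soon as \<open>E\<^sup>T X = X\<^sup>T E \<ge> 0\<close> and \<open>(X x) \<bullet> (A x + B u) \<le> u \<bullet> (C x + D u)\<close> for all
  \<open>x\<close>, \<open>u\<close>; observability makes every such \<open>X\<close> invertible. To find \<open>X\<close>, note that minimality turns
  eigenvalues of \<open>s E - A\<close> into poles, so a positive real system has none in the open right half
  plane, and the Cayley transform \<open>s = (1 - z) / (1 + z)\<close> yields a discrete-time system which is
  passive. Its available storage is a quadratic form on the range of \<open>E\<close>, finite because every such
  state is reachable, and it gives the inequality for those \<open>(x, u)\<close> for which \<open>A x + B u\<close> lies in
  the range of \<open>E\<close>. As \<open>D + D\<^sup>T \<ge> 0\<close> and \<open>[E B]\<close> has full row rank, a positive semidefinite completion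
  extends it to all \<open>(x, u)\<close>.

  In a staircase form the blocks outside the first row and column do not contribute to the transfer
  function. Part (ii) reduces to part (i), since \<open>\<W>\<^sup>T \<E> = 0\<close> implies
  \<open>\<W>\<^sup>T \<A> (s \<E> - \<A>)\<inverse> \<B> = - \<W>\<^sup>T \<B>\<close>.
\<close>

section \<open>Linear algebra\<close>

hide_const (open) Determinants.det Cartesian_Space.rank Finite_Cartesian_Product.mat
no_notation Inner_Product.real_inner_class.inner (infix \<open>\<bullet>\<close> 70)
no_notation Finite_Cartesian_Product.vec_nth (infixl \<open>$\<close> 90)
no_notation fps_nth (infixl \<open>$\<close> 75)

text \<open>The obstacle is a singular \<open>E\<close>: the transfer function may then have a pole
  at infinity and the response may involve derivatives of the input, so the state-space theory of
  passive systems does not apply directly. The Cayley map sends infinity to \<open>z = -1\<close>,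
  on the unit circle together with the imaginary axis, and \<open>s = 1\<close> to
  \<open>z = 0\<close>. The discrete system therefore needs only the inverse of
  \<open>E - A\<close>, is an ordinary recursion, and is estimated on circles of radius
  \<open>r < 1\<close>, where no pole is left. The storage is a supremum over real inputs, so it is
  real by construction and no Riccati equation has to be solved. It sees \<open>x\<close> only
  through \<open>E x\<close>, hence says nothing about pairs for which \<open>A x + B u\<close>
  leaves the range of \<open>E\<close>. For those pairs \<open>D + D\<^sup>T \<ge> 0\<close> is a
  genuine extra demand: with singular \<open>E\<close> the term
  \<open>C (s E - A)\<inverse> B\<close> can contribute a constant at infinity, and then positive
  realness does not force the demand on \<open>D\<close>.\<close>

lemma mult_mat_vec_add:
  "dim_vec v = dim_col A \<Longrightarrow> dim_vec w = dim_col A \<Longrightarrow> A *\<^sub>v (v + w) = A *\<^sub>v v + A *\<^sub>v w"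
  for A :: "'a :: comm_ring_1 mat"
  by (rule mult_add_distrib_mat_vec[of A "dim_row A" "dim_col A"]) (auto intro: carrier_vecI)

lemma mult_mat_vec_minus:
  "dim_vec v = dim_col A \<Longrightarrow> dim_vec w = dim_col A \<Longrightarrow> A *\<^sub>v (v - w) = A *\<^sub>v v - A *\<^sub>v w"
  for A :: "'a :: comm_ring_1 mat"
  by (rule mult_minus_distrib_mat_vec[of A "dim_row A" "dim_col A"]) (auto intro: carrier_vecI)

lemma mult_mat_vec_smult:
  "dim_vec v = dim_col A \<Longrightarrow> A *\<^sub>v (k \<cdot>\<^sub>v v) = k \<cdot>\<^sub>v (A *\<^sub>v v)"
  for A :: "'a :: comm_ring_1 mat"
  by (intro eq_vecI) (auto simp: scalar_prod_def sum_distrib_left algebra_simps intro!: sum.cong)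

lemma mult_mat_vec_uminus:
  "dim_vec v = dim_col A \<Longrightarrow> A *\<^sub>v (- v) = - (A *\<^sub>v v)"
  for A :: "'a :: comm_ring_1 mat"
  by (intro eq_vecI) (auto simp: scalar_prod_def sum_negf)

lemma mult_mat_vec_zero:
  "n = dim_col A \<Longrightarrow> A *\<^sub>v 0\<^sub>v n = 0\<^sub>v (dim_row A)"
  for A :: "'a :: comm_ring_1 mat"
  by (intro eq_vecI) (auto simp: scalar_prod_def)

lemma zero_mult_mat_vec:
  "dim_vec v = k \<Longrightarrow> 0\<^sub>m n k *\<^sub>v v = 0\<^sub>v n"
  for v :: "'a :: comm_ring_1 vec"
  by (intro eq_vecI) (auto simp: scalar_prod_def)

lemma add_mult_mat_vec:
  "dim_row A = dim_row B \<Longrightarrow> dim_col A = dim_col B \<Longrightarrow> dim_vec v = dim_col B \<Longrightarrow>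
   (A + B) *\<^sub>v v = A *\<^sub>v v + B *\<^sub>v v"
  for A :: "'a :: comm_ring_1 mat"
  by (rule add_mult_distrib_mat_vec[of A "dim_row A" "dim_col A"]) (auto intro: carrier_vecI)

lemma minus_mult_mat_vec:
  "dim_row A = dim_row B \<Longrightarrow> dim_col A = dim_col B \<Longrightarrow> dim_vec v = dim_col B \<Longrightarrow>
   (A - B) *\<^sub>v v = A *\<^sub>v v - B *\<^sub>v v"
  for A :: "'a :: comm_ring_1 mat"
  by (rule minus_mult_distrib_mat_vec[of A "dim_row A" "dim_col A"]) (auto intro: carrier_vecI)

lemma smult_mult_mat_vec:
  "dim_vec v = dim_col A \<Longrightarrow> (k \<cdot>\<^sub>m A) *\<^sub>v v = k \<cdot>\<^sub>v (A *\<^sub>v v)"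
  for A :: "'a :: comm_ring_1 mat"
  by (intro eq_vecI) (auto simp: scalar_prod_def sum_distrib_left algebra_simps intro!: sum.cong)

lemma uminus_mult_mat_vec':
  "dim_vec v = dim_col A \<Longrightarrow> (- A) *\<^sub>v v = - (A *\<^sub>v v)"
  for A :: "'a :: comm_ring_1 mat"
  by simp

lemma mult_mult_mat_vec:
  "dim_col A = dim_row B \<Longrightarrow> dim_vec v = dim_col B \<Longrightarrow> (A * B) *\<^sub>v v = A *\<^sub>v (B *\<^sub>v v)"
  for A :: "'a :: comm_ring_1 mat"
  by (rule assoc_mult_mat_vec[of A "dim_row A" "dim_row B" B "dim_col B"]) (auto intro: carrier_vecI)

lemma one_mult_mat_vec': "dim_vec v = n \<Longrightarrow> 1\<^sub>m n *\<^sub>v v = v"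
  for v :: "'a :: comm_ring_1 vec"
  by (auto intro: carrier_vecI)

lemma minus_self_vec: "dim_vec v = n \<Longrightarrow> v - v = 0\<^sub>v n"
  for v :: "'a :: comm_ring_1 vec"
  by (auto simp: vec_eq_iff)

lemmas mat_vec_distribs = minus_self_vec mult_mat_vec_add mult_mat_vec_minus mult_mat_vec_smult
  mult_mat_vec_uminus mult_mat_vec_zero zero_mult_mat_vec add_mult_mat_vec minus_mult_mat_vec
  smult_mult_mat_vec uminus_mult_mat_vec' mult_mult_mat_vec one_mult_mat_vec'

lemma scalar_prod_distribs:
  fixes u v w :: "'a :: comm_ring_1 vec"
  shows "dim_vec u = dim_vec w \<Longrightarrow> dim_vec v = dim_vec w \<Longrightarrow> (u + v) \<bullet> w = u \<bullet> w + v \<bullet> w"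
    and "dim_vec u = dim_vec w \<Longrightarrow> dim_vec v = dim_vec w \<Longrightarrow> (u - v) \<bullet> w = u \<bullet> w - v \<bullet> w"
    and "dim_vec u = dim_vec w \<Longrightarrow> dim_vec v = dim_vec w \<Longrightarrow> w \<bullet> (u + v) = w \<bullet> u + w \<bullet> v"
    and "dim_vec u = dim_vec w \<Longrightarrow> dim_vec v = dim_vec w \<Longrightarrow> w \<bullet> (u - v) = w \<bullet> u - w \<bullet> v"
    and "dim_vec u = dim_vec w \<Longrightarrow> (- u) \<bullet> w = - (u \<bullet> w)"
    and "dim_vec u = dim_vec w \<Longrightarrow> u \<bullet> (- w) = - (u \<bullet> w)"
    and "dim_vec u = dim_vec w \<Longrightarrow> (k \<cdot>\<^sub>v u) \<bullet> w = k * (u \<bullet> w)"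
    and "dim_vec u = dim_vec w \<Longrightarrow> u \<bullet> (k \<cdot>\<^sub>v w) = k * (u \<bullet> w)"
    and "dim_vec u = n \<Longrightarrow> u \<bullet> 0\<^sub>v n = 0"
    and "dim_vec u = n \<Longrightarrow> 0\<^sub>v n \<bullet> u = 0"
  by (auto simp: scalar_prod_def algebra_simps sum.distrib sum_subtractf sum_negf sum_distrib_left
      intro!: sum.cong)

lemma scalar_prod_commute:
  "dim_vec u = dim_vec v \<Longrightarrow> u \<bullet> v = v \<bullet> (u :: 'a :: comm_ring_1 vec)"
  by (auto simp: scalar_prod_def algebra_simps)

lemma transpose_mult_scalar_prod:
  fixes A :: "'a :: comm_ring_1 mat"
  assumes "dim_vec x = dim_col A" "dim_vec y = dim_row A"
  shows "(A\<^sup>T *\<^sub>v y) \<bullet> x = y \<bullet> (A *\<^sub>v x)" "x \<bullet> (A\<^sup>T *\<^sub>v y) = y \<bullet> (A *\<^sub>v x)"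
proof -
  show *: "(A\<^sup>T *\<^sub>v y) \<bullet> x = y \<bullet> (A *\<^sub>v x)"
    by (rule transpose_vec_mult_scalar[of A "dim_row A" "dim_col A"])
       (use assms in \<open>auto intro: carrier_vecI\<close>)
  show "x \<bullet> (A\<^sup>T *\<^sub>v y) = y \<bullet> (A *\<^sub>v x)"
    unfolding *[symmetric] by (rule scalar_prod_commute) (use assms in auto)
qed

lemma vec_eq_zero_if_orthogonal:
  fixes x :: "'a :: comm_ring_1 vec"
  assumes "x \<in> carrier_vec n" "\<And>y. y \<in> carrier_vec n \<Longrightarrow> y \<bullet> x = 0"
  shows "x = 0\<^sub>v n"
proof (rule eq_vecI)
  fix i assume "i < dim_vec (0\<^sub>v n :: 'a vec)"
  then show "x $ i = 0\<^sub>v n $ i"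
    using assms(2)[of "unit_vec n i"] assms(1) by auto
qed (use assms in auto)

lemma mat_eq_if_mult_vec_eq:
  fixes A B :: "'a :: comm_ring_1 mat"
  assumes A: "A \<in> carrier_mat n k" and B: "B \<in> carrier_mat n k"
    and eq: "\<And>v. v \<in> carrier_vec k \<Longrightarrow> A *\<^sub>v v = B *\<^sub>v v"
  shows "A = B"
proof (rule eq_matI)
  fix i j assume ij: "i < dim_row B" "j < dim_col B"
  have "(A *\<^sub>v unit_vec k j) $ i = (B *\<^sub>v unit_vec k j) $ i" using eq by simp
  then show "A $$ (i, j) = B $$ (i, j)" using ij A B by auto
qed (use A B in auto)

section \<open>Generalized inverses and factorization through a kernel\<close>

text \<open>Induction on the number of columns, an algebraic version of Greville's recursion: it
  works over any field and needs neither rank nor a choice of bases.\<close>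

lemma generalized_inverse_aux:
  fixes a :: "nat \<Rightarrow> nat \<Rightarrow> 'a :: field"
  shows "\<exists>g. \<forall>i<p. \<forall>j<q. (\<Sum>k<q. a i k * (\<Sum>l<p. g k l * a l j)) = a i j"
proof (induction q)
  case 0
  then show ?case by simp
next
  case (Suc q)
  then obtain g where g: "\<And>i j. i < p \<Longrightarrow> j < q \<Longrightarrow> (\<Sum>k<q. a i k * (\<Sum>l<p. g k l * a l j)) = a i j"
    by blast
  \<comment> \<open>The part of the new column that the inverse of the earlier columns fails to
    reproduce. If it vanishes, a zero row extends \<open>g\<close>.\<close>
  define e where "e i = a i q - (\<Sum>k<q. a i k * (\<Sum>l<p. g k l * a l q))" for i
  show ?case
  proof (cases "\<forall>i<p. e i = 0")
    case True
    define g' where "g' k l = (if k = q then 0 else g k l)" for k l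
    have "(\<Sum>k<Suc q. a i k * (\<Sum>l<p. g' k l * a l j)) = a i j" if "i < p" "j < Suc q" for i j
    proof -
      have "(\<Sum>k<Suc q. a i k * (\<Sum>l<p. g' k l * a l j)) = (\<Sum>k<q. a i k * (\<Sum>l<p. g k l * a l j))"
        by (simp add: g'_def)
      also have "\<dots> = a i j"
      proof (cases "j = q")
        case True
        have "e i = 0" using \<open>\<forall>i<p. e i = 0\<close> that by blast
        from this[unfolded e_def right_minus_eq] show ?thesis unfolding True by (rule sym)
      next
        case False
        then show ?thesis using g[of i j] that by linarith
      qed
      finally show ?thesis .
    qed
    then show ?thesis by blast
  next
    case False
    then obtain i0 where i0: "i0 < p" "e i0 \<noteq> 0" by blast
    \<comment> \<open>Row \<open>i0\<close> of \<open>1 - a g\<close>, scaled at a pivot of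
      \<open>e\<close>: a functional that kills the old columns and takes the value 1 on the new
      one.\<close>
    define h where "h l = ((if l = i0 then 1 else 0) - (\<Sum>k<q. a i0 k * g k l)) / e i0" for l
    have ha: "(\<Sum>l<p. h l * a l j) = (a i0 j - (\<Sum>k<q. a i0 k * (\<Sum>l<p. g k l * a l j))) / e i0" for j
    proof -
      have "(\<Sum>l<p. h l * a l j) =
        (\<Sum>l<p. ((if l = i0 then a l j else 0) - (\<Sum>k<q. a i0 k * (g k l * a l j))) / e i0)"
        by (rule sum.cong) (auto simp: h_def sum_distrib_right left_diff_distrib mult.assoc)
      also have "\<dots> = (a i0 j - (\<Sum>l<p. \<Sum>k<q. a i0 k * (g k l * a l j))) / e i0"
        using i0 by (simp add: sum_divide_distrib[symmetric] sum_subtractf)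
      also have "(\<Sum>l<p. \<Sum>k<q. a i0 k * (g k l * a l j)) = (\<Sum>k<q. a i0 k * (\<Sum>l<p. g k l * a l j))"
        by (subst sum.swap) (simp add: sum_distrib_left)
      finally show ?thesis .
    qed
    have h0: "(\<Sum>l<p. h l * a l j) = 0" if "j < q" for j
      using g[OF i0(1) that] by (simp add: ha)
    have h1: "(\<Sum>l<p. h l * a l q) = 1"
      using i0 by (simp add: ha e_def)
    define c where "c k = (\<Sum>r<p. g k r * a r q)" for k
    \<comment> \<open>The new row is \<open>h\<close>; the correction by \<open>c\<close> removes
      what the old rows would contribute on the new column.\<close>
    define g' where "g' k l = (if k = q then h l else g k l - c k * h l)" for k l
    have "(\<Sum>k<Suc q. a i k * (\<Sum>l<p. g' k l * a l j)) = a i j" if ij: "i < p" "j < Suc q" for i j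
    proof -
      have *: "(\<Sum>l<p. g' k l * a l j) = (\<Sum>l<p. g k l * a l j) - c k * (\<Sum>l<p. h l * a l j)" if "k < q" for k
        using that by (simp add: g'_def left_diff_distrib sum_subtractf sum_distrib_left mult.assoc)
      have "(\<Sum>k<Suc q. a i k * (\<Sum>l<p. g' k l * a l j)) =
         (\<Sum>k<q. a i k * ((\<Sum>l<p. g k l * a l j) - c k * (\<Sum>l<p. h l * a l j))) + a i q * (\<Sum>l<p. h l * a l j)"
        using * by (simp add: g'_def)
      also have "\<dots> = a i j"
      proof (cases "j = q")
        case True
        then show ?thesis using h1 by (simp add: c_def)
      next
        case False
        then show ?thesis using ij g h0 by simp
      qed
      finally show ?thesis .
    qed
    then show ?thesis by blast
  qed
qed

lemma generalized_inverse:
  fixes A :: "'a :: field mat"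
  assumes A: "A \<in> carrier_mat p q"
  obtains G where "G \<in> carrier_mat q p" "A * G * A = A"
proof -
  obtain g where g: "\<forall>i<p. \<forall>j<q. (\<Sum>k<q. A $$ (i, k) * (\<Sum>l<p. g k l * A $$ (l, j))) = A $$ (i, j)"
    using generalized_inverse_aux[of p q "\<lambda>i j. A $$ (i, j)"] by blast
  define G where "G = mat q p (\<lambda>(k, l). g k l)"
  have G: "G \<in> carrier_mat q p" by (simp add: G_def)
  have "A * (G * A) = A"
    by (rule eq_matI) (use A g in \<open>auto simp: G_def scalar_prod_def atLeast0LessThan\<close>)
  then have "A * G * A = A" using A G by simp
  with G that show thesis by blast
qed

text \<open>With a generalized inverse \<open>G\<close>, the vector \<open>v - G A v\<close> lies in
  the kernel of \<open>A\<close>, hence in that of \<open>B\<close>, so \<open>K = B G\<close>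
  works.\<close>

lemma factor_if_kernel_subset:
  fixes A B :: "'a :: field mat"
  assumes A: "A \<in> carrier_mat p q" and B: "B \<in> carrier_mat r q"
    and ker: "\<And>v. v \<in> carrier_vec q \<Longrightarrow> A *\<^sub>v v = 0\<^sub>v p \<Longrightarrow> B *\<^sub>v v = 0\<^sub>v r"
  obtains K where "K \<in> carrier_mat r p" "B = K * A"
proof -
  obtain G where G: "G \<in> carrier_mat q p" "A * G * A = A" using generalized_inverse[OF A] .
  have "B = B * G * A"
  proof (rule mat_eq_if_mult_vec_eq[of _ r q])
    fix v :: "'a vec" assume v: "v \<in> carrier_vec q"
    have "A *\<^sub>v (v - (G * A) *\<^sub>v v) = A *\<^sub>v v - (A * G * A) *\<^sub>v v"
      using v A G(1) by (simp add: mat_vec_distribs)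
    also have "\<dots> = 0\<^sub>v p" using G(2) v A by simp
    finally have "B *\<^sub>v (v - (G * A) *\<^sub>v v) = 0\<^sub>v r" using ker v A G by simp
    then have "B *\<^sub>v v - (B * G * A) *\<^sub>v v = 0\<^sub>v r"
      using v A G(1) B by (simp add: mat_vec_distribs)
    then show "B *\<^sub>v v = (B * G * A) *\<^sub>v v"
      using v A G(1) B by (auto simp: vec_eq_iff)
  qed (use A B G in auto)
  then show thesis using that[of "B * G"] B G by simp
qed

text \<open>A trivial kernel of \<open>A\<^sup>T\<close> lets the identity factor through
  \<open>A\<^sup>T\<close>; transposing the factorization gives the right inverse.\<close>

lemma right_inverse_if_left_kernel_trivial:
  fixes A :: "'a :: field mat"
  assumes A: "A \<in> carrier_mat p q"
    and ker: "\<And>y. y \<in> carrier_vec p \<Longrightarrow> A\<^sup>T *\<^sub>v y = 0\<^sub>v q \<Longrightarrow> y = 0\<^sub>v p"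
  obtains G where "G \<in> carrier_mat q p" "A * G = 1\<^sub>m p"
proof -
  have "\<And>v. v \<in> carrier_vec p \<Longrightarrow> A\<^sup>T *\<^sub>v v = 0\<^sub>v q \<Longrightarrow> 1\<^sub>m p *\<^sub>v v = 0\<^sub>v p"
    using ker by simp
  then obtain K where K: "K \<in> carrier_mat p q" "1\<^sub>m p = K * A\<^sup>T"
    using factor_if_kernel_subset[of "A\<^sup>T" q p "1\<^sub>m p :: 'a mat" p] A by auto
  have "A * K\<^sup>T = (K * A\<^sup>T)\<^sup>T" using A K(1) by (subst transpose_mult) auto
  also have "\<dots> = 1\<^sub>m p" unfolding K(2)[symmetric] by simp
  finally show thesis using that[of "K\<^sup>T"] K by simp
qed

section \<open>Full rank expressed by trivial kernels\<close>

lemma (in vec_space) kernel_trivial_if_full_column_rank: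
  assumes A: "A \<in> carrier_mat n nc" and "rank A = nc" and v: "v \<in> carrier_vec nc" "A *\<^sub>v v = 0\<^sub>v n"
  shows "v = 0\<^sub>v nc"
proof (rule ccontr)
  assume v0: "v \<noteq> 0\<^sub>v nc"
  \<comment> \<open>Rank is computed from the set of columns, in which repeated columns collapse. A
    repetition would leave fewer than \<open>nc\<close> vectors, so full rank excludes it before
    independence can be used.\<close>
  have "distinct (cols A)"
  proof (rule ccontr)
    assume "\<not> distinct (cols A)"
    then have "card (set (cols A)) < nc"
      using A by (metis card_distinct card_length carrier_matD(2) cols_length le_neq_implies_less)
    moreover obtain S where S: "maximal S (\<lambda>T. T \<subseteq> set (cols A) \<and> lin_indpt T)"
      using maximal_exists[of "(\<lambda>T. T \<subseteq> set (cols A) \<and> lin_indpt T)" "card (set (cols A))" "{}"]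
      by (meson List.finite_set card_mono empty_iff empty_subsetI finite_lin_indpt2 rev_finite_subset)
    then have "card S \<le> card (set (cols A))" by (simp add: card_mono maximal_def)
    ultimately show False using rank_card_indpt[OF A S] assms by simp
  qed
  then show False
    using full_rank_lin_indpt[OF A] lin_depI[OF A v(1) v0 v(2)] assms by blast
qed

text \<open>A maximal independent set of columns has \<open>n\<close> elements and is a basis;
  \<open>y\<close> pairs to zero with each of them, hence with every vector.\<close>

lemma (in vec_space) left_kernel_trivial_if_full_row_rank:
  assumes A: "A \<in> carrier_mat n nc" and r: "rank A = n"
    and y: "y \<in> carrier_vec n" "A\<^sup>T *\<^sub>v y = 0\<^sub>v nc"
  shows "y = 0\<^sub>v n"
proof -
  obtain S where S: "maximal S (\<lambda>T. T \<subseteq> set (cols A) \<and> lin_indpt T)"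
    using maximal_exists[of "(\<lambda>T. T \<subseteq> set (cols A) \<and> lin_indpt T)" "card (set (cols A))" "{}"]
    by (meson List.finite_set card_mono empty_iff empty_subsetI finite_lin_indpt2 rev_finite_subset)
  have SA: "S \<subseteq> set (cols A)" and li: "lin_indpt S" using S by (auto simp: maximal_def)
  have Sc: "S \<subseteq> carrier_vec n" using SA A cols_dim by blast
  have fin: "finite S" using SA finite_subset by blast
  have card: "card S = n" using rank_card_indpt[OF A S] r by simp
  have "basis S"
    by (rule dim_li_is_basis) (use Sc li fin card dim_is_n in auto)
  then have span: "span S = carrier_vec n" by (simp add: basis_def)
  have orth: "y \<bullet> c = 0" if cS: "c \<in> S" for c
  proof -
    obtain j where j: "j < nc" "c = col A j"
      using subsetD[OF SA cS] A by (auto simp: cols_def)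
    have "(A\<^sup>T *\<^sub>v y) $ j = 0" using y j by simp
    then have "c \<bullet> y = 0" using j A by simp
    then show ?thesis using j A y scalar_prod_commute[of c y] by simp
  qed
  have "x \<bullet> y = 0" if x: "x \<in> carrier_vec n" for x
  proof -
    from x span have "x \<in> span S" by simp
    then obtain a where a: "x = lincomb a S" using finite_in_span[OF fin Sc, of x] by auto
    have f: "(\<lambda>c. a c \<cdot>\<^sub>v c) \<in> S \<rightarrow> carrier_vec n" using Sc by auto
    have "x \<bullet> y = (\<Sum>c\<in>S. (a c \<cdot>\<^sub>v c) \<bullet> y)"
      unfolding a lincomb_def using finsum_scalar_prod_sum[OF f y(1)] by simp
    also have "\<dots> = 0"
    proof (rule sum.neutral, rule ballI)
      fix c assume c: "c \<in> S"
      then have "c \<in> carrier_vec n" using Sc by blast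
      then show "(a c \<cdot>\<^sub>v c) \<bullet> y = 0"
        using orth[OF c] y scalar_prod_commute[of c y] by (simp add: scalar_prod_distribs)
    qed
    finally show ?thesis .
  qed
  then show ?thesis by (intro vec_eq_zero_if_orthogonal[OF y(1)])
qed

section \<open>Polynomials acting on a vector, and eigenvectors in Krylov spaces\<close>

text \<open>This is \<open>p(N) v\<close> by Horner's scheme on vectors, which avoids powers of
  matrices.\<close>

definition poly_act :: "'a :: field mat \<Rightarrow> 'a vec \<Rightarrow> 'a poly \<Rightarrow> 'a vec" where
  "poly_act N v p = fold_coeffs (\<lambda>a w. a \<cdot>\<^sub>v v + N *\<^sub>v w) p (0\<^sub>v (dim_vec v))"

context
  fixes N :: "'a :: field mat" and v :: "'a vec" and n :: nat
  assumes N: "N \<in> carrier_mat n n" and v: "v \<in> carrier_vec n"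
begin

lemma poly_act_0: "poly_act N v 0 = 0\<^sub>v n"
  using v by (simp add: poly_act_def)

lemma poly_act_pCons: "poly_act N v (pCons a p) = a \<cdot>\<^sub>v v + N *\<^sub>v poly_act N v p"
proof (cases "a = 0 \<and> p = 0")
  case True
  then show ?thesis using v N by (auto simp: poly_act_0 mat_vec_distribs)
next
  case False
  then show ?thesis by (auto simp: poly_act_def)
qed

lemma poly_act_carrier: "poly_act N v p \<in> carrier_vec n"
  by (induction p) (use N v in \<open>auto simp: poly_act_0 poly_act_pCons\<close>)

lemma iterate_mult_mat_vec_carrier: "((\<lambda>w. N *\<^sub>v w) ^^ k) v \<in> carrier_vec n"
  by (induction k) (use N v in auto)

text \<open>The link between Horner's scheme and the Krylov vectors. The bound \<open>m\<close> is
  free above the degree, so that polynomials of different degrees can be compared in sums of equal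
  length.\<close>

lemma poly_act_index:
  "i < n \<Longrightarrow> (\<And>k. k \<ge> m \<Longrightarrow> coeff p k = 0) \<Longrightarrow>
   poly_act N v p $ i = (\<Sum>k<m. coeff p k * ((\<lambda>w. N *\<^sub>v w) ^^ k) v $ i)"
proof (induction p arbitrary: i m)
  case 0
  then show ?case by (simp add: poly_act_0)
next
  case (pCons a p)
  show ?case
  proof (cases m)
    case 0
    then have "pCons a p = 0" using pCons.prems(2) by (intro poly_eqI) auto
    then show ?thesis using pCons.hyps by auto
  next
    case (Suc m')
    have c: "coeff p k = 0" if "k \<ge> m'" for k
      using pCons.prems(2)[of "Suc k"] Suc that by simp
    have "(N *\<^sub>v poly_act N v p) $ i = (\<Sum>j<n. N $$ (i, j) * poly_act N v p $ j)"
      using pCons.prems(1) N poly_act_carrier[of p]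
      by (auto simp: scalar_prod_def atLeast0LessThan intro!: sum.cong)
    also have "\<dots> = (\<Sum>j<n. \<Sum>k<m'. coeff p k * (N $$ (i, j) * ((\<lambda>w. N *\<^sub>v w) ^^ k) v $ j))"
      using pCons.IH[OF _ c] by (auto simp: sum_distrib_left algebra_simps intro!: sum.cong)
    also have "\<dots> = (\<Sum>k<m'. coeff p k * (\<Sum>j<n. N $$ (i, j) * ((\<lambda>w. N *\<^sub>v w) ^^ k) v $ j))"
      by (subst sum.swap) (simp add: sum_distrib_left)
    also have "\<dots> = (\<Sum>k<m'. coeff p k * ((\<lambda>w. N *\<^sub>v w) ^^ Suc k) v $ i)"
    proof (rule sum.cong[OF refl])
      fix k
      show "coeff p k * (\<Sum>j<n. N $$ (i, j) * ((\<lambda>w. N *\<^sub>v w) ^^ k) v $ j) =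
        coeff p k * ((\<lambda>w. N *\<^sub>v w) ^^ Suc k) v $ i"
        using pCons.prems(1) N iterate_mult_mat_vec_carrier[of k]
        by (auto simp: scalar_prod_def atLeast0LessThan)
    qed
    finally have *: "(N *\<^sub>v poly_act N v p) $ i = \<dots>" .
    have "poly_act N v (pCons a p) $ i = a * v $ i + (N *\<^sub>v poly_act N v p) $ i"
      using pCons.prems(1) N v poly_act_carrier[of p] by (auto simp: poly_act_pCons)
    then show ?thesis unfolding * Suc by (subst sum.lessThan_Suc_shift) simp
  qed
qed

text \<open>Splitting off a root \<open>e\<close> of an annihilating polynomial acts as
  \<open>N - e\<close>; this is what produces an eigenvector.\<close>

lemma poly_act_linear_factor:
  "poly_act N v ([:- e, 1:] * q) = N *\<^sub>v poly_act N v q - e \<cdot>\<^sub>v poly_act N v q"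
proof (rule eq_vecI)
  fix i assume "i < dim_vec (N *\<^sub>v poly_act N v q - e \<cdot>\<^sub>v poly_act N v q)"
  then have i: "i < n" using poly_act_carrier[of q] by auto
  define m where "m = Suc (Suc (degree q))"
  have [simp]: "coeff q k = 0" if "k \<ge> Suc (degree q)" for k
    using that by (simp add: coeff_eq_0)
  have "poly_act N v ([:- e, 1:] * q) $ i =
      (\<Sum>k<m. coeff ([:- e, 1:] * q) k * ((\<lambda>w. N *\<^sub>v w) ^^ k) v $ i)"
    by (rule poly_act_index[OF i]) (auto simp: m_def coeff_pCons split: nat.splits)
  also have "\<dots> = (\<Sum>k<m. coeff (pCons 0 q) k * ((\<lambda>w. N *\<^sub>v w) ^^ k) v $ i)
      - e * (\<Sum>k<m. coeff q k * ((\<lambda>w. N *\<^sub>v w) ^^ k) v $ i)"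
    by (simp add: algebra_simps sum_subtractf sum_distrib_left sum.distrib)
  also have "(\<Sum>k<m. coeff (pCons 0 q) k * ((\<lambda>w. N *\<^sub>v w) ^^ k) v $ i) = poly_act N v (pCons 0 q) $ i"
    by (rule poly_act_index[OF i, symmetric]) (auto simp: m_def coeff_pCons split: nat.splits)
  also have "(\<Sum>k<m. coeff q k * ((\<lambda>w. N *\<^sub>v w) ^^ k) v $ i) = poly_act N v q $ i"
    by (rule poly_act_index[OF i, symmetric]) (auto simp: m_def)
  also have "poly_act N v (pCons 0 q) = N *\<^sub>v poly_act N v q"
    using v N by (auto simp: poly_act_pCons)
  finally show "poly_act N v ([:- e, 1:] * q) $ i = (N *\<^sub>v poly_act N v q - e \<cdot>\<^sub>v poly_act N v q) $ i"
    using i poly_act_carrier[of q] by auto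
qed (use N carrier_vecD[OF poly_act_carrier] in \<open>simp del: mult_pCons_left\<close>)

lemma annihilating_poly:
  obtains p where "p \<noteq> 0" "degree p \<le> n" "poly_act N v p = 0\<^sub>v n"
proof -
  \<comment> \<open>The columns are the \<open>n + 1\<close> Krylov vectors, padded by a zero row to
    make the matrix square. Its determinant vanishes, and a kernel vector lists the coefficients of
    the polynomial.\<close>
  define M where "M = mat (Suc n) (Suc n) (\<lambda>(i, k). if i < n then ((\<lambda>w. N *\<^sub>v w) ^^ k) v $ i else 0)"
  have M: "M \<in> carrier_mat (Suc n) (Suc n)" by (simp add: M_def)
  have "M\<^sup>T *\<^sub>v unit_vec (Suc n) n = 0\<^sub>v (Suc n)"
    by (rule eq_vecI) (use M in \<open>auto simp: M_def\<close>)
  then have "det M\<^sup>T = 0"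
    using det_0_iff_vec_prod_zero_field[of "M\<^sup>T" "Suc n"] M unit_vec_carrier unit_vec_nonzero
    by (metis lessI transpose_carrier_mat)
  then have "det M = 0" using det_transpose[OF M] by simp
  then obtain c where c: "c \<in> carrier_vec (Suc n)" "c \<noteq> 0\<^sub>v (Suc n)" "M *\<^sub>v c = 0\<^sub>v (Suc n)"
    using det_0_iff_vec_prod_zero_field[OF M] by blast
  define p where "p = Poly (map (\<lambda>k. c $ k) [0..<Suc n])"
  have coeff: "coeff p k = (if k < Suc n then c $ k else 0)" for k
    unfolding p_def by (auto simp: nth_default_def simp del: upt_Suc)
  have "p \<noteq> 0"
  proof
    assume "p = 0"
    then have "c $ k = 0" if "k < Suc n" for k using coeff[of k] that by simp
    then show False using c by (auto simp: vec_eq_iff)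
  qed
  moreover have "degree p \<le> n" by (rule degree_le) (auto simp: coeff)
  moreover have "poly_act N v p = 0\<^sub>v n"
  proof (rule eq_vecI)
    fix i assume i: "i < dim_vec (0\<^sub>v n :: 'a vec)"
    have "poly_act N v p $ i = (\<Sum>k<Suc n. coeff p k * ((\<lambda>w. N *\<^sub>v w) ^^ k) v $ i)"
      by (rule poly_act_index) (use i in \<open>auto simp: coeff\<close>)
    also have "\<dots> = (\<Sum>k<Suc n. M $$ (i, k) * c $ k)"
      by (rule sum.cong) (use i in \<open>auto simp: coeff M_def\<close>)
    also have "\<dots> = (M *\<^sub>v c) $ i"
      using i M c(1) by (auto simp: scalar_prod_def atLeast0LessThan intro!: sum.cong)
    finally show "poly_act N v p $ i = 0\<^sub>v n $ i" using c(3) i by simp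
  qed (use poly_act_carrier in auto)
  ultimately show thesis using that by blast
qed

end

text \<open>Take an annihilating polynomial \<open>p\<close> of least degree, a root
  \<open>e\<close> and \<open>p = (X - e) q\<close>. Then \<open>w = q(N) v\<close> is nonzero by
  minimality and \<open>(N - e) w = 0\<close>. The sum stops before \<open>n\<close> because
  \<open>q\<close> has smaller degree than \<open>p\<close>. Thus invariant subspaces can be tested
  through their Krylov vectors alone.\<close>

lemma eigenvector_in_krylov_space:
  fixes N :: "complex mat"
  assumes N: "N \<in> carrier_mat n n" and v: "v \<in> carrier_vec n" "v \<noteq> 0\<^sub>v n"
  obtains w e c where "w \<in> carrier_vec n" "w \<noteq> 0\<^sub>v n" "N *\<^sub>v w = e \<cdot>\<^sub>v w"
    "w = vec n (\<lambda>i. \<Sum>k<n. c k * ((\<lambda>w. N *\<^sub>v w) ^^ k) v $ i)"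
proof -
  let ?P = "\<lambda>p. p \<noteq> 0 \<and> degree p \<le> n \<and> poly_act N v p = 0\<^sub>v n"
  obtain p0 where "?P p0" using annihilating_poly[OF N v(1)] by blast
  then obtain p where p: "?P p" and least: "\<And>q. ?P q \<Longrightarrow> degree p \<le> degree q"
    using ex_has_least_nat[of ?P p0 degree] by blast
  have "degree p \<noteq> 0"
  proof
    assume "degree p = 0"
    then obtain a where a: "p = [:a:]" by (metis degree_eq_zeroE)
    then have "a \<cdot>\<^sub>v v = 0\<^sub>v n"
      using p N v by (auto simp: poly_act_pCons[OF N v(1)] poly_act_0[OF N v(1)] mat_vec_distribs)
    then have "a * v $ i = 0" if "i < n" for i using that v by (metis carrier_vecD index_smult_vec(1) index_zero_vec(1))
    then have "a = 0" using v by (auto simp: vec_eq_iff)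
    then show False using p a by simp
  qed
  then have "\<not> constant (poly p)" by (simp add: constant_degree)
  then obtain e where "poly p e = 0" using fundamental_theorem_of_algebra by blast
  then obtain q where q: "p = [:- e, 1:] * q" by (metis dvdE poly_eq_0_iff_dvd)
  then have q0: "q \<noteq> 0" using p by auto
  have dq: "degree p = Suc (degree q)"
    unfolding q using q0 by (subst degree_mult_eq) auto
  define w where "w = poly_act N v q"
  have w: "w \<in> carrier_vec n" unfolding w_def by (rule poly_act_carrier[OF N v(1)])
  have "w \<noteq> 0\<^sub>v n" using least[of q] q0 dq p unfolding w_def by auto
  moreover have "N *\<^sub>v w - e \<cdot>\<^sub>v w = 0\<^sub>v n"
    using p q poly_act_linear_factor[OF N v(1), of e q] unfolding w_def by simp
  then have "N *\<^sub>v w = e \<cdot>\<^sub>v w" using w N by (auto simp: vec_eq_iff)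
  moreover have "w = vec n (\<lambda>i. \<Sum>k<n. coeff q k * ((\<lambda>w. N *\<^sub>v w) ^^ k) v $ i)"
  proof (rule eq_vecI)
    fix i assume "i < dim_vec (vec n (\<lambda>i. \<Sum>k<n. coeff q k * ((\<lambda>w. N *\<^sub>v w) ^^ k) v $ i))"
    then show "w $ i = vec n (\<lambda>i. \<Sum>k<n. coeff q k * ((\<lambda>w. N *\<^sub>v w) ^^ k) v $ i) $ i"
      unfolding w_def using dq p by (simp add: poly_act_index[OF N v(1), of _ n] coeff_eq_0)
  qed (use w in auto)
  ultimately show thesis using that w by blast
qed

section \<open>Quadratic forms\<close>

text \<open>Rounding \<open>n t\<close> to an integer shows that \<open>n\<close> times the
  deviation from linearity stays below \<open>2 K\<close> for every \<open>n\<close>.\<close>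

lemma additive_bounded_imp_linear:
  fixes f :: "real \<Rightarrow> real"
  assumes add: "\<And>s t. f (s + t) = f s + f t" and bound: "\<And>t. \<bar>t\<bar> \<le> 1 \<Longrightarrow> \<bar>f t\<bar> \<le> K"
  shows "f t = t * f 1"
proof -
  have f0: "f 0 = 0" using add[of 0 0] by simp
  have fm: "f (- s) = - f s" for s using add[of s "- s"] f0 by simp
  have fnat: "f (real n * s) = real n * f s" for n s
    by (induction n) (auto simp: f0 add algebra_simps)
  have fint: "f (of_int k * s) = of_int k * f s" for k s
  proof (cases "k \<ge> 0")
    case True
    then show ?thesis using fnat[of "nat k" s] by simp
  next
    case False
    then show ?thesis using fnat[of "nat (- k)" s] fm[of "of_int (- k) * s"] by simp
  qed
  have "real n * \<bar>f t - t * f 1\<bar> \<le> 2 * K" for n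
  proof -
    define k where "k = \<lfloor>real n * t\<rfloor>"
    define r where "r = real n * t - of_int k"
    have r: "\<bar>r\<bar> \<le> 1" unfolding r_def k_def by linarith
    have "real n * f t = f (of_int k * 1 + r)" by (simp add: fnat[symmetric] r_def)
    also have "\<dots> = of_int k * f 1 + f r" by (simp only: add fint)
    finally have "real n * (f t - t * f 1) = f r - r * f 1" by (simp add: r_def algebra_simps)
    moreover have "\<bar>f r - r * f 1\<bar> \<le> 2 * K"
    proof -
      have "\<bar>r * f 1\<bar> \<le> 1 * K"
        unfolding abs_mult using r bound[of 1] by (intro mult_mono) auto
      then show ?thesis using bound[OF r] by linarith
    qed
    ultimately show ?thesis by (metis abs_mult abs_of_nat)
  qed
  then have "f t - t * f 1 = 0"
    by (metis reals_Archimedean3 abs_le_zero_iff not_le zero_less_abs_iff)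
  then show ?thesis by simp
qed

text \<open>The argument of Jordan and von Neumann.\<close>

lemma parallelogram_imp_quadratic_form:
  fixes V :: "real vec \<Rightarrow> real"
  assumes nonneg: "\<And>x. x \<in> carrier_vec n \<Longrightarrow> V x \<ge> 0"
    and hom: "\<And>x t. x \<in> carrier_vec n \<Longrightarrow> V (t \<cdot>\<^sub>v x) = t\<^sup>2 * V x"
    and par: "\<And>x y. x \<in> carrier_vec n \<Longrightarrow> y \<in> carrier_vec n \<Longrightarrow>
      V (x + y) + V (x - y) = 2 * V x + 2 * V y"
  obtains P where "P \<in> carrier_mat n n" "P\<^sup>T = P" "\<And>x. x \<in> carrier_vec n \<Longrightarrow> V x = x \<bullet> (P *\<^sub>v x)"
proof -
  define b where "b x y = (V (x + y) - V x - V y) / 2" for x y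
  have b_comm: "b x y = b y x" if "x \<in> carrier_vec n" "y \<in> carrier_vec n" for x y
    using that by (simp add: b_def comm_add_vec[of x n y])
  \<comment> \<open>Additivity of the polar form comes from combining four instances of the
    parallelogram law.\<close>
  have b_add: "b (x + y) z = b x z + b y z"
    if x: "x \<in> carrier_vec n" and y: "y \<in> carrier_vec n" and z: "z \<in> carrier_vec n" for x y z
  proof -
    have e1: "(x + z) + y = x + y + z" "(x + z) - y = x - y + z" "(y + z) + x = x + y + z"
      "(y + z) - x = z - (x - y)" "z + (x - y) = x - y + z"
      using x y z by (auto simp: vec_eq_iff)
    have 1: "V (x + y + z) + V (x - y + z) = 2 * V (x + z) + 2 * V y"
      using par[of "x + z" y] x y z by (simp add: e1)
    have 2: "V (x + y + z) + V (z - (x - y)) = 2 * V (y + z) + 2 * V x"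
      using par[of "y + z" x] x y z by (simp add: e1)
    have 3: "V (x - y + z) + V (z - (x - y)) = 2 * V z + 2 * V (x - y)"
      using par[of z "x - y"] x y z by (simp add: e1)
    have 4: "V (x + y) + V (x - y) = 2 * V x + 2 * V y" using par x y by simp
    show ?thesis unfolding b_def using 1 2 3 4 by (simp add: field_simps)
  qed
  have b_smult: "b (t \<cdot>\<^sub>v x) z = t * b x z" if x: "x \<in> carrier_vec n" and z: "z \<in> carrier_vec n" for t x z
  proof -
    define f where "f t = b (t \<cdot>\<^sub>v x) z" for t
    have add: "f (s + t) = f s + f t" for s t
      unfolding f_def add_smult_distrib_vec using x z by (simp add: b_add)
    have f0: "f 0 = 0" using add[of 0 0] by simp
    have fm: "f (- s) = - f s" for s using add[of s "- s"] f0 by simp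
    \<comment> \<open>Nonnegativity of \<open>V\<close> takes the place of continuity: it bounds
      \<open>f\<close> from below near 0, and oddness turns this into a bound on both sides.\<close>
    have lower: "2 * f t \<ge> - t\<^sup>2 * V x - V z" for t
    proof -
      have "V (t \<cdot>\<^sub>v x + z) \<ge> 0" using nonneg x z by simp
      then show ?thesis using x hom by (simp add: f_def b_def)
    qed
    have "\<bar>f t\<bar> \<le> V x + V z" if t: "\<bar>t\<bar> \<le> 1" for t
    proof -
      have "t\<^sup>2 * V x \<le> 1 * V x"
        using t nonneg[OF x] by (intro mult_right_mono) (auto simp: abs_square_le_1)
      then show ?thesis using lower[of t] lower[of "- t"] fm[of t] nonneg[OF x] nonneg[OF z] by auto
    qed
    from additive_bounded_imp_linear[OF add this] have "f t = t * f 1" .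
    then show ?thesis using x by (simp add: f_def)
  qed
  have V0: "V (0\<^sub>v n) = 0"
  proof -
    have "(0::real) \<cdot>\<^sub>v 0\<^sub>v n = 0\<^sub>v n" by (auto simp: vec_eq_iff)
    then show ?thesis using hom[of "0\<^sub>v n" 0] by simp
  qed
  have b0: "b (0\<^sub>v n) z = 0" if "z \<in> carrier_vec n" for z
    using that by (simp add: b_def V0)
  \<comment> \<open>Truncation to the first \<open>k\<close> coordinates, so that the expansion in
    unit vectors can be obtained by induction.\<close>
  define tr where "tr k x = vec n (\<lambda>i. if i < k then vec_index x i else (0::real))" for k x
  have b_tr: "b (tr k x) z = (\<Sum>i<k. x $ i * b (unit_vec n i) z)"
    if x: "x \<in> carrier_vec n" and z: "z \<in> carrier_vec n" and k: "k \<le> n" for k x z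
    using k
  proof (induction k)
    case 0
    have "tr 0 x = 0\<^sub>v n" by (auto simp: tr_def vec_eq_iff)
    then show ?case using b0 z by simp
  next
    case (Suc k)
    have "tr (Suc k) x = tr k x + x $ k \<cdot>\<^sub>v unit_vec n k"
      using Suc.prems by (auto simp: tr_def vec_eq_iff less_Suc_eq)
    moreover have "tr k x \<in> carrier_vec n" by (simp add: tr_def)
    ultimately show ?case using Suc z by (simp add: b_add b_smult)
  qed
  have b_expand: "b x z = (\<Sum>i<n. x $ i * b (unit_vec n i) z)"
    if "x \<in> carrier_vec n" "z \<in> carrier_vec n" for x z
  proof -
    have "tr n x = x" using that by (auto simp: tr_def vec_eq_iff)
    then show ?thesis using b_tr[OF that, of n] by simp
  qed
  define P where "P = mat n n (\<lambda>(i, j). b (unit_vec n i) (unit_vec n j))"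
  have P: "P \<in> carrier_mat n n" by (simp add: P_def)
  moreover have "P\<^sup>T = P"
    by (auto simp: P_def mat_eq_iff intro!: b_comm)
  moreover have "V x = x \<bullet> (P *\<^sub>v x)" if x: "x \<in> carrier_vec n" for x
  proof -
    have "x + x = 2 \<cdot>\<^sub>v x" by (auto simp: vec_eq_iff)
    then have "V x = b x x" using hom[OF x, of 2] by (simp add: b_def)
    also have "\<dots> = (\<Sum>i<n. x $ i * b x (unit_vec n i))"
      using b_expand[OF x x] b_comm[OF x] by simp
    also have "\<dots> = (\<Sum>i<n. x $ i * (\<Sum>j<n. x $ j * b (unit_vec n j) (unit_vec n i)))"
      by (rule sum.cong) (use b_expand[OF x] in auto)
    also have "\<dots> = x \<bullet> (P *\<^sub>v x)"
      using x b_comm by (auto simp: scalar_prod_def P_def atLeast0LessThan intro!: sum.cong)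
    finally show ?thesis .
  qed
  ultimately show thesis using that by blast
qed

lemma smult_zero_vec_right [simp]: "k \<cdot>\<^sub>v 0\<^sub>v n = (0\<^sub>v n :: 'a :: comm_ring_1 vec)"
  by (auto simp: vec_eq_iff)

lemma affine_nonneg_imp_slope_zero:
  fixes a b :: real
  assumes "\<And>t. a + t * b \<ge> 0"
  shows "b = 0"
proof (rule ccontr)
  assume "b \<noteq> 0"
  then show False using assms[of "- (a + 1) / b"] by simp
qed

text \<open>First-order optimality: 0 is a minimum of the parabola. It is used below for first
  variations of nonnegative forms.\<close>

lemma quadratic_nonneg_imp_linear_zero:
  fixes a b c :: real
  assumes "\<And>t. a * t\<^sup>2 + b * t \<ge> 0"
  shows "b = 0"
proof (rule ccontr)
  assume b: "b \<noteq> 0"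
  \<comment> \<open>A positive bound of the leading coefficient, whatever the sign of
    \<open>a\<close>; \<open>t\<close> is then the minimum of \<open>k t^2 + b t\<close>.\<close>
  define k where "k = \<bar>a\<bar> + 1"
  have k: "k > 0" "a \<le> k" by (auto simp: k_def)
  define t where "t = - b / (2 * k)"
  have "a * t\<^sup>2 + b * t \<le> k * t\<^sup>2 + b * t" using k by (simp add: mult_right_mono)
  also have "\<dots> = - (b\<^sup>2 / (4 * k))"
    using k(1) by (simp add: t_def field_simps power2_eq_square)
  also have "\<dots> < 0" using b k(1) by simp
  finally show False using assms[of t] by simp
qed

text \<open>The missing block of the completion is the one for which, after minimising over the kernel of
  the projection \<open>Pr\<close>, the remaining cross term vanishes.\<close>

lemma psd_completion:
  fixes Q11 Q12 D Pr :: "real mat"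
  assumes Q11: "Q11 \<in> carrier_mat n n" and Q12: "Q12 \<in> carrier_mat n m"
    and D: "D \<in> carrier_mat m m" and Pr: "Pr \<in> carrier_mat m m" "Pr * Pr = Pr"
    and psd1: "\<And>u. u \<in> carrier_vec m \<Longrightarrow> u \<bullet> (D *\<^sub>v u) \<ge> 0"
    and psd2: "\<And>x u. x \<in> carrier_vec n \<Longrightarrow> u \<in> carrier_vec m \<Longrightarrow> Pr *\<^sub>v u = 0\<^sub>v m \<Longrightarrow>
      x \<bullet> (Q11 *\<^sub>v x) + x \<bullet> (Q12 *\<^sub>v u) + u \<bullet> (D *\<^sub>v u) \<ge> 0"
  obtains Y where "Y \<in> carrier_mat n m"
    "\<And>x u. x \<in> carrier_vec n \<Longrightarrow> u \<in> carrier_vec m \<Longrightarrow>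
      x \<bullet> (Q11 *\<^sub>v x) + x \<bullet> (Q12 *\<^sub>v u) + u \<bullet> (D *\<^sub>v u) - x \<bullet> (Y *\<^sub>v (Pr *\<^sub>v u)) \<ge> 0"
proof -
  \<comment> \<open>The complementary projection, onto the kernel of \<open>Pr\<close>;
    \<open>D00\<close> is the symmetrized \<open>D\<close> compressed to that kernel.\<close>
  define Q0 where "Q0 = 1\<^sub>m m - Pr"
  define Db where "Db = D + D\<^sup>T"
  define D00 where "D00 = Q0\<^sup>T * (Db * Q0)"
  have Q0: "Q0 \<in> carrier_mat m m" and Db: "Db \<in> carrier_mat m m" and D00: "D00 \<in> carrier_mat m m"
    using Pr D by (auto simp: Q0_def Db_def D00_def)
  have dims [simp]: "dim_row Q11 = n" "dim_col Q11 = n" "dim_row Q12 = n" "dim_col Q12 = m"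
    "dim_row D = m" "dim_col D = m" "dim_row Pr = m" "dim_col Pr = m" "dim_row Q0 = m" "dim_col Q0 = m"
    "dim_row Db = m" "dim_col Db = m" "dim_row D00 = m" "dim_col D00 = m"
    using Q11 Q12 D Pr Q0 Db D00 by auto
  have PrPr: "Pr *\<^sub>v (Pr *\<^sub>v u) = Pr *\<^sub>v u" if "u \<in> carrier_vec m" for u
    using that Pr by (metis assoc_mult_mat_vec)
  have PrQ0: "Pr *\<^sub>v (Q0 *\<^sub>v u) = 0\<^sub>v m" if "u \<in> carrier_vec m" for u
    using that PrPr[OF that] unfolding Q0_def by (simp add: mat_vec_distribs)
  have Db_sym: "a \<bullet> (Db *\<^sub>v b) = b \<bullet> (Db *\<^sub>v a)" if "a \<in> carrier_vec m" "b \<in> carrier_vec m" for a b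
  proof -
    have "a \<bullet> (Db *\<^sub>v b) = a \<bullet> (D *\<^sub>v b) + b \<bullet> (D *\<^sub>v a)"
      using that by (simp add: Db_def mat_vec_distribs scalar_prod_distribs transpose_mult_scalar_prod
          scalar_prod_commute[of "D *\<^sub>v a" b])
    moreover have "b \<bullet> (Db *\<^sub>v a) = b \<bullet> (D *\<^sub>v a) + a \<bullet> (D *\<^sub>v b)"
      using that by (simp add: Db_def mat_vec_distribs scalar_prod_distribs transpose_mult_scalar_prod
          scalar_prod_commute[of "D *\<^sub>v b" a])
    ultimately show ?thesis by simp
  qed
  have Db_diag: "a \<bullet> (Db *\<^sub>v a) = 2 * (a \<bullet> (D *\<^sub>v a))" if "a \<in> carrier_vec m" for a
    using that by (simp add: Db_def mat_vec_distribs scalar_prod_distribs transpose_mult_scalar_prod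
          scalar_prod_commute[of "D *\<^sub>v a" a])
  have expand: "(a + b) \<bullet> (D *\<^sub>v (a + b)) = a \<bullet> (D *\<^sub>v a) + a \<bullet> (Db *\<^sub>v b) + b \<bullet> (D *\<^sub>v b)"
    if "a \<in> carrier_vec m" "b \<in> carrier_vec m" for a b
    using that by (simp add: Db_def mat_vec_distribs scalar_prod_distribs transpose_mult_scalar_prod
          scalar_prod_commute[of "D *\<^sub>v a" b])
  \<comment> \<open>In a direction \<open>h\<close> of the kernel of \<open>Pr\<close> on which the
    form of \<open>D\<close> vanishes, the given form is affine in the length of \<open>h\<close>.
    Nonnegativity kills its slope, so \<open>Q12\<close> factors through \<open>D00\<close>
    there.\<close>
  have "(Q12 * Q0) *\<^sub>v z = 0\<^sub>v n" if z: "z \<in> carrier_vec m" "D00 *\<^sub>v z = 0\<^sub>v m" for z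
  proof (rule vec_eq_zero_if_orthogonal)
    fix x :: "real vec" assume x: "x \<in> carrier_vec n"
    define h where "h = Q0 *\<^sub>v z"
    have h: "h \<in> carrier_vec m" unfolding h_def by (rule carrier_vecI) simp
    have "D00 *\<^sub>v z = Q0\<^sup>T *\<^sub>v (Db *\<^sub>v h)"
      using z by (simp add: D00_def h_def mult_mult_mat_vec)
    then have "z \<bullet> (D00 *\<^sub>v z) = h \<bullet> (Db *\<^sub>v h)"
      using z h by (simp add: transpose_mult_scalar_prod(2) h_def[symmetric] scalar_prod_commute[of h])
    then have hDh: "h \<bullet> (D *\<^sub>v h) = 0" using z Db_diag[OF h] by (simp add: scalar_prod_distribs)
    have "x \<bullet> (Q11 *\<^sub>v x) + t * (x \<bullet> (Q12 *\<^sub>v h)) \<ge> 0" for t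
    proof -
      have "Pr *\<^sub>v (t \<cdot>\<^sub>v h) = 0\<^sub>v m" using z h PrQ0[OF z(1)] by (simp add: mat_vec_distribs h_def)
      from psd2[OF x _ this] show ?thesis
        using h x hDh by (simp add: mat_vec_distribs scalar_prod_distribs)
    qed
    from affine_nonneg_imp_slope_zero[OF this] show "x \<bullet> ((Q12 * Q0) *\<^sub>v z) = 0"
      using z by (simp add: h_def mat_vec_distribs)
  qed (use z Q12 Q0 in auto)
  then obtain KT where KT: "KT \<in> carrier_mat n m" "Q12 * Q0 = KT * D00"
    using factor_if_kernel_subset[of D00 m m "Q12 * Q0" n] D00 Q12 Q0 by auto
  have dKT [simp]: "dim_row KT = n" "dim_col KT = m" using KT by auto
  have KTe: "Q12 *\<^sub>v (Q0 *\<^sub>v u) = KT *\<^sub>v (D00 *\<^sub>v u)" if "u \<in> carrier_vec m" for u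
    using that arg_cong[OF KT(2), of "\<lambda>M. M *\<^sub>v u"] by (simp add: mat_vec_distribs)
  \<comment> \<open>Chosen so that after subtraction the mixed term becomes
    \<open>u \<bullet> (Db h)\<close>, with the \<open>h\<close> below, for every \<open>u\<close>
    and not only for \<open>u\<close> in the kernel of \<open>Pr\<close>.\<close>
  define Y where "Y = Q12 - KT * (Q0\<^sup>T * Db)"
  have Y: "Y \<in> carrier_mat n m" unfolding Y_def by (rule carrier_matI) simp_all
  have "x \<bullet> (Q11 *\<^sub>v x) + x \<bullet> (Q12 *\<^sub>v u) + u \<bullet> (D *\<^sub>v u) - x \<bullet> (Y *\<^sub>v (Pr *\<^sub>v u)) \<ge> 0"
    if x: "x \<in> carrier_vec n" and u: "u \<in> carrier_vec m" for x u
  proof -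
    \<comment> \<open>The minimum over the kernel of \<open>Pr\<close> is attained at
      \<open>-h\<close> and equals \<open>x \<bullet> (Q11 x) - h \<bullet> (D h)\<close>. The
      completed form is this minimum plus the square
      \<open>(u + h) \<bullet> (D (u + h))\<close>.\<close>
    define h where "h = Q0 *\<^sub>v (KT\<^sup>T *\<^sub>v x)"
    have Kx: "KT\<^sup>T *\<^sub>v x \<in> carrier_vec m" using KT x by auto
    have h: "h \<in> carrier_vec m" unfolding h_def by (rule carrier_vecI) simp
    have Q0u: "Q0 *\<^sub>v u = u - Pr *\<^sub>v u" using u by (simp add: Q0_def mat_vec_distribs)
    have hw: "x \<bullet> (KT *\<^sub>v (Q0\<^sup>T *\<^sub>v w)) = h \<bullet> w" if "dim_vec w = m" for w
    proof -
      have "h \<bullet> w = (KT\<^sup>T *\<^sub>v x) \<bullet> (Q0\<^sup>T *\<^sub>v w)"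
        unfolding h_def using that
        by (subst transpose_mult_scalar_prod(2)) (auto simp: scalar_prod_commute)
      also have "\<dots> = x \<bullet> (KT *\<^sub>v (Q0\<^sup>T *\<^sub>v w))"
        by (rule transpose_mult_scalar_prod(1)) (use x in auto)
      finally show ?thesis by simp
    qed
    have D00e: "D00 *\<^sub>v w = Q0\<^sup>T *\<^sub>v (Db *\<^sub>v (Q0 *\<^sub>v w))" if "dim_vec w = m" for w
      using that by (simp add: D00_def mult_mult_mat_vec)
    have "x \<bullet> (Q12 *\<^sub>v h) = h \<bullet> (Db *\<^sub>v h)"
      unfolding h_def KTe[OF Kx] by (subst D00e) (use hw[of "Db *\<^sub>v h"] in \<open>auto simp: h_def\<close>)
    then have 1: "x \<bullet> (Q11 *\<^sub>v x) - h \<bullet> (D *\<^sub>v h) \<ge> 0"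
      using psd2[OF x, of "- h"] h PrQ0[OF Kx] x Db_diag[OF h]
      by (simp add: mat_vec_distribs scalar_prod_distribs h_def)
    have 2: "(u + h) \<bullet> (D *\<^sub>v (u + h)) \<ge> 0" using psd1 u h by simp
    have "x \<bullet> (Q12 *\<^sub>v u) - x \<bullet> (Y *\<^sub>v (Pr *\<^sub>v u)) =
      x \<bullet> (Q12 *\<^sub>v (Q0 *\<^sub>v u)) + x \<bullet> (KT *\<^sub>v (Q0\<^sup>T *\<^sub>v (Db *\<^sub>v (Pr *\<^sub>v u))))"
      using x u by (simp add: Q0u Y_def mat_vec_distribs scalar_prod_distribs)
    also have "\<dots> = h \<bullet> (Db *\<^sub>v (Q0 *\<^sub>v u)) + h \<bullet> (Db *\<^sub>v (Pr *\<^sub>v u))"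
      unfolding KTe[OF u] using u by (simp add: D00e hw)
    also have "\<dots> = h \<bullet> (Db *\<^sub>v u)"
      using u h by (simp add: Q0u mat_vec_distribs scalar_prod_distribs)
    also have "\<dots> = u \<bullet> (Db *\<^sub>v h)" using Db_sym[OF u h] by simp
    finally show ?thesis using 1 2 expand[OF u h] by linarith
  qed
  with Y that show thesis by blast
qed

section \<open>The linear matrix inequality\<close>

lemma inverse_mat_exists:
  fixes A :: "'a :: field mat"
  assumes A: "A \<in> carrier_mat n n" and det: "det A \<noteq> 0"
  obtains R where "R \<in> carrier_mat n n" "A * R = 1\<^sub>m n" "R * A = 1\<^sub>m n"
proof -
  from det_non_zero_imp_unit[OF A det, of n]
  obtain R where "R \<in> carrier_mat n n" "A * R = 1\<^sub>m n" "R * A = 1\<^sub>m n"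
    by (auto simp: Units_def ring_mat_simps)
  then show thesis by (rule that)
qed

lemma mat_adjoint_real: "mat_adjoint M = M\<^sup>T" for M :: "real mat"
  by (rule eq_matI) (auto simp: mat_adjoint_def mat_of_rows_def)

lemma psd_real_iff:
  "psd M \<longleftrightarrow> square_mat M \<and> M\<^sup>T = M \<and> (\<forall>v \<in> carrier_vec (dim_row M). v \<bullet> (M *\<^sub>v v) \<ge> 0)"
  for M :: "real mat"
  by (auto simp: psd_def mat_adjoint_real scalar_prod_commute)

text \<open>The Popov-Belevitch-Hautus test in kernel form. In homogeneous coordinates
  \<open>\<beta> = 0\<close> is the eigenvalue at infinity.\<close>

definition hautus_observable :: "nat \<Rightarrow> nat \<Rightarrow> real mat \<Rightarrow> real mat \<Rightarrow> real mat \<Rightarrow> bool" where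
  "hautus_observable n m E A C \<longleftrightarrow> (\<forall>\<alpha> \<beta> x. (\<alpha>, \<beta>) \<noteq> (0, 0) \<longrightarrow> x \<in> carrier_vec n \<longrightarrow>
     pencil \<alpha> \<beta> E A *\<^sub>v x = 0\<^sub>v n \<longrightarrow> cmat C *\<^sub>v x = 0\<^sub>v m \<longrightarrow> x = 0\<^sub>v n)"

text \<open>The dual test, with the plain transpose in place of the adjoint: \<open>y\<close> ranges
  over all complex vectors, so conjugation makes no difference.\<close>

definition hautus_controllable :: "nat \<Rightarrow> nat \<Rightarrow> real mat \<Rightarrow> real mat \<Rightarrow> real mat \<Rightarrow> bool" where
  "hautus_controllable n m E A B \<longleftrightarrow> (\<forall>\<alpha> \<beta> y. (\<alpha>, \<beta>) \<noteq> (0, 0) \<longrightarrow> y \<in> carrier_vec n \<longrightarrow>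
     (pencil \<alpha> \<beta> E A)\<^sup>T *\<^sub>v y = 0\<^sub>v n \<longrightarrow> (cmat B)\<^sup>T *\<^sub>v y = 0\<^sub>v m \<longrightarrow> y = 0\<^sub>v n)"

locale descriptor =
  fixes n m :: nat and E A B C D :: "real mat"
  assumes system: "descriptor_system n m E A B C D"
begin

lemma carriers: "E \<in> carrier_mat n n" "A \<in> carrier_mat n n" "B \<in> carrier_mat n m"
  "C \<in> carrier_mat m n" "D \<in> carrier_mat m m"
  using system by (auto simp: descriptor_system_def)

lemma dims [simp]: "dim_row E = n" "dim_col E = n" "dim_row A = n" "dim_col A = n"
  "dim_row B = n" "dim_col B = m" "dim_row C = m" "dim_col C = n" "dim_row D = m" "dim_col D = m"
  using carriers by auto

lemma pencil_carrier: "pencil \<alpha> \<beta> E A \<in> carrier_mat n n"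
  by (auto simp: pencil_def)

lemma pencil_dims [simp]: "dim_row (pencil \<alpha> \<beta> E A) = n" "dim_col (pencil \<alpha> \<beta> E A) = n"
  by (auto simp: pencil_def)

lemma pencil_mult_vec:
  "dim_vec x = n \<Longrightarrow> pencil \<alpha> \<beta> E A *\<^sub>v x = \<alpha> \<cdot>\<^sub>v (cmat E *\<^sub>v x) - \<beta> \<cdot>\<^sub>v (cmat A *\<^sub>v x)"
  by (simp add: pencil_def mat_vec_distribs)

lemma pencil_transpose_mult_vec:
  assumes "dim_vec y = n"
  shows "(pencil \<alpha> \<beta> E A)\<^sup>T *\<^sub>v y = \<alpha> \<cdot>\<^sub>v ((cmat E)\<^sup>T *\<^sub>v y) - \<beta> \<cdot>\<^sub>v ((cmat A)\<^sup>T *\<^sub>v y)"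
proof -
  have "(pencil \<alpha> \<beta> E A)\<^sup>T = \<alpha> \<cdot>\<^sub>m (cmat E)\<^sup>T - \<beta> \<cdot>\<^sub>m (cmat A)\<^sup>T"
    by (rule eq_matI) (auto simp: pencil_def)
  then show ?thesis using assms by (simp add: mat_vec_distribs)
qed

end

section \<open>Concatenated matrices, accretive kernels and complex eigenvectors of real
  matrices\<close>

lemma append_cols_carrier [simp]:
  "M \<in> carrier_mat n p \<Longrightarrow> N \<in> carrier_mat n q \<Longrightarrow> append_cols M N \<in> carrier_mat n (p + q)"
  by (auto simp: append_cols_def)

lemma append_cols_mult_vec:
  fixes M N :: "'a :: comm_ring_1 mat"
  assumes "M \<in> carrier_mat n p" "N \<in> carrier_mat n q" "a \<in> carrier_vec p" "b \<in> carrier_vec q"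
  shows "append_cols M N *\<^sub>v (a @\<^sub>v b) = M *\<^sub>v a + N *\<^sub>v b"
proof -
  have "append_cols M N *\<^sub>v (a @\<^sub>v b) = (M *\<^sub>v a + N *\<^sub>v b) @\<^sub>v (0\<^sub>m 0 p *\<^sub>v a + 0\<^sub>m 0 q *\<^sub>v b)"
    unfolding append_cols_def
    using assms by (subst four_block_mat_mult_vec[of _ n p _ q _ 0]) auto
  also have "\<dots> = M *\<^sub>v a + N *\<^sub>v b"
    using assms by (intro eq_vecI) auto
  finally show ?thesis .
qed

lemma append_cols_transpose_mult_vec:
  fixes M N :: "'a :: comm_ring_1 mat"
  assumes "M \<in> carrier_mat n p" "N \<in> carrier_mat n q" "y \<in> carrier_vec n"
  shows "(append_cols M N)\<^sup>T *\<^sub>v y = (M\<^sup>T *\<^sub>v y) @\<^sub>v (N\<^sup>T *\<^sub>v y)"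
proof (rule eq_vecI)
  fix i assume "i < dim_vec ((M\<^sup>T *\<^sub>v y) @\<^sub>v (N\<^sup>T *\<^sub>v y))"
  then have i: "i < p + q" using assms by simp
  have "col (append_cols M N) i = (if i < p then col M i else col N (i - p))"
    using assms i by (intro eq_vecI) (auto simp: append_cols_def)
  then show "((append_cols M N)\<^sup>T *\<^sub>v y) $ i = ((M\<^sup>T *\<^sub>v y) @\<^sub>v (N\<^sup>T *\<^sub>v y)) $ i"
    using assms i by (auto simp: append_cols_def)
qed (use assms in \<open>auto simp: append_cols_def\<close>)

lemma append_rows_mult_vec:
  fixes M N :: "'a :: comm_ring_1 mat"
  assumes "M \<in> carrier_mat p n" "N \<in> carrier_mat q n" "v \<in> carrier_vec n"
  shows "(M @\<^sub>r N) *\<^sub>v v = (M *\<^sub>v v) @\<^sub>v (N *\<^sub>v v)"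
  by (rule mat_mult_append[OF assms])

lemma append_rows_transpose_mult_vec:
  fixes M N :: "'a :: comm_ring_1 mat"
  assumes "M \<in> carrier_mat p n" "N \<in> carrier_mat q n" "a \<in> carrier_vec p" "b \<in> carrier_vec q"
  shows "(M @\<^sub>r N)\<^sup>T *\<^sub>v (a @\<^sub>v b) = M\<^sup>T *\<^sub>v a + N\<^sup>T *\<^sub>v b"
proof -
  have "(M @\<^sub>r N)\<^sup>T = append_cols M\<^sup>T N\<^sup>T"
    using assms by (intro eq_matI) (auto simp: append_rows_def append_cols_def)
  then show ?thesis using assms append_cols_mult_vec[of "M\<^sup>T" n p "N\<^sup>T" q a b] by simp
qed

lemma append_vec_eq_zero_iff:
  fixes a b :: "'a :: comm_ring_1 vec"
  assumes "a \<in> carrier_vec p"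
  shows "a @\<^sub>v b = 0\<^sub>v (p + q) \<longleftrightarrow> a = 0\<^sub>v p \<and> b = 0\<^sub>v q"
proof -
  have "(0\<^sub>v (p + q) :: 'a vec) = 0\<^sub>v p @\<^sub>v 0\<^sub>v q" by (auto simp: vec_eq_iff)
  then show ?thesis by (simp only: append_vec_eq[OF assms zero_carrier_vec])
qed

text \<open>\<open>x\<close> is a zero of a nonnegative form, so its first variation in every
  direction \<open>y\<close> vanishes; as \<open>M x = 0\<close>, that variation is just
  \<open>x \<bullet> (M y)\<close>.\<close>

lemma accretive_kernel_subset_transpose:
  fixes M :: "real mat"
  assumes M: "M \<in> carrier_mat n n" and acc: "\<And>x. x \<in> carrier_vec n \<Longrightarrow> x \<bullet> (M *\<^sub>v x) \<ge> 0"
    and x: "x \<in> carrier_vec n" "M *\<^sub>v x = 0\<^sub>v n"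
  shows "M\<^sup>T *\<^sub>v x = 0\<^sub>v n"
proof (rule vec_eq_zero_if_orthogonal)
  fix y :: "real vec" assume y: "y \<in> carrier_vec n"
  have [simp]: "dim_row M = n" "dim_col M = n" using M by auto
  have "(y \<bullet> (M *\<^sub>v y)) * t\<^sup>2 + (x \<bullet> (M *\<^sub>v y)) * t \<ge> 0" for t
    using acc[of "x + t \<cdot>\<^sub>v y"] x y
    by (simp add: mat_vec_distribs scalar_prod_distribs power2_eq_square algebra_simps)
  from quadratic_nonneg_imp_linear_zero[OF this] show "y \<bullet> (M\<^sup>T *\<^sub>v x) = 0"
    using x y by (simp add: transpose_mult_scalar_prod)
qed (use M x in auto)

lemma krylov_of_real:
  assumes "N \<in> carrier_mat n n" "v \<in> carrier_vec n"
  shows "((\<lambda>w. cmat N *\<^sub>v w) ^^ k) (map_vec complex_of_real v) = map_vec complex_of_real (((\<lambda>w. N *\<^sub>v w) ^^ k) v)"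
proof (induction k)
  case (Suc k)
  have "((\<lambda>w. N *\<^sub>v w) ^^ k) v \<in> carrier_vec n"
    using assms by (rule iterate_mult_mat_vec_carrier)
  then show ?case using Suc assms(1) by (simp add: of_real_hom.mult_mat_vec_hom[symmetric])
qed simp

lemma map_vec_of_real_eq_zero_iff:
  "map_vec complex_of_real v = 0\<^sub>v n \<longleftrightarrow> v = 0\<^sub>v n"
  by (auto simp: vec_eq_iff)

lemma index_mult_mat_vec_sum:
  "i < dim_row M \<Longrightarrow> dim_vec v = dim_col M \<Longrightarrow> (M *\<^sub>v v) $ i = (\<Sum>j<dim_col M. M $$ (i, j) * v $ j)"
  by (simp add: scalar_prod_def atLeast0LessThan)

text \<open>Bridges two fields: invariance is checked on real Krylov vectors, whereas the Hautus
  tests speak of complex eigenvectors.\<close>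

lemma complex_eigenvector_in_kernel:
  fixes N M :: "real mat"
  assumes N: "N \<in> carrier_mat n n" and v: "v \<in> carrier_vec n" "v \<noteq> 0\<^sub>v n" and M: "M \<in> carrier_mat p n"
    and ker: "\<And>k. k < n \<Longrightarrow> M *\<^sub>v ((\<lambda>w. N *\<^sub>v w) ^^ k) v = 0\<^sub>v p"
  obtains w e where "w \<in> carrier_vec n" "w \<noteq> 0\<^sub>v n" "cmat N *\<^sub>v w = e \<cdot>\<^sub>v w" "cmat M *\<^sub>v w = 0\<^sub>v p"
proof -
  define pw where "pw k = ((\<lambda>w. N *\<^sub>v w) ^^ k) v" for k
  have dims: "dim_vec (pw k) = n" "dim_row M = p" "dim_col M = n" for k
    using iterate_mult_mat_vec_carrier[OF N v(1), of k] M by (auto simp: pw_def)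
  have Mpw: "(\<Sum>j<n. M $$ (i, j) * pw k $ j) = 0" if "i < p" "k < n" for i k
    using index_mult_mat_vec_sum[of i M "pw k"] ker[OF that(2)] that(1) dims by (simp add: pw_def)
  have vc: "map_vec complex_of_real v \<in> carrier_vec n" "map_vec complex_of_real v \<noteq> 0\<^sub>v n"
    using v by (auto simp: map_vec_of_real_eq_zero_iff)
  have Nc: "cmat N \<in> carrier_mat n n" using N by simp
  obtain w e c where w: "w \<in> carrier_vec n" "w \<noteq> 0\<^sub>v n" "cmat N *\<^sub>v w = e \<cdot>\<^sub>v w"
    "w = vec n (\<lambda>i. \<Sum>k<n. c k * ((\<lambda>w. cmat N *\<^sub>v w) ^^ k) (map_vec complex_of_real v) $ i)"
    using eigenvector_in_krylov_space[OF Nc vc] .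
  have wpw: "w $ j = (\<Sum>k<n. c k * complex_of_real (pw k $ j))" if "j < n" for j
    using that dims(1) unfolding pw_def by (subst w(4)) (simp add: krylov_of_real[OF N v(1)])
  have "cmat M *\<^sub>v w = 0\<^sub>v p"
  proof (rule eq_vecI)
    fix i assume i: "i < dim_vec (0\<^sub>v p :: complex vec)"
    have "(cmat M *\<^sub>v w) $ i = (\<Sum>j<n. complex_of_real (M $$ (i, j)) * w $ j)"
      using i w(1) dims by (simp add: scalar_prod_def atLeast0LessThan)
    also have "\<dots> = (\<Sum>j<n. \<Sum>k<n. c k * (complex_of_real (M $$ (i, j)) * complex_of_real (pw k $ j)))"
      by (rule sum.cong) (auto simp: wpw sum_distrib_left algebra_simps)
    also have "\<dots> = (\<Sum>k<n. c k * complex_of_real (\<Sum>j<n. M $$ (i, j) * pw k $ j))"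
      unfolding of_real_sum of_real_mult by (subst sum.swap) (simp add: sum_distrib_left)
    also have "\<dots> = 0" using Mpw i by (simp del: of_real_sum of_real_mult)
    finally show "(cmat M *\<^sub>v w) $ i = 0\<^sub>v p $ i" using i by simp
  qed (use M in auto)
  with w(1-3) that show thesis by blast
qed

section \<open>From the matrix inequality to the port-Hamiltonian structure\<close>

context descriptor
begin

text \<open>The kernel of \<open>X\<close> is invariant under \<open>(E - A)\<inverse> E\<close> and annihilated by \<open>C\<close>, so it would contain
  an unobservable eigenvector.\<close>

lemma lmi_solution_invertible:
  assumes det: "det (E - A) \<noteq> 0" and obs: "hautus_observable n m E A C"
    and X: "X \<in> carrier_mat n n" and sym: "E\<^sup>T * X = X\<^sup>T * E"
    and nonneg: "\<And>x. x \<in> carrier_vec n \<Longrightarrow> (X *\<^sub>v x) \<bullet> (E *\<^sub>v x) \<ge> 0"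
    and lmi: "\<And>x u. x \<in> carrier_vec n \<Longrightarrow> u \<in> carrier_vec m \<Longrightarrow>
      (X *\<^sub>v x) \<bullet> (A *\<^sub>v x + B *\<^sub>v u) \<le> u \<bullet> (C *\<^sub>v x + D *\<^sub>v u)"
  shows "det X \<noteq> 0"
proof
  assume "det X = 0"
  then obtain v where v: "v \<in> carrier_vec n" "v \<noteq> 0\<^sub>v n" "X *\<^sub>v v = 0\<^sub>v n"
    using det_0_iff_vec_prod_zero_field[OF X] by blast
  have EA: "E - A \<in> carrier_mat n n" by auto
  obtain R where R: "R \<in> carrier_mat n n" "(E - A) * R = 1\<^sub>m n" "R * (E - A) = 1\<^sub>m n"
    using inverse_mat_exists[OF EA det] .
  have [simp]: "dim_row X = n" "dim_col X = n" "dim_row R = n" "dim_col R = n" using X R by auto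
  have EAR: "(E - A) *\<^sub>v (R *\<^sub>v w) = w" if "dim_vec w = n" for w
    using that arg_cong[OF R(2), of "\<lambda>M. M *\<^sub>v w"] by (simp add: mat_vec_distribs)
  have EAT: "y = 0\<^sub>v n" if y: "dim_vec y = n" "(E - A)\<^sup>T *\<^sub>v y = 0\<^sub>v n" for y
  proof -
    have "R\<^sup>T * (E - A)\<^sup>T = ((E - A) * R)\<^sup>T" by (rule transpose_mult[symmetric]) (use R EA in auto)
    then have "R\<^sup>T *\<^sub>v ((E - A)\<^sup>T *\<^sub>v y) = y"
      using R(2) y(1) by (simp add: mult_mult_mat_vec[symmetric] one_mult_mat_vec')
    then show ?thesis using y(2) by (simp add: mat_vec_distribs)
  qed
  \<comment> \<open>The inequality at \<open>u = 0\<close> together with nonnegativity of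
    \<open>X\<^sup>T E\<close> makes \<open>M\<close> accretive.\<close>
  define M where "M = X\<^sup>T * (E - A)"
  have M: "M \<in> carrier_mat n n" by (auto simp: M_def)
  have MT: "M\<^sup>T *\<^sub>v x = (E - A)\<^sup>T *\<^sub>v (X *\<^sub>v x)" if "dim_vec x = n" for x
    unfolding M_def by (subst transpose_mult[of _ n n _ n]) (use X EA that in \<open>auto simp: mat_vec_distribs\<close>)
  have acc: "x \<bullet> (M *\<^sub>v x) \<ge> 0" if x: "x \<in> carrier_vec n" for x
    using nonneg[OF x] lmi[OF x, of "0\<^sub>v m"] x
    by (simp add: M_def mat_vec_distribs scalar_prod_distribs transpose_mult_scalar_prod
        scalar_prod_commute[of _ "X *\<^sub>v x"])
  define N where "N = R * E"
  have N: "N \<in> carrier_mat n n" by (auto simp: N_def)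
  \<comment> \<open>By symmetry \<open>M (N x) = X\<^sup>T E x = E\<^sup>T X x = 0\<close>.
    Accretivity transfers this to \<open>M\<^sup>T\<close>, and the invertible factor
    \<open>(E - A)\<^sup>T\<close> cancels.\<close>
  have XN: "X *\<^sub>v (N *\<^sub>v x) = 0\<^sub>v n" if x: "dim_vec x = n" "X *\<^sub>v x = 0\<^sub>v n" for x
  proof -
    have "M *\<^sub>v (N *\<^sub>v x) = (X\<^sup>T * E) *\<^sub>v x" using x by (simp add: M_def N_def mult_mult_mat_vec EAR)
    also have "\<dots> = 0\<^sub>v n" using x unfolding sym[symmetric] by (simp add: mat_vec_distribs)
    finally have "M\<^sup>T *\<^sub>v (N *\<^sub>v x) = 0\<^sub>v n"
      using N by (intro accretive_kernel_subset_transpose[OF M acc]) (auto intro: carrier_vecI)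
    then show ?thesis using EAT[of "X *\<^sub>v (N *\<^sub>v x)"] N by (simp add: MT)
  qed
  \<comment> \<open>On the kernel of \<open>X\<close> the left side of the inequality is zero, so
    the term of the right side that is linear in \<open>u\<close> must vanish.\<close>
  have XC: "C *\<^sub>v x = 0\<^sub>v m" if x: "x \<in> carrier_vec n" "X *\<^sub>v x = 0\<^sub>v n" for x
  proof (rule vec_eq_zero_if_orthogonal)
    fix u :: "real vec" assume u: "u \<in> carrier_vec m"
    have "(u \<bullet> (D *\<^sub>v u)) * t\<^sup>2 + (u \<bullet> (C *\<^sub>v x)) * t \<ge> 0" for t
      using lmi[OF x(1), of "t \<cdot>\<^sub>v u"] x u
      by (simp add: mat_vec_distribs scalar_prod_distribs power2_eq_square algebra_simps)
    from quadratic_nonneg_imp_linear_zero[OF this] show "u \<bullet> (C *\<^sub>v x) = 0" .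
  qed (auto intro: carrier_vecI)
  define pw where "pw k = ((\<lambda>w. N *\<^sub>v w) ^^ k) v" for k
  have pw: "pw k \<in> carrier_vec n \<and> X *\<^sub>v pw k = 0\<^sub>v n" for k
    by (induction k) (use v N XN in \<open>auto simp: pw_def intro: carrier_vecI\<close>)
  have "C *\<^sub>v ((\<lambda>w. N *\<^sub>v w) ^^ k) v = 0\<^sub>v m" for k
    using XC pw[of k] by (simp add: pw_def)
  then obtain w e where w: "w \<in> carrier_vec n" "w \<noteq> 0\<^sub>v n" "cmat N *\<^sub>v w = e \<cdot>\<^sub>v w" "cmat C *\<^sub>v w = 0\<^sub>v m"
    using complex_eigenvector_in_kernel[OF N v(1,2) carriers(4)] by blast
  have Nc: "cmat N \<in> carrier_mat n n" using N by simp
  \<comment> \<open>\<open>N w = e w\<close> means \<open>E w = e (E - A) w\<close>; collecting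
    terms gives these coefficients, which never vanish together.\<close>
  have "pencil (1 - e) (- e) E A *\<^sub>v w = 0\<^sub>v n"
  proof -
    have "cmat E = cmat ((E - A) * N)"
    proof -
      have "(E - A) * N = (E - A) * R * E"
        unfolding N_def by (rule assoc_mult_mat[symmetric]) (use R EA carriers in auto)
      also have "\<dots> = E" unfolding R(2) using carriers by simp
      finally show ?thesis by simp
    qed
    also have "\<dots> = (cmat E - cmat A) * cmat N"
    proof -
      have "cmat (E - A) = cmat E - cmat A" by (rule eq_matI) auto
      then show ?thesis using of_real_hom.mat_hom_mult[OF EA N] by metis
    qed
    finally have "cmat E *\<^sub>v w = (cmat E - cmat A) *\<^sub>v (e \<cdot>\<^sub>v w)"
      using w N by (metis (no_types, lifting) Nc assoc_mult_mat_vec carriers(1,2) map_carrier_mat minus_carrier_mat)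
    then have "cmat E *\<^sub>v w = e \<cdot>\<^sub>v (cmat E *\<^sub>v w) - e \<cdot>\<^sub>v (cmat A *\<^sub>v w)"
      using w(1) by (simp add: mat_vec_distribs) (auto simp: vec_eq_iff algebra_simps)
    then show ?thesis using w(1) by (auto simp: pencil_mult_vec vec_eq_iff algebra_simps)
  qed
  moreover have "(1 - e, - e) \<noteq> (0, 0)" by auto
  ultimately show False using obs w unfolding hautus_observable_def by blast
qed

text \<open>With \<open>Q = X\<close> invertible the structure equations leave no choice:
  \<open>J - R = A X\<inverse>\<close>, \<open>G - P = B\<close> and
  \<open>(G + P)\<^sup>T = C X\<inverse>\<close>. The dissipation form at \<open>(x, u)\<close> is
  then the right side of the inequality minus its left side.\<close>

lemma port_Hamiltonian_if_lmi:
  assumes X: "X \<in> carrier_mat n n" "det X \<noteq> 0" and sym: "E\<^sup>T * X = X\<^sup>T * E"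
    and nonneg: "\<And>x. x \<in> carrier_vec n \<Longrightarrow> (X *\<^sub>v x) \<bullet> (E *\<^sub>v x) \<ge> 0"
    and lmi: "\<And>x u. x \<in> carrier_vec n \<Longrightarrow> u \<in> carrier_vec m \<Longrightarrow>
      (X *\<^sub>v x) \<bullet> (A *\<^sub>v x + B *\<^sub>v u) \<le> u \<bullet> (C *\<^sub>v x + D *\<^sub>v u)"
  shows "port_Hamiltonian n m E A B C D"
proof -
  obtain Y where Y: "Y \<in> carrier_mat n n" "X * Y = 1\<^sub>m n" "Y * X = 1\<^sub>m n"
    using inverse_mat_exists[OF X] .
  have [simp]: "dim_row X = n" "dim_col X = n" "dim_row Y = n" "dim_col Y = n" using X Y by auto
  have YX: "Y *\<^sub>v (X *\<^sub>v x) = x" if "dim_vec x = n" for x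
    using that arg_cong[OF Y(3), of "\<lambda>M. M *\<^sub>v x"] by (simp add: mat_vec_distribs)
  have XTYT: "X\<^sup>T *\<^sub>v (Y\<^sup>T *\<^sub>v x) = x" if "dim_vec x = n" for x
  proof -
    have "X\<^sup>T * Y\<^sup>T = (Y * X)\<^sup>T" by (rule transpose_mult[symmetric]) (use X Y in auto)
    then show ?thesis using Y(3) that by (simp add: mult_mult_mat_vec[symmetric] one_mult_mat_vec')
  qed
  \<comment> \<open>\<open>M = A X\<inverse>\<close> splits into its skew part \<open>J\<close> and
    minus its symmetric part \<open>R\<close>; \<open>L\<close>, the transpose of
    \<open>C X\<inverse>\<close>, and \<open>B\<close> determine \<open>G\<close> and
    \<open>P\<close>.\<close>
  define M where "M = A * Y"
  define L where "L = Y\<^sup>T * C\<^sup>T"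
  define J where "J = (1/2) \<cdot>\<^sub>m (M - M\<^sup>T)"
  define R where "R = (- 1/2) \<cdot>\<^sub>m (M + M\<^sup>T)"
  define G where "G = (1/2) \<cdot>\<^sub>m (B + L)"
  define P where "P = (1/2) \<cdot>\<^sub>m (L - B)"
  define S where "S = (1/2) \<cdot>\<^sub>m (D + D\<^sup>T)"
  define N where "N = (1/2) \<cdot>\<^sub>m (D - D\<^sup>T)"
  have M: "M \<in> carrier_mat n n" and L: "L \<in> carrier_mat n m" by (auto simp: M_def L_def)
  have cs: "J \<in> carrier_mat n n" "R \<in> carrier_mat n n" "G \<in> carrier_mat n m" "P \<in> carrier_mat n m"
    "S \<in> carrier_mat m m" "N \<in> carrier_mat m m"
    using M L by (auto simp: J_def R_def G_def P_def S_def N_def)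
  then have [simp]: "dim_row J = n" "dim_col J = n" "dim_row R = n" "dim_col R = n" "dim_row G = n" "dim_col G = m"
    "dim_row P = n" "dim_col P = m" "dim_row S = m" "dim_col S = m" "dim_row N = m" "dim_col N = m"
    "dim_row M = n" "dim_col M = n" "dim_row L = n" "dim_col L = m"
    using M L by auto
  have "J - R = M" by (rule eq_matI) (auto simp: J_def R_def field_simps)
  moreover have "M * X = A" unfolding M_def using Y X carriers by (simp add: assoc_mult_mat[of _ n n _ n _ n])
  ultimately have AJR: "A = (J - R) * X" by simp
  have GP: "B = G - P" by (rule eq_matI) (auto simp: G_def P_def field_simps)
  have "G + P = L" by (rule eq_matI) (auto simp: G_def P_def field_simps)
  moreover have "L\<^sup>T * X = C"
  proof -
    have "L\<^sup>T = C * Y" unfolding L_def by (subst transpose_mult) (use Y carriers in auto)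
    then show ?thesis using Y X carriers by (simp add: assoc_mult_mat[of _ m n _ n _ n])
  qed
  ultimately have CGP: "C = (G + P)\<^sup>T * X" by simp
  have DSN: "D = S + N" by (rule eq_matI) (auto simp: S_def N_def field_simps)
  have skew: "four_block_mat J G (- G\<^sup>T) N = - (four_block_mat J G (- G\<^sup>T) N)\<^sup>T"
    by (rule eq_matI) (auto simp: J_def N_def field_simps)
  have ET: "E\<^sup>T * X \<in> carrier_mat n n" by auto
  have psdE: "psd (E\<^sup>T * X)"
    unfolding psd_real_iff
  proof (intro conjI ballI)
    have "(E\<^sup>T * X)\<^sup>T = X\<^sup>T * E" by (subst transpose_mult) (use X carriers in auto)
    then show "(E\<^sup>T * X)\<^sup>T = E\<^sup>T * X" using sym by simp
  next
    fix x :: "real vec" assume x: "x \<in> carrier_vec (dim_row (E\<^sup>T * X))"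
    have "x \<bullet> ((E\<^sup>T * X) *\<^sub>v x) = (E *\<^sub>v x) \<bullet> (X *\<^sub>v x)"
      using x by (simp add: mat_vec_distribs transpose_mult_scalar_prod scalar_prod_commute)
    also have "\<dots> \<ge> 0" using nonneg[of x] x by (simp add: scalar_prod_commute)
    finally show "x \<bullet> ((E\<^sup>T * X) *\<^sub>v x) \<ge> 0" .
  qed simp
  let ?W = "four_block_mat (X\<^sup>T * R * X) (X\<^sup>T * P) (P\<^sup>T * X) S"
  have W: "psd ?W"
    unfolding psd_real_iff
  proof (intro conjI ballI)
    have "R\<^sup>T = R" by (rule eq_matI) (auto simp: R_def field_simps)
    then have "(X\<^sup>T * R * X)\<^sup>T = X\<^sup>T * R * X"
      using X cs by (subst transpose_mult[of _ n n _ n], simp, simp, subst transpose_mult[of _ n n _ n])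
        (auto simp: assoc_mult_mat[of _ n n _ n _ n])
    moreover have "(X\<^sup>T * P)\<^sup>T = P\<^sup>T * X" by (subst transpose_mult) (use X cs in auto)
    moreover have "(P\<^sup>T * X)\<^sup>T = X\<^sup>T * P" by (subst transpose_mult) (use X cs in auto)
    moreover have "S\<^sup>T = S" by (rule eq_matI) (auto simp: S_def field_simps)
    ultimately show "?W\<^sup>T = ?W"
      by (subst transpose_four_block_mat[of _ n n _ m _ m]) auto
  next
    fix z :: "real vec" assume "z \<in> carrier_vec (dim_row ?W)"
    then have z: "z \<in> carrier_vec (n + m)" by simp
    define x where "x = vec_first z n"
    define u where "u = vec_last z m"
    have x: "x \<in> carrier_vec n" and u: "u \<in> carrier_vec m" and zxu: "z = x @\<^sub>v u"
      using z by (auto simp: x_def u_def)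
    have [simp]: "dim_vec x = n" "dim_vec u = m" using x u by auto
    define Xx where "Xx = X *\<^sub>v x"
    have [simp]: "dim_vec Xx = n" by (simp add: Xx_def)
    have "M *\<^sub>v Xx = A *\<^sub>v x" by (simp add: M_def Xx_def mult_mult_mat_vec YX)
    moreover have "Xx \<bullet> (M\<^sup>T *\<^sub>v Xx) = Xx \<bullet> (M *\<^sub>v Xx)"
      by (simp add: transpose_mult_scalar_prod scalar_prod_commute)
    ultimately have xRx: "x \<bullet> ((X\<^sup>T * R * X) *\<^sub>v x) = - (Xx \<bullet> (A *\<^sub>v x))"
      by (simp add: mat_vec_distribs transpose_mult_scalar_prod Xx_def[symmetric] R_def scalar_prod_distribs
          scalar_prod_commute[of "A *\<^sub>v x" Xx])
    have XL: "Xx \<bullet> (L *\<^sub>v u) = u \<bullet> (C *\<^sub>v x)"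
    proof -
      have "Xx \<bullet> (L *\<^sub>v u) = Xx \<bullet> (Y\<^sup>T *\<^sub>v (C\<^sup>T *\<^sub>v u))"
        by (simp add: L_def mult_mult_mat_vec)
      also have "\<dots> = (C\<^sup>T *\<^sub>v u) \<bullet> (Y *\<^sub>v Xx)" by (rule transpose_mult_scalar_prod) auto
      also have "\<dots> = (C\<^sup>T *\<^sub>v u) \<bullet> x" by (simp add: Xx_def YX)
      also have "\<dots> = u \<bullet> (C *\<^sub>v x)" by (rule transpose_mult_scalar_prod) auto
      finally show ?thesis .
    qed
    have XP: "x \<bullet> ((X\<^sup>T * P) *\<^sub>v u) = (u \<bullet> (C *\<^sub>v x) - Xx \<bullet> (B *\<^sub>v u)) / 2"
      by (simp add: mat_vec_distribs transpose_mult_scalar_prod Xx_def[symmetric] P_def scalar_prod_distribs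
          XL[symmetric] scalar_prod_commute[of _ Xx])
    have PX: "u \<bullet> ((P\<^sup>T * X) *\<^sub>v x) = (u \<bullet> (C *\<^sub>v x) - Xx \<bullet> (B *\<^sub>v u)) / 2"
    proof -
      have "u \<bullet> ((P\<^sup>T * X) *\<^sub>v x) = x \<bullet> ((X\<^sup>T * P) *\<^sub>v u)"
        by (simp add: mat_vec_distribs transpose_mult_scalar_prod scalar_prod_commute)
      then show ?thesis using XP by simp
    qed
    have uSu: "u \<bullet> (S *\<^sub>v u) = u \<bullet> (D *\<^sub>v u)"
      by (simp add: S_def mat_vec_distribs scalar_prod_distribs transpose_mult_scalar_prod
          scalar_prod_commute[of "D *\<^sub>v u" u])
    have Wz: "?W *\<^sub>v z = ((X\<^sup>T * R * X) *\<^sub>v x + (X\<^sup>T * P) *\<^sub>v u) @\<^sub>v ((P\<^sup>T * X) *\<^sub>v x + S *\<^sub>v u)"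
      unfolding zxu by (rule four_block_mat_mult_vec[of _ n n _ m _ m]) (use x u in auto)
    have "z \<bullet> (?W *\<^sub>v z) = x \<bullet> ((X\<^sup>T * R * X) *\<^sub>v x + (X\<^sup>T * P) *\<^sub>v u) +
        u \<bullet> ((P\<^sup>T * X) *\<^sub>v x + S *\<^sub>v u)"
      unfolding Wz unfolding zxu
      by (rule scalar_prod_append[OF x u]) (rule carrier_vecI; simp)+
    also have "\<dots> = u \<bullet> (C *\<^sub>v x + D *\<^sub>v u) - Xx \<bullet> (A *\<^sub>v x + B *\<^sub>v u)"
      by (simp add: scalar_prod_distribs xRx XP PX uSu del: assoc_mult_mat_vec)
    finally show "z \<bullet> (?W *\<^sub>v z) \<ge> 0" using lmi[OF x u] by (simp add: Xx_def)
  qed simp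
  have block: "four_block_mat A B C D =
             four_block_mat ((J - R) * X) (G - P) ((G + P)\<^sup>T * X) (S + N)"
    using AJR GP CGP DSN by simp
  show ?thesis
    unfolding port_Hamiltonian_def Let_def S_def[symmetric] N_def[symmetric]
    by (intro conjI bexI[of _ J] bexI[of _ R] bexI[of _ X] bexI[of _ G] bexI[of _ P])
       (use system cs(1-4) X(1) block skew sym psdE W in simp_all)
qed

end

section \<open>From a storage form to the matrix inequality\<close>

lemma of_real_transpose_mult_mat_vec:
  "dim_vec v = dim_row M \<Longrightarrow>
    (cmat M)\<^sup>T *\<^sub>v map_vec complex_of_real v = map_vec complex_of_real (M\<^sup>T *\<^sub>v v)"
  by (auto simp: vec_eq_iff scalar_prod_def)

context descriptor
begin

text \<open>Controllability at infinity, that is \<open>\<alpha> = 1\<close> and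
  \<open>\<beta> = 0\<close>: the matrix \<open>[E B]\<close> has full row rank.\<close>

lemma left_kernel_at_infinity:
  assumes ctrl: "hautus_controllable n m E A B"
    and y: "y \<in> carrier_vec n" "E\<^sup>T *\<^sub>v y = 0\<^sub>v n" "B\<^sup>T *\<^sub>v y = 0\<^sub>v m"
  shows "y = 0\<^sub>v n"
proof -
  let ?y = "map_vec complex_of_real y"
  have d: "dim_vec y = n" using y by simp
  have "(pencil 1 0 E A)\<^sup>T *\<^sub>v ?y = 0\<^sub>v n"
    using d y(2) by (simp add: pencil_transpose_mult_vec of_real_transpose_mult_mat_vec) (auto simp: vec_eq_iff)
  moreover have "(cmat B)\<^sup>T *\<^sub>v ?y = 0\<^sub>v m"
    using d y(3) by (auto simp: of_real_transpose_mult_mat_vec vec_eq_iff)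
  moreover have "((1::complex), (0::complex)) \<noteq> (0, 0)" by simp
  ultimately have "?y = 0\<^sub>v n" using ctrl y(1) unfolding hautus_controllable_def
    by (metis map_carrier_vec)
  then show ?thesis by (simp add: map_vec_of_real_eq_zero_iff)
qed

text \<open>A right inverse of \<open>[E B]\<close> whose input part vanishes on the range of
  \<open>E\<close>. For it, \<open>S2 f = 0\<close> is exactly the condition that \<open>f\<close>
  lies in the range of \<open>E\<close>, which thereby becomes a linear equation.\<close>

lemma adapted_right_inverse:
  assumes ctrl: "hautus_controllable n m E A B"
  obtains S1 S2 where "S1 \<in> carrier_mat n n" "S2 \<in> carrier_mat m n"
    "\<And>f. f \<in> carrier_vec n \<Longrightarrow> E *\<^sub>v (S1 *\<^sub>v f) + B *\<^sub>v (S2 *\<^sub>v f) = f"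
    "\<And>w. w \<in> carrier_vec n \<Longrightarrow> S2 *\<^sub>v (E *\<^sub>v w) = 0\<^sub>v m"
proof -
  obtain F where F: "F \<in> carrier_mat n n" "E * F * E = E"
    using generalized_inverse[OF carriers(1)] .
  \<comment> \<open>A projection whose kernel is the range of \<open>E\<close>: only what
    \<open>E\<close> cannot produce is left to the input.\<close>
  define L where "L = 1\<^sub>m n - E * F"
  have [simp]: "dim_row F = n" "dim_col F = n" "dim_row L = n" "dim_col L = n" using F by (auto simp: L_def)
  have EFE: "E *\<^sub>v (F *\<^sub>v (E *\<^sub>v w)) = E *\<^sub>v w" if "dim_vec w = n" for w
    using that arg_cong[OF F(2), of "\<lambda>M. M *\<^sub>v w"] by (simp add: mat_vec_distribs)
  have LE: "L *\<^sub>v (E *\<^sub>v w) = 0\<^sub>v n" if "dim_vec w = n" for w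
    using that by (simp add: L_def mat_vec_distribs EFE)
  have LB: "L * B \<in> carrier_mat n m" by (rule carrier_matI) simp_all
  obtain K where K: "K \<in> carrier_mat m n" "L * B * K * (L * B) = L * B"
    using generalized_inverse[OF LB] .
  have [simp]: "dim_row K = m" "dim_col K = n" using K by auto
  have BKB: "L *\<^sub>v (B *\<^sub>v (K *\<^sub>v (L *\<^sub>v (B *\<^sub>v u)))) = L *\<^sub>v (B *\<^sub>v u)" if "dim_vec u = m" for u
    using that arg_cong[OF K(2), of "\<lambda>M. M *\<^sub>v u"] by (simp add: mat_vec_distribs)
  define S2 where "S2 = K * L"
  define S1 where "S1 = F * (1\<^sub>m n - B * S2)"
  have S: "S1 \<in> carrier_mat n n" "S2 \<in> carrier_mat m n"
    unfolding S1_def S2_def by (rule carrier_matI; simp)+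
  have [simp]: "dim_row S1 = n" "dim_col S1 = n" "dim_row S2 = m" "dim_col S2 = n" using S by auto
  have S2v: "S2 *\<^sub>v f = K *\<^sub>v (L *\<^sub>v f)" if "dim_vec f = n" for f
    using that by (simp add: S2_def mat_vec_distribs)
  \<comment> \<open>The residual of the construction. It annihilates the ranges of \<open>E\<close>
    and of \<open>B\<close>, hence is zero because \<open>[E B]\<close> has full row rank.\<close>
  define T where "T = L - L * (B * S2)"
  have T: "T \<in> carrier_mat n n" unfolding T_def by (rule carrier_matI) simp_all
  have [simp]: "dim_row T = n" "dim_col T = n" using T by auto
  have TE: "T *\<^sub>v (E *\<^sub>v w) = 0\<^sub>v n" if "dim_vec w = n" for w
    using that by (simp add: T_def mat_vec_distribs LE S2v)
  have TB: "T *\<^sub>v (B *\<^sub>v u) = 0\<^sub>v n" if "dim_vec u = m" for u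
    using that by (simp add: T_def mat_vec_distribs S2v BKB)
  have TT: "T\<^sup>T *\<^sub>v y = 0\<^sub>v n" if y: "y \<in> carrier_vec n" for y
  proof (rule left_kernel_at_infinity[OF ctrl])
    show "T\<^sup>T *\<^sub>v y \<in> carrier_vec n" by (rule carrier_vecI) simp
    have "x \<bullet> (E\<^sup>T *\<^sub>v (T\<^sup>T *\<^sub>v y)) = 0" if x: "x \<in> carrier_vec n" for x
      using x y TE[of x] by (simp add: transpose_mult_scalar_prod)
    then show "E\<^sup>T *\<^sub>v (T\<^sup>T *\<^sub>v y) = 0\<^sub>v n"
      by (intro vec_eq_zero_if_orthogonal) (auto intro: carrier_vecI)
    have "x \<bullet> (B\<^sup>T *\<^sub>v (T\<^sup>T *\<^sub>v y)) = 0" if x: "x \<in> carrier_vec m" for x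
      using x y TB[of x] by (simp add: transpose_mult_scalar_prod)
    then show "B\<^sup>T *\<^sub>v (T\<^sup>T *\<^sub>v y) = 0\<^sub>v m"
      by (intro vec_eq_zero_if_orthogonal) (auto intro: carrier_vecI)
  qed
  have T0: "T *\<^sub>v f = 0\<^sub>v n" if f: "f \<in> carrier_vec n" for f
  proof (rule vec_eq_zero_if_orthogonal)
    fix y :: "real vec" assume y: "y \<in> carrier_vec n"
    have "y \<bullet> (T *\<^sub>v f) = (T\<^sup>T *\<^sub>v y) \<bullet> f"
      by (rule transpose_mult_scalar_prod(1)[symmetric]) (use f y in auto)
    then show "y \<bullet> (T *\<^sub>v f) = 0" using TT[OF y] f by simp
  qed (auto intro: carrier_vecI)
  have "E *\<^sub>v (S1 *\<^sub>v f) + B *\<^sub>v (S2 *\<^sub>v f) = f" if f: "f \<in> carrier_vec n" for f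
  proof -
    define g where "g = f - B *\<^sub>v (S2 *\<^sub>v f)"
    have dg: "dim_vec g = n" by (simp add: g_def)
    have "L *\<^sub>v g = 0\<^sub>v n" using T0[OF f] f by (simp add: g_def T_def mat_vec_distribs)
    then have "g - E *\<^sub>v (F *\<^sub>v g) = 0\<^sub>v n" using dg by (simp add: L_def mat_vec_distribs)
    then have "E *\<^sub>v (F *\<^sub>v g) = g" using dg by (auto simp: vec_eq_iff simp del: index_mult_mat_vec)
    moreover have "S1 *\<^sub>v f = F *\<^sub>v g" using f by (simp add: S1_def g_def mat_vec_distribs)
    ultimately have "E *\<^sub>v (S1 *\<^sub>v f) = g" by simp
    then show ?thesis using f by (auto simp: g_def vec_eq_iff simp del: index_mult_mat_vec)
  qed
  moreover have "S2 *\<^sub>v (E *\<^sub>v w) = 0\<^sub>v m" if "w \<in> carrier_vec n" for w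
    using that by (simp add: S2v LE mat_vec_distribs)
  ultimately show thesis using S that by blast
qed

text \<open>The transpose of \<open>X\<close> has to send \<open>E w\<close> to \<open>Z w\<close>,
  which fixes it on the range of \<open>E\<close> only. \<open>Z S1\<close> is one extension and
  \<open>Y S2\<close> is the remaining freedom; the inequality for all pairs turns into a completion
  problem for \<open>Y\<close>.\<close>

lemma lmi_solution_from_storage:
  assumes ctrl: "hautus_controllable n m E A B"
    and Z: "Z \<in> carrier_mat n n" "Z\<^sup>T = Z"
    and nonneg: "\<And>w. w \<in> carrier_vec n \<Longrightarrow> w \<bullet> (Z *\<^sub>v w) \<ge> 0"
    and ker: "\<And>w. w \<in> carrier_vec n \<Longrightarrow> E *\<^sub>v w = 0\<^sub>v n \<Longrightarrow> Z *\<^sub>v w = 0\<^sub>v n"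
    and diss: "\<And>x u w. x \<in> carrier_vec n \<Longrightarrow> u \<in> carrier_vec m \<Longrightarrow> w \<in> carrier_vec n \<Longrightarrow>
      A *\<^sub>v x + B *\<^sub>v u = E *\<^sub>v w \<Longrightarrow> x \<bullet> (Z *\<^sub>v w) \<le> u \<bullet> (C *\<^sub>v x + D *\<^sub>v u)"
    and D: "\<And>u. u \<in> carrier_vec m \<Longrightarrow> u \<bullet> (D *\<^sub>v u) \<ge> 0"
  obtains X where "X \<in> carrier_mat n n" "E\<^sup>T * X = X\<^sup>T * E"
    "\<And>x. x \<in> carrier_vec n \<Longrightarrow> (X *\<^sub>v x) \<bullet> (E *\<^sub>v x) \<ge> 0"
    "\<And>x u. x \<in> carrier_vec n \<Longrightarrow> u \<in> carrier_vec m \<Longrightarrow>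
      (X *\<^sub>v x) \<bullet> (A *\<^sub>v x + B *\<^sub>v u) \<le> u \<bullet> (C *\<^sub>v x + D *\<^sub>v u)"
proof -
  obtain S1 S2 where S: "S1 \<in> carrier_mat n n" "S2 \<in> carrier_mat m n"
    and ES: "\<And>f. f \<in> carrier_vec n \<Longrightarrow> E *\<^sub>v (S1 *\<^sub>v f) + B *\<^sub>v (S2 *\<^sub>v f) = f"
    and S2E: "\<And>w. w \<in> carrier_vec n \<Longrightarrow> S2 *\<^sub>v (E *\<^sub>v w) = 0\<^sub>v m"
    using adapted_right_inverse[OF ctrl] by blast
  have [simp]: "dim_row S1 = n" "dim_col S1 = n" "dim_row S2 = m" "dim_col S2 = n"
    "dim_row Z = n" "dim_col Z = n" using S Z by auto
  have S2B: "S2 *\<^sub>v (B *\<^sub>v (S2 *\<^sub>v f)) = S2 *\<^sub>v f" if f: "f \<in> carrier_vec n" for f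
  proof -
    have "S2 *\<^sub>v f = S2 *\<^sub>v (E *\<^sub>v (S1 *\<^sub>v f) + B *\<^sub>v (S2 *\<^sub>v f))" using ES[OF f] by simp
    also have "\<dots> = S2 *\<^sub>v (E *\<^sub>v (S1 *\<^sub>v f)) + S2 *\<^sub>v (B *\<^sub>v (S2 *\<^sub>v f))"
      by (simp add: mult_mat_vec_add)
    also have "S2 *\<^sub>v (E *\<^sub>v (S1 *\<^sub>v f)) = 0\<^sub>v m" by (rule S2E) (rule carrier_vecI, simp)
    finally show ?thesis by (auto simp: vec_eq_iff simp del: index_mult_mat_vec)
  qed
  \<comment> \<open>The substitution \<open>u = v - H x\<close> decouples the range condition: since
    \<open>S2 B S2 = S2\<close>, the vector \<open>S2 (A x + B u)\<close> becomes
    \<open>Pr v\<close>, free of \<open>x\<close>, and \<open>Pr\<close> is a projection.\<close>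
  define H where "H = S2 * A"
  define Q11 where "Q11 = H\<^sup>T * (D * H) - H\<^sup>T * C - Z * (S1 * (A - B * H))"
  define Q12 where "Q12 = C\<^sup>T - H\<^sup>T * (D + D\<^sup>T) - Z * (S1 * B)"
  define Pr where "Pr = S2 * B"
  have [simp]: "dim_row H = m" "dim_col H = n" "dim_row Pr = m" "dim_col Pr = m" 
    by (auto simp: H_def Pr_def)
  have Hx: "H *\<^sub>v x = S2 *\<^sub>v (A *\<^sub>v x)" if "dim_vec x = n" for x
    using that by (simp add: H_def mat_vec_distribs)
  have Pru: "Pr *\<^sub>v u = S2 *\<^sub>v (B *\<^sub>v u)" if "dim_vec u = m" for u
    using that by (simp add: Pr_def mat_vec_distribs)
  have cQ: "Q11 \<in> carrier_mat n n" "Q12 \<in> carrier_mat n m" "Pr \<in> carrier_mat m m"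
    unfolding Q11_def Q12_def by (rule carrier_matI; simp)+
  have PrPr: "Pr * Pr = Pr"
  proof (rule mat_eq_if_mult_vec_eq)
    fix u :: "real vec" assume u: "u \<in> carrier_vec m"
    have "B *\<^sub>v u \<in> carrier_vec n" by (rule carrier_vecI) simp
    from S2B[OF this] show "(Pr * Pr) *\<^sub>v u = Pr *\<^sub>v u"
      using u by (simp add: mult_mult_mat_vec Pru)
  qed (use cQ in auto)
  \<comment> \<open>Supply minus storage rate in the variables \<open>(x, v)\<close>;
    \<open>Q11\<close>, \<open>Q12\<close> and \<open>D\<close> are the coefficients of this
    form.\<close>
  define q where "q x v = (v - H *\<^sub>v x) \<bullet> (C *\<^sub>v x + D *\<^sub>v (v - H *\<^sub>v x))
      - x \<bullet> (Z *\<^sub>v (S1 *\<^sub>v (A *\<^sub>v x + B *\<^sub>v (v - H *\<^sub>v x))))" for x v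
  have q: "x \<bullet> (Q11 *\<^sub>v x) + x \<bullet> (Q12 *\<^sub>v v) + v \<bullet> (D *\<^sub>v v) = q x v"
    if x: "x \<in> carrier_vec n" and v: "v \<in> carrier_vec m" for x v
  proof -
    define h where "h = H *\<^sub>v x"
    have [simp]: "dim_vec x = n" "dim_vec v = m" "dim_vec h = m" using x v by (auto simp: h_def)
    have HT: "x \<bullet> (H\<^sup>T *\<^sub>v w) = w \<bullet> h" if "dim_vec w = m" for w
      unfolding h_def by (rule transpose_mult_scalar_prod(2)) (use that in auto)
    have 1: "x \<bullet> (Q11 *\<^sub>v x) = (D *\<^sub>v h) \<bullet> h - (C *\<^sub>v x) \<bullet> h - x \<bullet> (Z *\<^sub>v (S1 *\<^sub>v (A *\<^sub>v x - B *\<^sub>v h)))"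
      by (simp add: Q11_def mult_mult_mat_vec minus_mult_mat_vec scalar_prod_distribs HT h_def[symmetric])
    have CT: "x \<bullet> (C\<^sup>T *\<^sub>v v) = v \<bullet> (C *\<^sub>v x)" by (rule transpose_mult_scalar_prod(2)) auto
    have DT: "(D\<^sup>T *\<^sub>v v) \<bullet> h = v \<bullet> (D *\<^sub>v h)" by (rule transpose_mult_scalar_prod(1)) auto
    have 2: "x \<bullet> (Q12 *\<^sub>v v) = v \<bullet> (C *\<^sub>v x) - ((D *\<^sub>v v) \<bullet> h + v \<bullet> (D *\<^sub>v h)) - x \<bullet> (Z *\<^sub>v (S1 *\<^sub>v (B *\<^sub>v v)))"
      by (simp add: Q12_def mult_mult_mat_vec minus_mult_mat_vec add_mult_mat_vec scalar_prod_distribs HT CT DT)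
    show ?thesis unfolding 1 2 q_def h_def[symmetric]
      by (simp add: mat_vec_distribs scalar_prod_distribs scalar_prod_commute[of _ h])
  qed
  have S2f: "S2 *\<^sub>v (A *\<^sub>v x + B *\<^sub>v (v - H *\<^sub>v x)) = Pr *\<^sub>v v"
    if x: "x \<in> carrier_vec n" and v: "v \<in> carrier_vec m" for x v
  proof -
    have "A *\<^sub>v x \<in> carrier_vec n" by (rule carrier_vecI) simp
    then show ?thesis using x v S2B[of "A *\<^sub>v x"]
      by (simp add: mat_vec_distribs Hx Pru) (auto simp: vec_eq_iff simp del: index_mult_mat_vec)
  qed
  have psd2: "x \<bullet> (Q11 *\<^sub>v x) + x \<bullet> (Q12 *\<^sub>v v) + v \<bullet> (D *\<^sub>v v) \<ge> 0"
    if x: "x \<in> carrier_vec n" and v: "v \<in> carrier_vec m" and Pv: "Pr *\<^sub>v v = 0\<^sub>v m" for x v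
  proof -
    define f where "f = A *\<^sub>v x + B *\<^sub>v (v - H *\<^sub>v x)"
    have f: "f \<in> carrier_vec n" unfolding f_def by (rule carrier_vecI) simp
    have "S2 *\<^sub>v f = 0\<^sub>v m" unfolding f_def S2f[OF x v] by (rule Pv)
    then have "E *\<^sub>v (S1 *\<^sub>v f) + 0\<^sub>v n = f" using ES[OF f] by (simp add: mat_vec_distribs)
    then have "f = E *\<^sub>v (S1 *\<^sub>v f)" by (auto simp: vec_eq_iff simp del: index_mult_mat_vec)
    moreover have "v - H *\<^sub>v x \<in> carrier_vec m" "S1 *\<^sub>v f \<in> carrier_vec n"
      by (rule carrier_vecI; simp)+
    ultimately have "x \<bullet> (Z *\<^sub>v (S1 *\<^sub>v f)) \<le> (v - H *\<^sub>v x) \<bullet> (C *\<^sub>v x + D *\<^sub>v (v - H *\<^sub>v x))"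
      using diss[OF x] unfolding f_def by metis
    then show ?thesis unfolding q[OF x v] q_def f_def by simp
  qed
  obtain Y where Y: "Y \<in> carrier_mat n m"
    and Yle: "\<And>x v. x \<in> carrier_vec n \<Longrightarrow> v \<in> carrier_vec m \<Longrightarrow>
      x \<bullet> (Q11 *\<^sub>v x) + x \<bullet> (Q12 *\<^sub>v v) + v \<bullet> (D *\<^sub>v v) - x \<bullet> (Y *\<^sub>v (Pr *\<^sub>v v)) \<ge> 0"
    using psd_completion[OF cQ(1,2) carriers(5) cQ(3) PrPr D psd2] by blast
  \<comment> \<open>The transpose of the solution \<open>X\<close>; the completion \<open>Y\<close>
    supplies its action outside the range of \<open>E\<close>.\<close>
  define Xt where "Xt = Z * S1 + Y * S2"
  have [simp]: "dim_row Y = n" "dim_col Y = m" using Y by auto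
  have Xt: "Xt \<in> carrier_mat n n" unfolding Xt_def by (rule carrier_matI) simp_all
  have [simp]: "dim_row Xt = n" "dim_col Xt = n" using Xt by auto
  have Xtf: "Xt *\<^sub>v f = Z *\<^sub>v (S1 *\<^sub>v f) + Y *\<^sub>v (S2 *\<^sub>v f)" if "dim_vec f = n" for f
    using that by (simp add: Xt_def mat_vec_distribs)
  have XtE: "Xt *\<^sub>v (E *\<^sub>v w) = Z *\<^sub>v w" if w: "w \<in> carrier_vec n" for w
  proof -
    have Ew: "E *\<^sub>v w \<in> carrier_vec n" by (rule carrier_vecI) simp
    \<comment> \<open>\<open>S1\<close> returns some preimage of \<open>E w\<close>, not
      \<open>w\<close> itself; the two differ by a kernel vector of \<open>E\<close>, on which
      \<open>Z\<close> vanishes.\<close>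
    define d where "d = S1 *\<^sub>v (E *\<^sub>v w) - w"
    have d: "d \<in> carrier_vec n" unfolding d_def by (rule carrier_vecI) (use w in simp)
    have "E *\<^sub>v (S1 *\<^sub>v (E *\<^sub>v w)) + 0\<^sub>v n = E *\<^sub>v w"
      using ES[OF Ew] by (simp add: S2E[OF w] mat_vec_distribs)
    then have "E *\<^sub>v (S1 *\<^sub>v (E *\<^sub>v w)) = E *\<^sub>v w" by (auto simp: vec_eq_iff simp del: index_mult_mat_vec)
    then have "E *\<^sub>v d = 0\<^sub>v n" using w by (simp add: d_def mat_vec_distribs)
    then have "Z *\<^sub>v d = 0\<^sub>v n" by (rule ker[OF d])
    then have "Z *\<^sub>v (S1 *\<^sub>v (E *\<^sub>v w)) = Z *\<^sub>v w"
      using w by (simp add: d_def mat_vec_distribs) (auto simp: vec_eq_iff simp del: index_mult_mat_vec)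
    then show ?thesis by (simp add: Xtf S2E[OF w] mat_vec_distribs) (auto simp: vec_eq_iff)
  qed
  have XtE': "Xt * E = Z"
    by (rule mat_eq_if_mult_vec_eq[of _ n n]) (use Xt carriers Z XtE in \<open>auto simp: mult_mult_mat_vec\<close>)
  show thesis
  proof (rule that[of "Xt\<^sup>T"])
    have XT: "(Xt\<^sup>T *\<^sub>v x) \<bullet> f = x \<bullet> (Xt *\<^sub>v f)" if "x \<in> carrier_vec n" "dim_vec f = n" for x f
      by (rule transpose_mult_scalar_prod(1)) (use that in auto)
    show "Xt\<^sup>T \<in> carrier_mat n n" using Xt by simp
    have "E\<^sup>T * Xt\<^sup>T = (Xt * E)\<^sup>T" by (rule transpose_mult[symmetric]) (use Xt carriers in auto)
    then show "E\<^sup>T * Xt\<^sup>T = (Xt\<^sup>T)\<^sup>T * E" unfolding XtE' using Z(2) XtE' by simp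
    show "(Xt\<^sup>T *\<^sub>v x) \<bullet> (E *\<^sub>v x) \<ge> 0" if x: "x \<in> carrier_vec n" for x
      using XT[OF x, of "E *\<^sub>v x"] XtE[OF x] nonneg[OF x] by simp
    show "(Xt\<^sup>T *\<^sub>v x) \<bullet> (A *\<^sub>v x + B *\<^sub>v u) \<le> u \<bullet> (C *\<^sub>v x + D *\<^sub>v u)"
      if x: "x \<in> carrier_vec n" and u: "u \<in> carrier_vec m" for x u
    proof -
      define v where "v = u + H *\<^sub>v x"
      have v: "v \<in> carrier_vec m" unfolding v_def by (rule carrier_vecI) (use u in simp)
      have uv: "v - H *\<^sub>v x = u" using u by (auto simp: v_def vec_eq_iff simp del: index_mult_mat_vec)
      define f where "f = A *\<^sub>v x + B *\<^sub>v u"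
      have df: "dim_vec f = n" by (simp add: f_def)
      have "u \<bullet> (C *\<^sub>v x + D *\<^sub>v u) - x \<bullet> (Z *\<^sub>v (S1 *\<^sub>v f)) - x \<bullet> (Y *\<^sub>v (S2 *\<^sub>v f)) \<ge> 0"
        using Yle[OF x v] S2f[OF x v] unfolding q[OF x v] q_def uv f_def by simp
      moreover have "(Xt\<^sup>T *\<^sub>v x) \<bullet> f = x \<bullet> (Z *\<^sub>v (S1 *\<^sub>v f)) + x \<bullet> (Y *\<^sub>v (S2 *\<^sub>v f))"
        using x df by (simp add: XT Xtf scalar_prod_distribs)
      ultimately show ?thesis by (simp add: f_def)
    qed
  qed
qed

end

section \<open>Available storage of the Cayley transform\<close>

locale cayley_descriptor = descriptor +
  fixes R :: "real mat"
  assumes R: "R \<in> carrier_mat n n" "(E - A) * R = 1\<^sub>m n" "R * (E - A) = 1\<^sub>m n"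
begin

lemma R_dims [simp]: "dim_row R = n" "dim_col R = n"
  using R(1) by auto

lemma EA_R: "dim_vec v = n \<Longrightarrow> (E - A) *\<^sub>v (R *\<^sub>v v) = v"
  using arg_cong[OF R(2), of "\<lambda>M. M *\<^sub>v v"] by (simp add: mult_mult_mat_vec one_mult_mat_vec')

lemma R_EA: "dim_vec v = n \<Longrightarrow> R *\<^sub>v ((E - A) *\<^sub>v v) = v"
  using arg_cong[OF R(3), of "\<lambda>M. M *\<^sub>v v"] by (simp add: mult_mult_mat_vec one_mult_mat_vec')

text \<open>The Cayley transform \<open>s = (1 - z) / (1 + z)\<close> of the system: if \<open>f = A x + B u\<close> is the
  derivative of \<open>E x\<close>, then \<open>E x - f\<close> and \<open>E x + f\<close> are consecutive states.\<close>

definition descr_state :: "real vec \<Rightarrow> real vec \<Rightarrow> real vec" where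
  "descr_state \<xi> u = R *\<^sub>v (\<xi> + B *\<^sub>v u)"

definition next_state :: "real vec \<Rightarrow> real vec \<Rightarrow> real vec" where
  "next_state \<xi> u = 2 \<cdot>\<^sub>v (E *\<^sub>v descr_state \<xi> u) - \<xi>"

definition out :: "real vec \<Rightarrow> real vec \<Rightarrow> real vec" where
  "out \<xi> u = C *\<^sub>v descr_state \<xi> u + D *\<^sub>v u"

fun state :: "real vec \<Rightarrow> (nat \<Rightarrow> real vec) \<Rightarrow> nat \<Rightarrow> real vec" where
  "state \<xi> u 0 = \<xi>"
| "state \<xi> u (Suc k) = next_state (state \<xi> u k) (u k)"

definition supplied :: "nat \<Rightarrow> real vec \<Rightarrow> (nat \<Rightarrow> real vec) \<Rightarrow> real" where
  "supplied N \<xi> u = (\<Sum>k<N. u k \<bullet> out (state \<xi> u k) (u k))"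

lemma dim_descr_state [simp]: "dim_vec (descr_state \<xi> u) = n"
  by (simp add: descr_state_def)

lemma dim_out [simp]: "dim_vec (out \<xi> u) = m"
  by (simp add: out_def)

lemma dim_next_state [simp]: "dim_vec (next_state \<xi> u) = dim_vec \<xi>"
  by (simp add: next_state_def)

lemma dim_state [simp]: "dim_vec (state \<xi> u k) = dim_vec \<xi>"
  by (induction k) auto

lemma state_add: "state \<xi> u (L + k) = state (state \<xi> u L) (\<lambda>k. u (L + k)) k"
  by (induction k) auto

lemma state_cong: "(\<And>j. j < k \<Longrightarrow> u j = v j) \<Longrightarrow> state \<xi> u k = state \<xi> v k"
  by (induction k) auto

lemma supplied_cong: "(\<And>j. j < N \<Longrightarrow> u j = v j) \<Longrightarrow> supplied N \<xi> u = supplied N \<xi> v"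
  unfolding supplied_def by (rule sum.cong) (auto intro!: arg_cong2[of _ _ _ _ scalar_prod]
      arg_cong2[of _ _ _ _ out] state_cong)

lemma supplied_add:
  "supplied (L + N) \<xi> u = supplied L \<xi> u + supplied N (state \<xi> u L) (\<lambda>k. u (L + k))"
proof -
  have "supplied (L + N) \<xi> u = supplied L \<xi> u + (\<Sum>k=L..<L + N. u k \<bullet> out (state \<xi> u k) (u k))"
    unfolding supplied_def lessThan_atLeast0
    by (rule sum.atLeastLessThan_concat[symmetric]) simp_all
  also have "(\<Sum>k=L..<L + N. u k \<bullet> out (state \<xi> u k) (u k)) =
      (\<Sum>k<N. u (L + k) \<bullet> out (state \<xi> u (L + k)) (u (L + k)))"
    using sum.shift_bounds_nat_ivl[of _ 0 L N] by (simp add: lessThan_atLeast0 add.commute)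
  also have "\<dots> = supplied N (state \<xi> u L) (\<lambda>k. u (L + k))"
    unfolding supplied_def by (simp only: state_add)
  finally show ?thesis .
qed

definition input :: "(nat \<Rightarrow> real vec) \<Rightarrow> bool" where
  "input u \<longleftrightarrow> (\<forall>k. dim_vec (u k) = m)"

lemma descr_state_lin:
  assumes "dim_vec \<xi> = n" "dim_vec \<eta> = n" "dim_vec u = m" "dim_vec v = m"
  shows "descr_state (\<xi> + t \<cdot>\<^sub>v \<eta>) (u + t \<cdot>\<^sub>v v) = descr_state \<xi> u + t \<cdot>\<^sub>v descr_state \<eta> v"
proof -
  have "\<xi> + t \<cdot>\<^sub>v \<eta> + B *\<^sub>v (u + t \<cdot>\<^sub>v v) = (\<xi> + B *\<^sub>v u) + t \<cdot>\<^sub>v (\<eta> + B *\<^sub>v v)"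
    using assms by (simp add: mat_vec_distribs)
      (auto simp: vec_eq_iff algebra_simps simp del: index_mult_mat_vec)
  then show ?thesis using assms unfolding descr_state_def by (simp add: mat_vec_distribs)
qed

lemma out_lin:
  assumes "dim_vec \<xi> = n" "dim_vec \<eta> = n" "dim_vec u = m" "dim_vec v = m"
  shows "out (\<xi> + t \<cdot>\<^sub>v \<eta>) (u + t \<cdot>\<^sub>v v) = out \<xi> u + t \<cdot>\<^sub>v out \<eta> v"
  using assms unfolding out_def descr_state_lin[OF assms]
  by (simp add: mat_vec_distribs)
     (auto simp: vec_eq_iff algebra_simps simp del: index_mult_mat_vec)

lemma next_state_lin:
  assumes "dim_vec \<xi> = n" "dim_vec \<eta> = n" "dim_vec u = m" "dim_vec v = m"
  shows "next_state (\<xi> + t \<cdot>\<^sub>v \<eta>) (u + t \<cdot>\<^sub>v v) = next_state \<xi> u + t \<cdot>\<^sub>v next_state \<eta> v"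
  using assms unfolding next_state_def descr_state_lin[OF assms]
  by (simp add: mat_vec_distribs)
     (auto simp: vec_eq_iff algebra_simps simp del: index_mult_mat_vec)

lemma state_lin:
  assumes "dim_vec \<xi> = n" "dim_vec \<eta> = n" "input u" "input v"
  shows "state (\<xi> + t \<cdot>\<^sub>v \<eta>) (\<lambda>k. u k + t \<cdot>\<^sub>v v k) k = state \<xi> u k + t \<cdot>\<^sub>v state \<eta> v k"
  by (induction k) (use assms in \<open>auto simp: input_def next_state_lin\<close>)

lemma supplied_lin:
  assumes "dim_vec \<xi> = n" "dim_vec \<eta> = n" "input u" "input v"
  shows "supplied N (\<xi> + t \<cdot>\<^sub>v \<eta>) (\<lambda>k. u k + t \<cdot>\<^sub>v v k) = supplied N \<xi> u + t\<^sup>2 * supplied N \<eta> v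
    + t * (\<Sum>k<N. u k \<bullet> out (state \<eta> v k) (v k) + v k \<bullet> out (state \<xi> u k) (u k))"
proof -
  have "(u k + t \<cdot>\<^sub>v v k) \<bullet> out (state (\<xi> + t \<cdot>\<^sub>v \<eta>) (\<lambda>k. u k + t \<cdot>\<^sub>v v k) k) (u k + t \<cdot>\<^sub>v v k) =
    u k \<bullet> out (state \<xi> u k) (u k) + t\<^sup>2 * (v k \<bullet> out (state \<eta> v k) (v k))
    + t * (u k \<bullet> out (state \<eta> v k) (v k) + v k \<bullet> out (state \<xi> u k) (u k))" for k
    unfolding state_lin[OF assms] using assms
    by (simp add: input_def out_lin scalar_prod_distribs algebra_simps power2_eq_square)
  then show ?thesis unfolding supplied_def
    by (simp only: sum.distrib sum_distrib_left distrib_left)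
qed

text \<open>The expansions at \<open>t = 1\<close> and \<open>t = -1\<close> are added, which
  cancels the mixed term.\<close>

lemma supplied_parallelogram:
  assumes "dim_vec \<xi> = n" "dim_vec \<eta> = n" "input u" "input v"
  shows "supplied N (\<xi> + \<eta>) (\<lambda>k. u k + v k) + supplied N (\<xi> - \<eta>) (\<lambda>k. u k - v k) =
    2 * supplied N \<xi> u + 2 * supplied N \<eta> v"
proof -
  have "\<xi> - \<eta> = \<xi> + (-1) \<cdot>\<^sub>v \<eta>" "\<And>k. u k - v k = u k + (-1) \<cdot>\<^sub>v v k"
    using assms by (auto simp: vec_eq_iff input_def)
  then show ?thesis
    using supplied_lin[OF assms, of N 1] supplied_lin[OF assms, of N "-1"] by simp
qed

lemma supplied_smult:
  assumes "dim_vec \<xi> = n" "input u"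
  shows "supplied N (t \<cdot>\<^sub>v \<xi>) (\<lambda>k. t \<cdot>\<^sub>v u k) = t\<^sup>2 * supplied N \<xi> u"
proof -
  have i0: "input (\<lambda>k. 0\<^sub>v m)" by (simp add: input_def)
  have e: "t \<cdot>\<^sub>v \<xi> = 0\<^sub>v n + t \<cdot>\<^sub>v \<xi>" "\<And>k. t \<cdot>\<^sub>v u k = 0\<^sub>v m + t \<cdot>\<^sub>v u k"
    using assms by (auto simp: vec_eq_iff input_def)
  have s0: "state (0\<^sub>v n) (\<lambda>k. 0\<^sub>v m) k = 0\<^sub>v n" for k
    by (induction k) (auto simp: next_state_def descr_state_def mat_vec_distribs)
  have o0: "out (0\<^sub>v n) (0\<^sub>v m) = 0\<^sub>v m"
    by (simp add: out_def descr_state_def mat_vec_distribs)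
  have "supplied N (0\<^sub>v n) (\<lambda>k. 0\<^sub>v m) = 0" by (simp add: supplied_def scalar_prod_distribs)
  moreover have "(\<Sum>k<N. 0\<^sub>v m \<bullet> out (state \<xi> u k) (u k) + u k \<bullet> out (state (0\<^sub>v n) (\<lambda>k. 0\<^sub>v m) k) (0\<^sub>v m)) = 0"
    by (rule sum.neutral) (use assms in \<open>auto simp: s0 o0 scalar_prod_distribs input_def\<close>)
  moreover have "supplied N (0\<^sub>v n + t \<cdot>\<^sub>v \<xi>) (\<lambda>k. 0\<^sub>v m + t \<cdot>\<^sub>v u k) =
      supplied N (0\<^sub>v n) (\<lambda>k. 0\<^sub>v m) + t\<^sup>2 * supplied N \<xi> u +
      t * (\<Sum>k<N. 0\<^sub>v m \<bullet> out (state \<xi> u k) (u k) +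
        u k \<bullet> out (state (0\<^sub>v n) (\<lambda>k. 0\<^sub>v m) k) (0\<^sub>v m))"
    by (rule supplied_lin) (use assms i0 in auto)
  ultimately show ?thesis by (simp only: e[symmetric])
qed

text \<open>A zero input supplies nothing whatever the state. Inputs over different horizons can
  thus be brought to a common one and added.\<close>

lemma supplied_pad:
  assumes u: "input u" and "N \<le> N'"
  obtains u' where "input u'" "supplied N' \<xi> u' = supplied N \<xi> u"
proof -
  define u' where "u' k = (if k < N then u k else 0\<^sub>v m)" for k
  have "supplied N' \<xi> u' = (\<Sum>k<N. u' k \<bullet> out (state \<xi> u' k) (u' k))"
    unfolding supplied_def using assms(2)
    by (intro sum.mono_neutral_right) (auto simp: u'_def scalar_prod_distribs)
  also have "\<dots> = supplied N \<xi> u'" by (simp add: supplied_def)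
  also have "\<dots> = supplied N \<xi> u" by (rule supplied_cong) (simp add: u'_def)
  finally show thesis using that[of u'] u by (auto simp: input_def u'_def)
qed

text \<open>Willems' available storage: the supremum of the energy that can be extracted from a
  state. Steering from 0 to that state bounds it, since passivity limits the total. Being the
  supremum of jointly quadratic functionals over a linear space of inputs, it obeys the
  parallelogram law and is a quadratic form.\<close>

lemma storage_from_passivity:
  assumes dissipative: "\<And>N u. input u \<Longrightarrow> supplied N (0\<^sub>v n) u \<ge> 0"
    and reach: "\<And>w. w \<in> carrier_vec n \<Longrightarrow> \<exists>L u. input u \<and> state (0\<^sub>v n) u L = E *\<^sub>v w"
  obtains P where "P \<in> carrier_mat n n" "P\<^sup>T = P"
    "\<And>w. w \<in> carrier_vec n \<Longrightarrow> w \<bullet> (P *\<^sub>v w) \<ge> 0"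
    "\<And>w. w \<in> carrier_vec n \<Longrightarrow> E *\<^sub>v w = 0\<^sub>v n \<Longrightarrow> P *\<^sub>v w = 0\<^sub>v n"
    "\<And>x u w. x \<in> carrier_vec n \<Longrightarrow> u \<in> carrier_vec m \<Longrightarrow> w \<in> carrier_vec n \<Longrightarrow>
      A *\<^sub>v x + B *\<^sub>v u = E *\<^sub>v w \<Longrightarrow> x \<bullet> (P *\<^sub>v w) \<le> u \<bullet> (C *\<^sub>v x + D *\<^sub>v u)"
proof -
  \<comment> \<open>The state is parametrized as \<open>E w\<close>, so that the storage is a
    function on all vectors and vanishes on the kernel of \<open>E\<close>.\<close>
  define S where "S w = {- supplied N (E *\<^sub>v w) u | N u. input u}" for w
  define V where "V w = Sup (S w)" for w
  have bdd: "bdd_above (S w)" if w: "w \<in> carrier_vec n" for w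
  proof -
    obtain L a where a: "input a" "state (0\<^sub>v n) a L = E *\<^sub>v w" using reach[OF w] by blast
    have "- supplied N (E *\<^sub>v w) u \<le> supplied L (0\<^sub>v n) a" if u: "input u" for N u
    proof -
      \<comment> \<open>First steer from 0 to \<open>E w\<close> in \<open>L\<close> steps, then
        apply \<open>u\<close>; passivity of the whole run gives a bound that does not depend on
        \<open>u\<close>.\<close>
      define b where "b k = (if k < L then a k else u (k - L))" for k
      have "input b" using a(1) u by (simp add: input_def b_def)
      then have "0 \<le> supplied (L + N) (0\<^sub>v n) b" by (rule dissipative)
      also have "\<dots> = supplied L (0\<^sub>v n) b + supplied N (state (0\<^sub>v n) b L) (\<lambda>k. b (L + k))"
        by (rule supplied_add)
      also have "supplied L (0\<^sub>v n) b = supplied L (0\<^sub>v n) a" by (rule supplied_cong) (simp add: b_def)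
      also have "state (0\<^sub>v n) b L = E *\<^sub>v w"
        unfolding a(2)[symmetric] by (rule state_cong) (simp add: b_def)
      also have "(\<lambda>k. b (L + k)) = u" by (simp add: b_def)
      finally show ?thesis by simp
    qed
    then show ?thesis by (intro bdd_aboveI[of _ "supplied L (0\<^sub>v n) a"]) (auto simp: S_def)
  qed
  have i0: "input (\<lambda>k. 0\<^sub>v m)" by (simp add: input_def)
  have ne: "S w \<noteq> {}" for w using i0 by (auto simp: S_def)
  have upper: "- supplied N (E *\<^sub>v w) u \<le> V w" if "w \<in> carrier_vec n" "input u" for N w u
    unfolding V_def using bdd[OF that(1)] that(2) by (intro cSup_upper) (auto simp: S_def)
  have least: "V w \<le> c" if "\<And>N u. input u \<Longrightarrow> - supplied N (E *\<^sub>v w) u \<le> c" for w c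
    unfolding V_def using ne that by (intro cSup_least) (auto simp: S_def)
  have V_nonneg: "V w \<ge> 0" if "w \<in> carrier_vec n" for w
    using upper[OF that i0, of 0] by (simp add: supplied_def)
  have V_ker: "V w = 0" if w: "w \<in> carrier_vec n" "E *\<^sub>v w = 0\<^sub>v n" for w
    using V_nonneg[OF w(1)] least[of w 0] dissipative w(2) by fastforce
  have V_smult_ge: "t\<^sup>2 * V w \<le> V (t \<cdot>\<^sub>v w)" if w: "w \<in> carrier_vec n" and t: "t \<noteq> 0" for t w
  proof -
    have "V w \<le> V (t \<cdot>\<^sub>v w) / t\<^sup>2"
    proof (rule least)
      fix N u assume u: "input u"
      have "input (\<lambda>k. t \<cdot>\<^sub>v u k)" using u by (simp add: input_def)
      from upper[OF _ this, of "t \<cdot>\<^sub>v w" N] have "- (t\<^sup>2 * supplied N (E *\<^sub>v w) u) \<le> V (t \<cdot>\<^sub>v w)"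
        using w u by (simp add: mat_vec_distribs supplied_smult)
      then show "- supplied N (E *\<^sub>v w) u \<le> V (t \<cdot>\<^sub>v w) / t\<^sup>2" using t by (simp add: field_simps)
    qed
    then show ?thesis using t by (simp add: field_simps)
  qed
  have V_smult: "V (t \<cdot>\<^sub>v w) = t\<^sup>2 * V w" if w: "w \<in> carrier_vec n" for t w
  proof (cases "t = 0")
    case True
    have "E *\<^sub>v (t \<cdot>\<^sub>v w) = 0\<^sub>v n" using w True by (auto simp: mat_vec_distribs vec_eq_iff)
    then show ?thesis using V_ker[of "t \<cdot>\<^sub>v w"] w True by simp
  next
    case False
    have "(1 / t)\<^sup>2 * V (t \<cdot>\<^sub>v w) \<le> V ((1 / t) \<cdot>\<^sub>v (t \<cdot>\<^sub>v w))"
      by (rule V_smult_ge) (use w False in auto)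
    also have "(1 / t) \<cdot>\<^sub>v (t \<cdot>\<^sub>v w) = w" using False by (auto simp: vec_eq_iff)
    finally have "V (t \<cdot>\<^sub>v w) \<le> t\<^sup>2 * V w" using False by (simp add: field_simps)
    then show ?thesis using V_smult_ge[OF w False] by simp
  qed
  \<comment> \<open>For inputs competing at \<open>x\<close> and at \<open>y\<close>, padded to a
    common horizon, their sum and difference compete at \<open>x + y\<close> and
    \<open>x - y\<close>.\<close>
  have V_ge: "2 * V x + 2 * V y \<le> V (x + y) + V (x - y)"
    if x: "x \<in> carrier_vec n" and y: "y \<in> carrier_vec n" for x y
  proof -
    have *: "- (2 * supplied N1 (E *\<^sub>v x) u) - 2 * supplied N2 (E *\<^sub>v y) v \<le> V (x + y) + V (x - y)"
      if u: "input u" and v: "input v" for N1 N2 u v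
    proof -
      obtain u' where u': "input u'" "supplied (max N1 N2) (E *\<^sub>v x) u' = supplied N1 (E *\<^sub>v x) u"
        using supplied_pad[OF u, of N1 "max N1 N2" "E *\<^sub>v x"] by auto
      obtain v' where v': "input v'" "supplied (max N1 N2) (E *\<^sub>v y) v' = supplied N2 (E *\<^sub>v y) v"
        using supplied_pad[OF v, of N2 "max N1 N2" "E *\<^sub>v y"] by auto
      have i: "input (\<lambda>k. u' k + v' k)" "input (\<lambda>k. u' k - v' k)"
        using u' v' by (auto simp: input_def)
      show ?thesis
        using upper[OF _ i(1), of "x + y" "max N1 N2"] upper[OF _ i(2), of "x - y" "max N1 N2"]
          supplied_parallelogram[of "E *\<^sub>v x" "E *\<^sub>v y" u' v' "max N1 N2"] u' v' x y
        by (simp add: mat_vec_distribs)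
    qed
    have "V x \<le> (V (x + y) + V (x - y) - 2 * V y) / 2"
    proof (rule least)
      fix N1 u assume u: "input u"
      have "V y \<le> (V (x + y) + V (x - y) + 2 * supplied N1 (E *\<^sub>v x) u) / 2"
      proof (rule least)
        fix N2 v assume v: "input v"
        show "- supplied N2 (E *\<^sub>v y) v \<le> (V (x + y) + V (x - y) + 2 * supplied N1 (E *\<^sub>v x) u) / 2"
          using *[OF u v, of N1 N2] by (simp add: field_simps)
      qed
      then show "- supplied N1 (E *\<^sub>v x) u \<le> (V (x + y) + V (x - y) - 2 * V y) / 2"
        by (simp add: field_simps)
    qed
    then show ?thesis by (simp add: field_simps)
  qed
  \<comment> \<open>The reverse inequality is \<open>V_ge\<close> at \<open>x + y\<close> and
    \<open>x - y\<close>, combined with homogeneity at the factor 2.\<close>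
  have par: "V (x + y) + V (x - y) = 2 * V x + 2 * V y"
    if x: "x \<in> carrier_vec n" and y: "y \<in> carrier_vec n" for x y
  proof -
    have e: "x + y + (x - y) = 2 \<cdot>\<^sub>v x" "x + y - (x - y) = 2 \<cdot>\<^sub>v y"
      using x y by (auto simp: vec_eq_iff)
    have "2 * V (x + y) + 2 * V (x - y) \<le> V (2 \<cdot>\<^sub>v x) + V (2 \<cdot>\<^sub>v y)"
      using V_ge[of "x + y" "x - y"] x y unfolding e by simp
    then show ?thesis using V_ge[OF x y] x y by (simp add: V_smult)
  qed
  obtain Q where Q: "Q \<in> carrier_mat n n" "Q\<^sup>T = Q" and VQ: "\<And>w. w \<in> carrier_vec n \<Longrightarrow> V w = w \<bullet> (Q *\<^sub>v w)"
    using parallelogram_imp_quadratic_form[of n V] V_nonneg V_smult par by blast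
  have [simp]: "dim_row Q = n" "dim_col Q = n" using Q by auto
  have Q_sym: "x \<bullet> (Q *\<^sub>v y) = y \<bullet> (Q *\<^sub>v x)" if "x \<in> carrier_vec n" "y \<in> carrier_vec n" for x y
    using transpose_mult_scalar_prod(2)[of x Q y] that Q(2) by simp
  have Q_expand: "V (x + t \<cdot>\<^sub>v y) = V x + 2 * t * (x \<bullet> (Q *\<^sub>v y)) + t\<^sup>2 * V y"
    if x: "x \<in> carrier_vec n" and y: "y \<in> carrier_vec n" for x y t
    using x y Q_sym[OF x y]
    by (simp add: VQ mat_vec_distribs scalar_prod_distribs algebra_simps power2_eq_square)
  have Q_ker: "Q *\<^sub>v w = 0\<^sub>v n" if w: "w \<in> carrier_vec n" "E *\<^sub>v w = 0\<^sub>v n" for w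
  proof (rule vec_eq_zero_if_orthogonal)
    fix y :: "real vec" assume y: "y \<in> carrier_vec n"
    have "V y * t\<^sup>2 + 2 * (w \<bullet> (Q *\<^sub>v y)) * t \<ge> 0" for t
      using V_nonneg[of "w + t \<cdot>\<^sub>v y"] w y Q_expand[OF w(1) y, of t] V_ker[OF w] by (simp add: algebra_simps)
    from quadratic_nonneg_imp_linear_zero[OF this] show "y \<bullet> (Q *\<^sub>v w) = 0"
      using Q_sym[OF w(1) y] by simp
  qed (auto intro: carrier_vecI)
  \<comment> \<open>With derivative \<open>E w\<close>, the states before and after the step are
    \<open>E (x - w)\<close> and \<open>E (x + w)\<close>, and \<open>V (x + w) - V (x - w)\<close>
    equals \<open>4 * (x \<bullet> (Q w))\<close>. The factor 4 is absorbed into the final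
    matrix.\<close>
  have diss: "4 * (x \<bullet> (Q *\<^sub>v w)) \<le> u \<bullet> (C *\<^sub>v x + D *\<^sub>v u)"
    if x: "x \<in> carrier_vec n" and u: "u \<in> carrier_vec m" and w: "w \<in> carrier_vec n"
      and f: "A *\<^sub>v x + B *\<^sub>v u = E *\<^sub>v w" for x u w
  proof -
    have "E *\<^sub>v (x - w) + B *\<^sub>v u = (E - A) *\<^sub>v x"
    proof -
      have "E *\<^sub>v (x - w) + B *\<^sub>v u = E *\<^sub>v x - (A *\<^sub>v x + B *\<^sub>v u) + B *\<^sub>v u"
        using x w unfolding f by (simp add: mat_vec_distribs)
      also have "\<dots> = (E - A) *\<^sub>v x"
        using x by (simp add: mat_vec_distribs) (auto simp: vec_eq_iff simp del: index_mult_mat_vec)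
      finally show ?thesis .
    qed
    then have ds: "descr_state (E *\<^sub>v (x - w)) u = x" using x R_EA by (simp add: descr_state_def)
    have ns: "next_state (E *\<^sub>v (x - w)) u = E *\<^sub>v (x + w)"
      unfolding next_state_def ds using x w by (simp add: mat_vec_distribs)
        (auto simp: vec_eq_iff simp del: index_mult_mat_vec)
    have xw: "x + w \<in> carrier_vec n" "x - w \<in> carrier_vec n" using x w by auto
    have "V (x + w) \<le> V (x - w) + u \<bullet> (C *\<^sub>v x + D *\<^sub>v u)"
    proof (rule least)
      fix N v assume v: "input v"
      \<comment> \<open>One step with \<open>u\<close> followed by an arbitrary \<open>v\<close>:
        the dynamic programming bound over a single step.\<close>
      define b where "b k = (if k < Suc 0 then u else v (k - 1))" for k
      have b: "input b" using u v by (simp add: input_def b_def)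
      have s1: "supplied 1 (E *\<^sub>v (x - w)) b = u \<bullet> out (E *\<^sub>v (x - w)) u"
        by (simp add: supplied_def b_def)
      have "supplied (1 + N) (E *\<^sub>v (x - w)) b = u \<bullet> out (E *\<^sub>v (x - w)) u +
          supplied N (state (E *\<^sub>v (x - w)) b 1) (\<lambda>k. b (1 + k))"
        by (simp only: supplied_add s1)
      also have "state (E *\<^sub>v (x - w)) b 1 = E *\<^sub>v (x + w)" using ns by (simp add: b_def)
      also have "(\<lambda>k. b (1 + k)) = v" by (simp add: b_def)
      finally show "- supplied N (E *\<^sub>v (x + w)) v \<le> V (x - w) + u \<bullet> (C *\<^sub>v x + D *\<^sub>v u)"
        using upper[OF xw(2) b, of "1 + N"] by (simp add: out_def ds)
    qed
    moreover have "V (x - w) = V x - 2 * (x \<bullet> (Q *\<^sub>v w)) + V w"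
    proof -
      have "x - w = x + (-1) \<cdot>\<^sub>v w" using x w by (auto simp: vec_eq_iff)
      then show ?thesis using Q_expand[OF x w, of "-1"] by simp
    qed
    moreover have "V (x + w) = V x + 2 * (x \<bullet> (Q *\<^sub>v w)) + V w"
      using Q_expand[OF x w, of 1] by simp
    ultimately show ?thesis by simp
  qed
  show thesis
  proof (rule that[of "4 \<cdot>\<^sub>m Q"])
    have "(4 \<cdot>\<^sub>m Q)\<^sup>T = 4 \<cdot>\<^sub>m Q\<^sup>T" by (rule eq_matI) auto
    then show "(4 \<cdot>\<^sub>m Q)\<^sup>T = 4 \<cdot>\<^sub>m Q" using Q(2) by simp
  qed (use Q V_nonneg VQ Q_ker diss in \<open>auto simp: smult_mult_mat_vec scalar_prod_distribs\<close>)
qed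

end

section \<open>Reachability of the discrete system\<close>

context cayley_descriptor
begin

text \<open>The state matrix of the Cayley transform, equal to
  \<open>(E + A) (E - A)\<inverse>\<close> because \<open>2 E - (E - A) = E + A\<close>.\<close>

definition "Ad = 2 \<cdot>\<^sub>m (E * R) - 1\<^sub>m n"

lemma Ad_dims [simp]: "dim_row Ad = n" "dim_col Ad = n"
  by (auto simp: Ad_def)

text \<open>The true input matrix is \<open>2 E R B\<close>, and its factor
  \<open>2 E R = Ad + 1\<close> commutes with \<open>Ad\<close>. Pulling this factor out of the
  trajectory leaves a recursion with input matrix \<open>B\<close>, to which the Hautus test
  applies.\<close>

fun krylov_state :: "(nat \<Rightarrow> real vec) \<Rightarrow> nat \<Rightarrow> real vec" where
  "krylov_state u 0 = 0\<^sub>v n"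
| "krylov_state u (Suc k) = Ad *\<^sub>v krylov_state u k + B *\<^sub>v u k"

lemma dim_krylov_state [simp]: "dim_vec (krylov_state u k) = n"
  by (cases k) auto

lemma krylov_state_cong: "(\<And>j. j < k \<Longrightarrow> u j = v j) \<Longrightarrow> krylov_state u k = krylov_state v k"
  by (induction k) auto

lemma state_eq_krylov_state:
  assumes "input u"
  shows "state (0\<^sub>v n) u k = 2 \<cdot>\<^sub>v (E *\<^sub>v (R *\<^sub>v krylov_state u k))"
proof (induction k)
  case 0
  then show ?case by (simp add: mat_vec_distribs)
next
  case (Suc k)
  show ?case
    using assms unfolding state.simps Suc next_state_def descr_state_def krylov_state.simps Ad_def
    by (simp add: mat_vec_distribs input_def)
       (auto simp: vec_eq_iff algebra_simps simp del: index_mult_mat_vec)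
qed

text \<open>\<open>M\<close> is Kalman's matrix \<open>[B, Ad B, ..., Ad^(k-1) B]\<close>, grown as
  \<open>[B, Ad M]\<close>: the block \<open>B\<close> belongs to the latest input. Only its range
  and a property of its left kernel are recorded.\<close>

lemma krylov_state_range:
  "\<exists>p M. M \<in> carrier_mat n p \<and> (\<forall>v \<in> carrier_vec p. \<exists>u. input u \<and> krylov_state u k = M *\<^sub>v v) \<and>
    (\<forall>y \<in> carrier_vec n. M\<^sup>T *\<^sub>v y = 0\<^sub>v p \<longrightarrow> (\<forall>j<k. B\<^sup>T *\<^sub>v ((\<lambda>w. Ad\<^sup>T *\<^sub>v w) ^^ j) y = 0\<^sub>v m))"
proof (induction k)
  case 0
  have "\<exists>u. input u \<and> krylov_state u 0 = 0\<^sub>m n 0 *\<^sub>v v" if "v \<in> carrier_vec 0" for v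
    using that by (intro exI[of _ "\<lambda>k. 0\<^sub>v m"]) (simp add: input_def zero_mult_mat_vec)
  then show ?case by (intro exI[of _ 0] exI[of _ "0\<^sub>m n 0"]) auto
next
  case (Suc k)
  then obtain p M where M: "M \<in> carrier_mat n p"
    and range: "\<And>v. v \<in> carrier_vec p \<Longrightarrow> \<exists>u. input u \<and> krylov_state u k = M *\<^sub>v v"
    and ker: "\<And>y j. y \<in> carrier_vec n \<Longrightarrow> M\<^sup>T *\<^sub>v y = 0\<^sub>v p \<Longrightarrow> j < k \<Longrightarrow>
      B\<^sup>T *\<^sub>v ((\<lambda>w. Ad\<^sup>T *\<^sub>v w) ^^ j) y = 0\<^sub>v m"
    by blast
  have [simp]: "dim_row M = n" "dim_col M = p" using M by auto
  have AM: "Ad * M \<in> carrier_mat n p" by (rule carrier_matI) simp_all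
  define M' where "M' = append_cols B (Ad * M)"
  have "M' \<in> carrier_mat n (m + p)" unfolding M'_def using carriers AM by simp
  moreover have "\<exists>u. input u \<and> krylov_state u (Suc k) = M' *\<^sub>v v" if v: "v \<in> carrier_vec (m + p)" for v
  proof -
    define a where "a = vec_first v m"
    define b where "b = vec_last v p"
    have a: "a \<in> carrier_vec m" and b: "b \<in> carrier_vec p" and vab: "v = a @\<^sub>v b"
      using v by (auto simp: a_def b_def)
    obtain u where u: "input u" "krylov_state u k = M *\<^sub>v b" using range[OF b] by blast
    define u' where "u' j = (if j < k then u j else a)" for j
    have "krylov_state u' k = krylov_state u k" by (rule krylov_state_cong) (simp add: u'_def)
    then have "krylov_state u' (Suc k) = Ad *\<^sub>v (M *\<^sub>v b) + B *\<^sub>v a" using u by (simp add: u'_def)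
    also have "\<dots> = M' *\<^sub>v v"
      unfolding M'_def vab append_cols_mult_vec[OF carriers(3) AM a b]
      using a b by (simp add: mat_vec_distribs) (auto simp: vec_eq_iff algebra_simps simp del: index_mult_mat_vec)
    finally show ?thesis using u(1) a by (intro exI[of _ u']) (auto simp: input_def u'_def)
  qed
  moreover have "B\<^sup>T *\<^sub>v ((\<lambda>w. Ad\<^sup>T *\<^sub>v w) ^^ j) y = 0\<^sub>v m"
    if y: "y \<in> carrier_vec n" and My: "M'\<^sup>T *\<^sub>v y = 0\<^sub>v (m + p)" and j: "j < Suc k" for y j
  proof -
    have "(B\<^sup>T *\<^sub>v y) @\<^sub>v ((Ad * M)\<^sup>T *\<^sub>v y) = 0\<^sub>v (m + p)"
      using My append_cols_transpose_mult_vec[OF carriers(3) AM y] by (simp add: M'_def)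
    moreover have "B\<^sup>T *\<^sub>v y \<in> carrier_vec m" by (rule carrier_vecI) simp
    ultimately have B0: "B\<^sup>T *\<^sub>v y = 0\<^sub>v m" and AM0: "(Ad * M)\<^sup>T *\<^sub>v y = 0\<^sub>v p"
      by (simp_all only: append_vec_eq_zero_iff)
    have "(Ad * M)\<^sup>T = M\<^sup>T * Ad\<^sup>T" by (rule transpose_mult) (use M in \<open>auto intro: carrier_matI\<close>)
    then have "M\<^sup>T *\<^sub>v (Ad\<^sup>T *\<^sub>v y) = 0\<^sub>v p" using AM0 y by (simp add: mult_mult_mat_vec)
    moreover have "Ad\<^sup>T *\<^sub>v y \<in> carrier_vec n" by (rule carrier_vecI) simp
    ultimately have "B\<^sup>T *\<^sub>v ((\<lambda>w. Ad\<^sup>T *\<^sub>v w) ^^ i) (Ad\<^sup>T *\<^sub>v y) = 0\<^sub>v m" if "i < k" for i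
      using ker that by blast
    then show ?thesis using B0 j by (cases j) (auto simp: funpow_Suc_right simp del: funpow.simps(2))
  qed
  ultimately show ?case by blast
qed

text \<open>A left kernel vector of Kalman's matrix has its Krylov vectors under
  \<open>Ad\<^sup>T\<close> annihilated by \<open>B\<^sup>T\<close>. Their span would contain an
  eigenvector that violates the Hautus test, so the matrix has a right inverse.\<close>

lemma reachable:
  assumes ctrl: "hautus_controllable n m E A B" and w: "w \<in> carrier_vec n"
  shows "\<exists>L u. input u \<and> state (0\<^sub>v n) u L = E *\<^sub>v w"
proof -
  obtain p M where M: "M \<in> carrier_mat n p"
    and range: "\<And>v. v \<in> carrier_vec p \<Longrightarrow> \<exists>u. input u \<and> krylov_state u n = M *\<^sub>v v"
    and ker: "\<And>y j. y \<in> carrier_vec n \<Longrightarrow> M\<^sup>T *\<^sub>v y = 0\<^sub>v p \<Longrightarrow> j < n \<Longrightarrow>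
      B\<^sup>T *\<^sub>v ((\<lambda>w. Ad\<^sup>T *\<^sub>v w) ^^ j) y = 0\<^sub>v m"
    using krylov_state_range[of n] by blast
  have EA: "E - A \<in> carrier_mat n n" "E + A \<in> carrier_mat n n" by (auto intro: carrier_matI)
  have AdT: "Ad\<^sup>T \<in> carrier_mat n n" by (rule carrier_matI) simp_all
  have "Ad * (E - A) = E + A"
  proof (rule mat_eq_if_mult_vec_eq[of _ n n])
    fix x :: "real vec" assume "x \<in> carrier_vec n"
    then show "(Ad * (E - A)) *\<^sub>v x = (E + A) *\<^sub>v x"
      using R_EA[of x]
      by (simp add: mult_mult_mat_vec Ad_def minus_mult_mat_vec[of "2 \<cdot>\<^sub>m (E * R)"] smult_mult_mat_vec one_mult_mat_vec')
         (simp add: mat_vec_distribs, auto simp: vec_eq_iff algebra_simps simp del: index_mult_mat_vec)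
  qed (auto intro!: carrier_matI)
  then have "(E - A)\<^sup>T * Ad\<^sup>T = (E + A)\<^sup>T"
    using transpose_mult[of Ad n n "E - A" n] EA AdT by (metis transpose_carrier_mat)
  then have "cmat ((E - A)\<^sup>T) * cmat (Ad\<^sup>T) = cmat ((E + A)\<^sup>T)"
    using of_real_hom.mat_hom_mult[of "(E - A)\<^sup>T" n n "Ad\<^sup>T" n] EA AdT
    by (metis transpose_carrier_mat)
  moreover have "cmat ((E - A)\<^sup>T) = (cmat E)\<^sup>T - (cmat A)\<^sup>T" "cmat ((E + A)\<^sup>T) = (cmat E)\<^sup>T + (cmat A)\<^sup>T"
    by (rule eq_matI; simp)+
  ultimately have key: "((cmat E)\<^sup>T - (cmat A)\<^sup>T) * cmat (Ad\<^sup>T) = (cmat E)\<^sup>T + (cmat A)\<^sup>T" by simp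
  have "y = 0\<^sub>v n" if y: "y \<in> carrier_vec n" and My: "M\<^sup>T *\<^sub>v y = 0\<^sub>v p" for y
  proof (rule ccontr)
    assume y0: "y \<noteq> 0\<^sub>v n"
    have "B\<^sup>T \<in> carrier_mat m n" using carriers by simp
    from complex_eigenvector_in_kernel[OF AdT y y0 this ker[OF y My]]
    obtain x e where x: "x \<in> carrier_vec n" "x \<noteq> 0\<^sub>v n" "cmat (Ad\<^sup>T) *\<^sub>v x = e \<cdot>\<^sub>v x" "cmat (B\<^sup>T) *\<^sub>v x = 0\<^sub>v m"
      by blast
    have "(cmat B)\<^sup>T *\<^sub>v x = 0\<^sub>v m" using x(4) by (simp add: map_mat_transpose)
    \<comment> \<open>Multiplying \<open>Ad\<^sup>T x = e x\<close> by
      \<open>(E - A)\<^sup>T\<close> gives \<open>(E + A)\<^sup>T x = e (E - A)\<^sup>T x\<close>;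
      these are the collected coefficients.\<close>
    moreover have "(pencil (1 - e) (- (1 + e)) E A)\<^sup>T *\<^sub>v x = 0\<^sub>v n"
    proof -
      have dx: "dim_vec x = n" using x by simp
      have "((cmat E)\<^sup>T + (cmat A)\<^sup>T) *\<^sub>v x = ((cmat E)\<^sup>T - (cmat A)\<^sup>T) *\<^sub>v (e \<cdot>\<^sub>v x)"
        unfolding key[symmetric] x(3)[symmetric] by (rule mult_mult_mat_vec) (use dx in auto)
      then have "(cmat E)\<^sup>T *\<^sub>v x + (cmat A)\<^sup>T *\<^sub>v x =
          e \<cdot>\<^sub>v ((cmat E)\<^sup>T *\<^sub>v x) - e \<cdot>\<^sub>v ((cmat A)\<^sup>T *\<^sub>v x)"
        using dx by (simp add: mat_vec_distribs)
          (auto simp: vec_eq_iff right_diff_distrib simp del: index_mult_mat_vec)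
      then show ?thesis using dx unfolding pencil_transpose_mult_vec[OF dx]
        by (auto simp: vec_eq_iff algebra_simps simp del: index_mult_mat_vec)
    qed
    moreover have "(1 - e, - (1 + e)) \<noteq> (0, 0)" by (auto simp: complex_eq_iff)
    ultimately show False using ctrl x(1,2) unfolding hautus_controllable_def by blast
  qed
  then obtain G where G: "G \<in> carrier_mat p n" "M * G = 1\<^sub>m n"
    using right_inverse_if_left_kernel_trivial[OF M] by blast
  \<comment> \<open>Chosen to undo the factor that was pulled out:
    \<open>2 E R z = E w\<close>.\<close>
  define z where "z = (1/2) \<cdot>\<^sub>v ((E - A) *\<^sub>v w)"
  have dz: "dim_vec z = n" by (simp add: z_def)
  have "M *\<^sub>v (G *\<^sub>v z) = z"
    using M G dz by (simp add: mult_mult_mat_vec[symmetric] one_mult_mat_vec')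
  moreover have "G *\<^sub>v z \<in> carrier_vec p" using G by (auto intro: carrier_vecI)
  ultimately obtain u where u: "input u" "krylov_state u n = z" using range by metis
  have "state (0\<^sub>v n) u n = 2 \<cdot>\<^sub>v (E *\<^sub>v (R *\<^sub>v z))"
    using state_eq_krylov_state[OF u(1)] u(2) by simp
  also have "\<dots> = E *\<^sub>v w"
    unfolding z_def using w R_EA[of w] by (simp add: mult_mat_vec_smult smult_smult_assoc)
  finally show ?thesis using u(1) by blast
qed

end

section \<open>Passivity of the Cayley transform\<close>

text \<open>Cramer's rule over the polynomial ring, followed by evaluation. Inverses of pencils
  thereby become polynomial matrices over one scalar polynomial, from which holomorphy and
  finiteness of the spectrum can be read off.\<close>

lemma linear_matrix_polynomial_adjugate:
  fixes M0 M1 :: "complex mat"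
  assumes M0: "M0 \<in> carrier_mat n n" and M1: "M1 \<in> carrier_mat n n"
  obtains Adj d where "Adj \<in> carrier_mat n n"
    "\<And>z. (M0 + z \<cdot>\<^sub>m M1) * map_mat (\<lambda>p. poly p z) Adj = poly d z \<cdot>\<^sub>m 1\<^sub>m n"
    "\<And>z. map_mat (\<lambda>p. poly p z) Adj * (M0 + z \<cdot>\<^sub>m M1) = poly d z \<cdot>\<^sub>m 1\<^sub>m n"
    "\<And>z. det (M0 + z \<cdot>\<^sub>m M1) = poly d z"
proof -
  define Mp where "Mp = mat n n (\<lambda>(i, j). [:M0 $$ (i, j), M1 $$ (i, j):])"
  have Mp: "Mp \<in> carrier_mat n n" by (simp add: Mp_def)
  have ev: "map_mat (\<lambda>p. poly p z) Mp = M0 + z \<cdot>\<^sub>m M1" for z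
    using M0 M1 by (intro eq_matI) (auto simp: Mp_def)
  note adj = adj_mat[OF Mp]
  show thesis
  proof (rule that[of "adj_mat Mp" "det Mp"])
    fix z :: complex
    have sh: "semiring_hom (\<lambda>p. poly p z)" and ch: "comm_ring_hom (\<lambda>p. poly p z)"
      by (unfold_locales; simp)+
    have sm: "map_mat (\<lambda>p. poly p z) (det Mp \<cdot>\<^sub>m 1\<^sub>m n) = poly (det Mp) z \<cdot>\<^sub>m 1\<^sub>m n"
      by (rule eq_matI) auto
    show "(M0 + z \<cdot>\<^sub>m M1) * map_mat (\<lambda>p. poly p z) (adj_mat Mp) = poly (det Mp) z \<cdot>\<^sub>m 1\<^sub>m n"
      using semiring_hom.mat_hom_mult[OF sh Mp adj(1)] unfolding ev adj(2) sm by simp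
    show "map_mat (\<lambda>p. poly p z) (adj_mat Mp) * (M0 + z \<cdot>\<^sub>m M1) = poly (det Mp) z \<cdot>\<^sub>m 1\<^sub>m n"
      using semiring_hom.mat_hom_mult[OF sh adj(1) Mp] unfolding ev adj(3) sm by simp
    show "det (M0 + z \<cdot>\<^sub>m M1) = poly (det Mp) z"
      unfolding ev[symmetric] by (rule comm_ring_hom.hom_det[OF ch])
  qed (rule adj(1))
qed

section \<open>Means over circles and Taylor coefficients\<close>

text \<open>The path is parametrized by \<open>{0..1}\<close>, so the integral is already
  normalized. As a relation it includes integrability. For holomorphic \<open>h\<close>, the mean of
  \<open>inverse z ^ k * h z\<close> is the \<open>k\<close>-th Taylor coefficient of
  \<open>h\<close> at 0.\<close>

definition circle_mean :: "real \<Rightarrow> (complex \<Rightarrow> complex) \<Rightarrow> complex \<Rightarrow> bool" where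
  "circle_mean r g c \<longleftrightarrow> ((\<lambda>t. g (circlepath 0 r t)) has_integral c) {0..1}"

lemma circlepath_norm: "0 < r \<Longrightarrow> norm (circlepath 0 r t) = r"
  by (simp add: circlepath norm_mult)

lemma circle_mean_cong:
  "0 < r \<Longrightarrow> (\<And>z. norm z = r \<Longrightarrow> f z = g z) \<Longrightarrow> circle_mean r f c \<longleftrightarrow> circle_mean r g c"
  unfolding circle_mean_def by (intro has_integral_cong) (simp add: circlepath_norm)

lemma circle_mean_unique: "circle_mean r f c \<Longrightarrow> circle_mean r f d \<Longrightarrow> c = d"
  unfolding circle_mean_def by (rule has_integral_unique)

lemma circle_mean_add:
  "circle_mean r f c \<Longrightarrow> circle_mean r g d \<Longrightarrow> circle_mean r (\<lambda>z. f z + g z) (c + d)"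
  unfolding circle_mean_def by (rule has_integral_add)

lemma circle_mean_mult: "circle_mean r f c \<Longrightarrow> circle_mean r (\<lambda>z. a * f z) (a * c)"
  unfolding circle_mean_def by (rule has_integral_mult_right)

lemma circle_mean_sum:
  "finite I \<Longrightarrow> (\<And>i. i \<in> I \<Longrightarrow> circle_mean r (f i) (c i)) \<Longrightarrow>
   circle_mean r (\<lambda>z. \<Sum>i\<in>I. f i z) (\<Sum>i\<in>I. c i)"
  unfolding circle_mean_def by (rule has_integral_sum)

lemma circle_mean_const: "circle_mean r (\<lambda>z. c) c"
  unfolding circle_mean_def using has_integral_const_real[of c 0 1] by simp

lemma circle_mean_cnj: "circle_mean r f c \<Longrightarrow> circle_mean r (\<lambda>z. cnj (f z)) (cnj c)"
  unfolding circle_mean_def using has_integral_cnj[of "\<lambda>t. f (circlepath 0 r t)"] by (simp add: o_def)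

lemma circle_mean_Re_nonneg:
  assumes "circle_mean r f c" "0 < r" "\<And>z. norm z = r \<Longrightarrow> Re (f z) \<ge> 0"
  shows "Re c \<ge> 0"
proof -
  have "((Re \<circ> (\<lambda>t. f (circlepath 0 r t))) has_integral Re c) {0..1}"
    using assms(1) unfolding circle_mean_def by (rule has_integral_linear[OF _ bounded_linear_Re])
  then show ?thesis
    by (rule has_integral_nonneg) (use assms in \<open>simp add: circlepath_norm\<close>)
qed

text \<open>The derivative of the path is \<open>2 pi i\<close> times the point itself, so this is
  Cauchy's theorem for \<open>h\<close>.\<close>

lemma circle_mean_holomorphic_mult:
  assumes h: "h holomorphic_on ball 0 1" and r: "0 < r" "r < 1"
  shows "circle_mean r (\<lambda>z. z * h z) 0"
proof -
  have "(h has_contour_integral 0) (circlepath 0 r)"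
    by (rule Cauchy_theorem_disc_simple[OF h]) (use r in \<open>auto simp: path_image_circlepath_nonneg\<close>)
  then have "((\<lambda>t. (2 * of_real pi * \<i>) * (circlepath 0 r t * h (circlepath 0 r t))) has_integral 0) {0..1}"
    unfolding has_contour_integral
    by (rule has_integral_eq[rotated])
       (simp add: vector_derivative_circlepath, simp add: circlepath algebra_simps)
  then show ?thesis unfolding circle_mean_def by (subst (asm) has_integral_mult_right_iff) auto
qed

text \<open>Continuity on the circle gives the Taylor coefficient as a number \<open>c\<close>; its
  value will be identified through a recursion.\<close>

lemma circle_mean_holomorphic:
  assumes h: "h holomorphic_on ball 0 1" and r: "0 < r" "r < 1"
  obtains c where "circle_mean r (\<lambda>z. inverse z ^ k * h z) c"
proof -
  have "continuous_on {0..1} (\<lambda>t. inverse (circlepath 0 r t) ^ k * h (circlepath 0 r t))"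
  proof (intro continuous_intros)
    show cp: "continuous_on {0..1} (circlepath 0 r)"
      unfolding circlepath by (intro continuous_intros)
    show "continuous_on {0..1} (\<lambda>t. h (circlepath 0 r t))"
      by (rule continuous_on_compose2[OF holomorphic_on_imp_continuous_on[OF h] cp])
         (use r in \<open>auto simp: circlepath_norm\<close>)
    show "\<forall>t\<in>{0..1}. circlepath 0 r t \<noteq> 0" using r by (simp add: circlepath)
  qed
  then have "(\<lambda>t. inverse (circlepath 0 r t) ^ k * h (circlepath 0 r t)) integrable_on {0..1}"
    by (rule integrable_continuous_interval)
  then show thesis using that unfolding circle_mean_def integrable_on_def by blast
qed

text \<open>Orthogonality of monomials. For \<open>l < k\<close> the function is a negative power,
  and on the circle \<open>inverse z\<close> is \<open>cnj z / r^2\<close>, so the case reduces to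
  the conjugate of a positive power.\<close>

lemma circle_mean_monomial:
  assumes r: "0 < r" "r < 1"
  shows "circle_mean r (\<lambda>z. inverse z ^ k * z ^ l) (if k = l then 1 else 0)"
proof -
  have pos: "circle_mean r (\<lambda>z. z ^ Suc p) 0" for p
    using circle_mean_holomorphic_mult[of "\<lambda>z. z ^ p" r] r by (simp add: holomorphic_intros)
  consider "k = l" | "k < l" | "l < k" by linarith
  then show ?thesis
  proof cases
    case 1
    have "circle_mean r (\<lambda>z. 1) 1" by (rule circle_mean_const)
    then show ?thesis
      by (subst circle_mean_cong[OF r(1), of _ "\<lambda>z. 1"]) (use r 1 in \<open>auto simp flip: power_mult_distrib\<close>)
  next
    case 2
    then obtain p where p: "l = k + Suc p" using less_iff_Suc_add by auto
    have "inverse z ^ k * z ^ l = z ^ Suc p" if "norm z = r" for z :: complex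
      using that r by (auto simp: p power_add field_simps)
    then show ?thesis using pos[of p] 2 by (subst circle_mean_cong[OF r(1), of _ "\<lambda>z. z ^ Suc p"]) auto
  next
    case 3
    then obtain p where p: "k = l + Suc p" using less_iff_Suc_add by auto
    have "inverse z ^ k * z ^ l = of_real (1 / r\<^sup>2) ^ Suc p * cnj (z ^ Suc p)" if z: "norm z = r" for z :: complex
    proof -
      have z0: "z \<noteq> 0" using z r by auto
      have "z * cnj z = of_real (r\<^sup>2)" using z by (metis complex_norm_square)
      then have "inverse z = of_real (1 / r\<^sup>2) * cnj z" using z0 r by (simp add: field_simps)
      moreover have "inverse z ^ k * z ^ l = inverse z ^ Suc p"
        using z0 by (simp add: p power_add field_simps)
      ultimately show ?thesis by (simp only: power_mult_distrib complex_cnj_power)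
    qed
    moreover have "circle_mean r (\<lambda>z. of_real (1 / r\<^sup>2) ^ Suc p * cnj (z ^ Suc p)) 0"
      using circle_mean_mult[OF circle_mean_cnj[OF pos[of p]], of "of_real (1 / r\<^sup>2) ^ Suc p"]
      by (simp only: complex_cnj_zero mult_zero_right)
    ultimately show ?thesis
      using 3 by (subst circle_mean_cong[OF r(1), of _ "\<lambda>z. of_real (1 / r\<^sup>2) ^ Suc p * cnj (z ^ Suc p)"]) auto
  qed
qed

section \<open>Parseval's identity along a trajectory\<close>

context cayley_descriptor
begin

text \<open>Parseval's identity turns the positive realness of the transfer function on the circle
  \<open>\<bar>z\<bar> = r\<close> into passivity of the discrete system with weights \<open>r\<^sup>2\<^sup>k\<close>; then \<open>r\<close> tends to 1.\<close>

lemma passivity_weighted: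
  assumes nosing: "\<And>s. Re s > 0 \<Longrightarrow> det (pencil s 1 E A) \<noteq> 0"
    and freq: "\<And>s x u. Re s > 0 \<Longrightarrow> x \<in> carrier_vec n \<Longrightarrow> u \<in> carrier_vec m \<Longrightarrow>
      pencil s 1 E A *\<^sub>v x = cmat B *\<^sub>v u \<Longrightarrow>
      Re (conjugate u \<bullet> (cmat C *\<^sub>v x + cmat D *\<^sub>v u)) \<ge> 0"
    and u: "input u" and r: "0 < r" "r < 1"
  shows "(\<Sum>k<N. r ^ (2 * k) * (u k \<bullet> out (state (0\<^sub>v n) u k) (u k))) \<ge> 0"
proof -
  \<comment> \<open>\<open>M0 + z M1\<close> is \<open>1 + z\<close> times the pencil at
    \<open>s = (1 - z) / (1 + z)\<close>: clearing the denominator makes it linear in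
    \<open>z\<close>.\<close>
  define M0 where "M0 = cmat E - cmat A"
  define M1 where "M1 = - (cmat E + cmat A)"
  have M: "M0 \<in> carrier_mat n n" "M1 \<in> carrier_mat n n"
    unfolding M0_def M1_def by (rule carrier_matI; simp)+
  have Md [simp]: "dim_row M0 = n" "dim_col M0 = n" "dim_row M1 = n" "dim_col M1 = n" using M by auto
  obtain Adj d where Adj: "Adj \<in> carrier_mat n n"
    and MAdj: "\<And>z. (M0 + z \<cdot>\<^sub>m M1) * map_mat (\<lambda>p. poly p z) Adj = poly d z \<cdot>\<^sub>m 1\<^sub>m n"
    and dd: "\<And>z. det (M0 + z \<cdot>\<^sub>m M1) = poly d z"
    using linear_matrix_polynomial_adjugate[OF M] by metis
  have [simp]: "dim_row Adj = n" "dim_col Adj = n" using Adj by auto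
  have s_half_plane: "Re ((1 - z) / (1 + z)) > 0" "1 + z \<noteq> 0" if z: "norm z < 1" for z :: complex
  proof -
    show z1: "1 + z \<noteq> 0"
    proof
      assume "1 + z = 0"
      then have "z = -1" by (simp add: add_eq_0_iff)
      then show False using z by simp
    qed
    have "(1 - z) / (1 + z) = (1 - z) * cnj (1 + z) / of_real ((norm (1 + z))\<^sup>2)"
      by (rule complex_div_cnj)
    also have "Re \<dots> = (1 - (norm z)\<^sup>2) / (norm (1 + z))\<^sup>2"
      unfolding Re_divide_of_real using cmod_power2[of z] by (simp add: algebra_simps power2_eq_square)
    also have "\<dots> > 0" using z z1 by (simp add: abs_square_less_1 divide_pos_pos)
    finally show "Re ((1 - z) / (1 + z)) > 0" .
  qed
  have pencil_z: "M0 + z \<cdot>\<^sub>m M1 = (1 + z) \<cdot>\<^sub>m pencil ((1 - z) / (1 + z)) 1 E A" if "norm z < 1" for z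
    using s_half_plane(2)[OF that]
    by (intro eq_matI) (auto simp: M0_def M1_def pencil_def field_simps)
  have d0: "poly d z \<noteq> 0" if z: "norm z < 1" for z
    using nosing[OF s_half_plane(1)[OF z]] s_half_plane(2)[OF z]
    unfolding dd[symmetric] pencil_z[OF z] by simp
  \<comment> \<open>The generating function of the input cut off after \<open>N\<close> terms, hence
    a polynomial.\<close>
  define uh where "uh z = vec m (\<lambda>l. \<Sum>k<N. complex_of_real (u k $ l) * z ^ k)" for z
  have duh [simp]: "dim_vec (uh z) = m" for z by (simp add: uh_def)
  \<comment> \<open>The frequency response to \<open>uh\<close>, written with the adjugate so that
    it is visibly holomorphic. It will turn out to generate the descriptor states.\<close>
  define xh where "xh z = (1 / poly d z) \<cdot>\<^sub>v (map_mat (\<lambda>p. poly p z) Adj *\<^sub>v ((1 + z) \<cdot>\<^sub>v (cmat B *\<^sub>v uh z)))" for z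
  have dxh [simp]: "dim_vec (xh z) = n" for z by (simp add: xh_def)
  have xh_eq: "M0 *\<^sub>v xh z + z \<cdot>\<^sub>v (M1 *\<^sub>v xh z) = (1 + z) \<cdot>\<^sub>v (cmat B *\<^sub>v uh z)" if z: "norm z < 1" for z
  proof -
    define b where "b = (1 + z) \<cdot>\<^sub>v (cmat B *\<^sub>v uh z)"
    have db: "dim_vec b = n" by (simp add: b_def)
    have "M0 *\<^sub>v xh z + z \<cdot>\<^sub>v (M1 *\<^sub>v xh z) = (M0 + z \<cdot>\<^sub>m M1) *\<^sub>v xh z"
      by (simp add: add_mult_mat_vec smult_mult_mat_vec)
    also have "\<dots> = (1 / poly d z) \<cdot>\<^sub>v (((M0 + z \<cdot>\<^sub>m M1) * map_mat (\<lambda>p. poly p z) Adj) *\<^sub>v b)"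
      unfolding xh_def b_def[symmetric] using db by (simp add: mult_mat_vec_smult mult_mult_mat_vec)
    also have "\<dots> = b" unfolding MAdj using db d0[OF z]
      by (simp add: smult_mult_mat_vec one_mult_mat_vec' smult_smult_assoc)
    finally show ?thesis unfolding b_def .
  qed
  have freq_z: "Re (conjugate (uh z) \<bullet> (cmat C *\<^sub>v xh z + cmat D *\<^sub>v uh z)) \<ge> 0" if z: "norm z < 1" for z
  proof (rule freq[OF s_half_plane(1)[OF z]])
    show "xh z \<in> carrier_vec n" "uh z \<in> carrier_vec m" by (rule carrier_vecI; simp)+
    have "(1 + z) \<cdot>\<^sub>v (pencil ((1 - z) / (1 + z)) 1 E A *\<^sub>v xh z) = (1 + z) \<cdot>\<^sub>v (cmat B *\<^sub>v uh z)"
      using xh_eq[OF z] pencil_z[OF z] by (metis Md add_mult_mat_vec smult_mult_mat_vec dxh pencil_dims index_smult_mat(2,3))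
    then have "(1 + z) * (pencil ((1 - z) / (1 + z)) 1 E A *\<^sub>v xh z) $ i = (1 + z) * (cmat B *\<^sub>v uh z) $ i" if "i < n" for i
      using that by (metis (no_types, lifting) dim_mult_mat_vec index_smult_vec(1) pencil_dims(1) index_map_mat(2) dims(5))
    then show "pencil ((1 - z) / (1 + z)) 1 E A *\<^sub>v xh z = cmat B *\<^sub>v uh z"
      using s_half_plane(2)[OF z] by (intro eq_vecI) (auto simp del: index_mult_mat_vec)
  qed
  have xh_hol: "(\<lambda>z. xh z $ j) holomorphic_on ball 0 1" if j: "j < n" for j
  proof -
    have "xh z $ j = 1 / poly d z * (\<Sum>i<n. poly (Adj $$ (j, i)) z *
        ((1 + z) * (\<Sum>l<m. complex_of_real (B $$ (i, l)) * (\<Sum>k<N. complex_of_real (u k $ l) * z ^ k))))" for z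
      using j by (simp add: xh_def index_mult_mat_vec_sum uh_def del: index_mult_mat_vec)
    then show ?thesis using d0 by (auto intro!: holomorphic_intros)
  qed
  \<comment> \<open>The Taylor coefficients of \<open>xh\<close>, chosen as means.\<close>
  define c where "c k j = (SOME c. circle_mean r (\<lambda>z. inverse z ^ k * xh z $ j) c)" for k j
  have c: "circle_mean r (\<lambda>z. inverse z ^ k * xh z $ j) (c k j)" if "j < n" for k j
    unfolding c_def using circle_mean_holomorphic[OF xh_hol[OF that] r, of k] by (metis someI)
  have mean_uh: "circle_mean r (\<lambda>z. inverse z ^ k * uh z $ l) (if k < N then complex_of_real (u k $ l) else 0)"
    if l: "l < m" for k l
  proof -
    have "circle_mean r (\<lambda>z. \<Sum>i<N. complex_of_real (u i $ l) * (inverse z ^ k * z ^ i))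
        (\<Sum>i<N. complex_of_real (u i $ l) * (if k = i then 1 else 0))"
      by (intro circle_mean_sum circle_mean_mult circle_mean_monomial r) simp
    also have "(\<Sum>i<N. complex_of_real (u i $ l) * (if k = i then 1 else 0)) =
        (if k < N then complex_of_real (u k $ l) else 0)"
      by (simp add: if_distrib sum.delta cong: if_cong)
    finally show ?thesis using l
      by (simp add: uh_def sum_distrib_left mult.left_commute)
  qed
  have mean_zx: "circle_mean r (\<lambda>z. inverse z ^ k * (z * xh z $ j)) (case k of 0 \<Rightarrow> 0 | Suc k' \<Rightarrow> c k' j)"
    if j: "j < n" for k j
  proof (cases k)
    case 0
    then show ?thesis using circle_mean_holomorphic_mult[OF xh_hol[OF j] r] by simp
  next
    case (Suc k')
    have "inverse z ^ k * (z * xh z $ j) = inverse z ^ k' * xh z $ j" if "norm z = r" for z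
      using that r unfolding Suc by (auto simp: field_simps)
    then show ?thesis using c[OF j, of k'] Suc
      by (subst circle_mean_cong[OF r(1), of _ "\<lambda>z. inverse z ^ k' * xh z $ j"]) auto
  qed
  have mean_zu: "circle_mean r (\<lambda>z. inverse z ^ k * (z * uh z $ l))
      (case k of 0 \<Rightarrow> 0 | Suc k' \<Rightarrow> if k' < N then complex_of_real (u k' $ l) else 0)"
    if l: "l < m" for k l
  proof (cases k)
    case 0
    have "(\<lambda>z. uh z $ l) holomorphic_on ball 0 1" using l by (simp add: uh_def holomorphic_intros)
    then show ?thesis using circle_mean_holomorphic_mult[OF _ r] 0 by simp
  next
    case (Suc k')
    have "inverse z ^ k * (z * uh z $ l) = inverse z ^ k' * uh z $ l" if "norm z = r" for z
      using that r unfolding Suc by (auto simp: field_simps)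
    then show ?thesis using mean_uh[OF l, of k'] Suc
      by (subst circle_mean_cong[OF r(1), of _ "\<lambda>z. inverse z ^ k' * uh z $ l"]) auto
  qed
  \<comment> \<open>The \<open>k\<close>-th coefficient of \<open>xh_eq\<close>. Multiplication by
    \<open>z\<close> is a delay by one step, and the value before time 0 is 0, hence the
    \<open>case\<close>.\<close>
  have recursion: "(\<Sum>j<n. M0 $$ (i, j) * c k j) + (\<Sum>j<n. M1 $$ (i, j) * (case k of 0 \<Rightarrow> 0 | Suc k' \<Rightarrow> c k' j)) =
      (\<Sum>l<m. complex_of_real (B $$ (i, l)) * complex_of_real (u k $ l)) +
      (\<Sum>l<m. complex_of_real (B $$ (i, l)) * (case k of 0 \<Rightarrow> 0 | Suc k' \<Rightarrow> complex_of_real (u k' $ l)))"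
    if i: "i < n" and k: "k < N" for i k
  proof (rule circle_mean_unique)
    let ?f = "\<lambda>z. (\<Sum>j<n. M0 $$ (i, j) * (inverse z ^ k * xh z $ j)) + (\<Sum>j<n. M1 $$ (i, j) * (inverse z ^ k * (z * xh z $ j)))"
    let ?g = "\<lambda>z. (\<Sum>l<m. complex_of_real (B $$ (i, l)) * (inverse z ^ k * uh z $ l)) +
      (\<Sum>l<m. complex_of_real (B $$ (i, l)) * (inverse z ^ k * (z * uh z $ l)))"
    show "circle_mean r ?f ((\<Sum>j<n. M0 $$ (i, j) * c k j) + (\<Sum>j<n. M1 $$ (i, j) * (case k of 0 \<Rightarrow> 0 | Suc k' \<Rightarrow> c k' j)))"
      by (intro circle_mean_add circle_mean_sum circle_mean_mult c mean_zx) auto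
    have g: "circle_mean r ?g ((\<Sum>l<m. complex_of_real (B $$ (i, l)) * (if k < N then complex_of_real (u k $ l) else 0)) +
      (\<Sum>l<m. complex_of_real (B $$ (i, l)) * (case k of 0 \<Rightarrow> 0 | Suc k' \<Rightarrow> if k' < N then complex_of_real (u k' $ l) else 0)))"
      by (intro circle_mean_add circle_mean_sum circle_mean_mult mean_uh mean_zu) auto
    have fg: "?f z = ?g z" if z: "norm z = r" for z
    proof -
      have "(M0 *\<^sub>v xh z) $ i + z * (M1 *\<^sub>v xh z) $ i = (1 + z) * (cmat B *\<^sub>v uh z) $ i"
        using arg_cong[OF xh_eq, of z "\<lambda>v. v $ i"] z r i by (simp del: index_mult_mat_vec)
      then have "(\<Sum>j<n. M0 $$ (i, j) * xh z $ j) + z * (\<Sum>j<n. M1 $$ (i, j) * xh z $ j) =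
          (1 + z) * (\<Sum>l<m. complex_of_real (B $$ (i, l)) * uh z $ l)"
        using i by (simp add: index_mult_mat_vec_sum del: index_mult_mat_vec)
      then have "inverse z ^ k * ((\<Sum>j<n. M0 $$ (i, j) * xh z $ j) + z * (\<Sum>j<n. M1 $$ (i, j) * xh z $ j)) =
          inverse z ^ k * ((1 + z) * (\<Sum>l<m. complex_of_real (B $$ (i, l)) * uh z $ l))" by simp
      then show ?thesis
        by (simp add: sum_distrib_left distrib_left distrib_right mult.assoc mult.left_commute)
    qed
    have "circle_mean r ?g ((\<Sum>l<m. complex_of_real (B $$ (i, l)) * complex_of_real (u k $ l)) +
      (\<Sum>l<m. complex_of_real (B $$ (i, l)) * (case k of 0 \<Rightarrow> 0 | Suc k' \<Rightarrow> complex_of_real (u k' $ l))))"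
      using g k by (cases k) auto
    then show "circle_mean r ?f ((\<Sum>l<m. complex_of_real (B $$ (i, l)) * complex_of_real (u k $ l)) +
      (\<Sum>l<m. complex_of_real (B $$ (i, l)) * (case k of 0 \<Rightarrow> 0 | Suc k' \<Rightarrow> complex_of_real (u k' $ l))))"
      using circle_mean_cong[of r ?f ?g, OF r(1) fg] by simp
  qed
  define x where "x k = descr_state (state (0\<^sub>v n) u k) (u k)" for k
  have dx [simp]: "dim_vec (x k) = n" for k by (simp add: x_def)
  have du [simp]: "dim_vec (u k) = m" for k using u by (simp add: input_def)
  have EAx: "(E - A) *\<^sub>v x k = state (0\<^sub>v n) u k + B *\<^sub>v u k" for k
    unfolding x_def descr_state_def by (rule EA_R) simp
  have x_rec: "(E - A) *\<^sub>v x (Suc k) = (E + A) *\<^sub>v x k + B *\<^sub>v u k + B *\<^sub>v u (Suc k)" for k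
  proof -
    have "(E - A) *\<^sub>v x (Suc k) = 2 \<cdot>\<^sub>v (E *\<^sub>v x k) - state (0\<^sub>v n) u k + B *\<^sub>v u (Suc k)"
      unfolding EAx by (simp add: next_state_def x_def)
    moreover have "state (0\<^sub>v n) u k = (E - A) *\<^sub>v x k - B *\<^sub>v u k"
      unfolding EAx by (auto simp: vec_eq_iff simp del: index_mult_mat_vec)
    ultimately show ?thesis
      by (simp add: mat_vec_distribs) (auto simp: vec_eq_iff simp del: index_mult_mat_vec)
  qed
  \<comment> \<open>\<open>M0\<close> is the pencil at \<open>z = 0\<close>, that is at
    \<open>s = 1\<close>, so it is nonsingular and the recursion determines each
    coefficient.\<close>
  have solve: "c k j = complex_of_real (x k $ j)"
    if eq: "\<And>i. i < n \<Longrightarrow> (\<Sum>j<n. M0 $$ (i, j) * c k j) = complex_of_real (((E - A) *\<^sub>v x k) $ i)" and j: "j < n" for k j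
  proof -
    define dl where "dl = vec n (\<lambda>j. c k j - complex_of_real (x k $ j))"
    have dl: "dl \<in> carrier_vec n" by (simp add: dl_def)
    have "M0 *\<^sub>v dl = 0\<^sub>v n"
    proof (rule eq_vecI)
      fix i assume "i < dim_vec (0\<^sub>v n :: complex vec)"
      then have i: "i < n" by simp
      have "(\<Sum>j<n. M0 $$ (i, j) * complex_of_real (x k $ j)) = complex_of_real (((E - A) *\<^sub>v x k) $ i)"
        using i by (simp add: index_mult_mat_vec_sum M0_def del: index_mult_mat_vec)
      then show "(M0 *\<^sub>v dl) $ i = 0\<^sub>v n $ i"
        using i eq[OF i] by (simp add: index_mult_mat_vec_sum dl_def right_diff_distrib sum_subtractf
            del: index_mult_mat_vec)
    qed simp
    moreover have "det M0 \<noteq> 0"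
    proof -
      have "M0 + 0 \<cdot>\<^sub>m M1 = M0" by (rule eq_matI) auto
      then show ?thesis using dd[of 0] d0[of 0] by simp
    qed
    ultimately have "dl = 0\<^sub>v n" using det_0_iff_vec_prod_zero_field[OF M(1)] dl by blast
    then have "dl $ j = 0" using j by simp
    then show ?thesis using j by (simp add: dl_def)
  qed
  \<comment> \<open>The coefficients obey the same recursion as the trajectory,
    \<open>x_rec\<close>, as long as \<open>k < N\<close>, where the cut-off input agrees with
    \<open>u\<close>.\<close>
  have cx: "c k j = complex_of_real (x k $ j)" if "k < N" "j < n" for k j
    using that
  proof (induction k arbitrary: j)
    case 0
    have "(\<Sum>j<n. M0 $$ (i, j) * c 0 j) = complex_of_real (((E - A) *\<^sub>v x 0) $ i)" if i: "i < n" for i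
      using recursion[OF i 0(1)] i unfolding EAx
      by (simp add: index_mult_mat_vec_sum del: index_mult_mat_vec)
    from solve[OF this 0(2)] show ?case .
  next
    case (Suc k)
    have "(\<Sum>j<n. M0 $$ (i, j) * c (Suc k) j) = complex_of_real (((E - A) *\<^sub>v x (Suc k)) $ i)" if i: "i < n" for i
    proof -
      have "(\<Sum>j<n. M1 $$ (i, j) * c k j) = - complex_of_real (((E + A) *\<^sub>v x k) $ i)"
        using i Suc by (simp add: index_mult_mat_vec_sum M1_def del: index_mult_mat_vec)
            (simp add: algebra_simps sum.distrib sum_subtractf sum_negf)
      then show ?thesis using recursion[OF i Suc.prems(1)] i unfolding x_rec
        by (simp add: index_mult_mat_vec_sum[of _ B] algebra_simps del: index_mult_mat_vec)
    qed
    from solve[OF this Suc.prems(2)] show ?case .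
  qed
  have mean_y: "circle_mean r (\<lambda>z. inverse z ^ k * (cmat C *\<^sub>v xh z + cmat D *\<^sub>v uh z) $ l)
      (complex_of_real (out (state (0\<^sub>v n) u k) (u k) $ l))" if k: "k < N" and l: "l < m" for k l
  proof -
    have "circle_mean r (\<lambda>z. (\<Sum>j<n. complex_of_real (C $$ (l, j)) * (inverse z ^ k * xh z $ j)) +
        (\<Sum>j<m. complex_of_real (D $$ (l, j)) * (inverse z ^ k * uh z $ j)))
      ((\<Sum>j<n. complex_of_real (C $$ (l, j)) * c k j) +
       (\<Sum>j<m. complex_of_real (D $$ (l, j)) * (if k < N then complex_of_real (u k $ j) else 0)))"
      by (intro circle_mean_add circle_mean_sum circle_mean_mult c mean_uh) auto
    moreover have "(\<Sum>j<n. complex_of_real (C $$ (l, j)) * c k j) +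
       (\<Sum>j<m. complex_of_real (D $$ (l, j)) * (if k < N then complex_of_real (u k $ j) else 0)) =
       complex_of_real (out (state (0\<^sub>v n) u k) (u k) $ l)"
      using k l cx by (simp add: out_def x_def[symmetric] index_mult_mat_vec_sum del: index_mult_mat_vec)
    moreover have "(\<lambda>z. (\<Sum>j<n. complex_of_real (C $$ (l, j)) * (inverse z ^ k * xh z $ j)) +
        (\<Sum>j<m. complex_of_real (D $$ (l, j)) * (inverse z ^ k * uh z $ j))) =
        (\<lambda>z. inverse z ^ k * (cmat C *\<^sub>v xh z + cmat D *\<^sub>v uh z) $ l)"
      using l by (simp add: index_mult_mat_vec_sum sum_distrib_left distrib_left mult.left_commute
          del: index_mult_mat_vec)
    ultimately show ?thesis by simp
  qed
  have "circle_mean r (\<lambda>z. \<Sum>l<m. \<Sum>k<N. complex_of_real (u k $ l * r ^ (2 * k)) *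
        (inverse z ^ k * (cmat C *\<^sub>v xh z + cmat D *\<^sub>v uh z) $ l))
      (\<Sum>l<m. \<Sum>k<N. complex_of_real (u k $ l * r ^ (2 * k)) * complex_of_real (out (state (0\<^sub>v n) u k) (u k) $ l))"
    (is "circle_mean r ?F ?S")
    by (intro circle_mean_sum circle_mean_mult mean_y) auto
  moreover have "Re (?F z) \<ge> 0" if z: "norm z = r" for z
  proof -
    \<comment> \<open>On the circle \<open>cnj z = r^2 / z\<close>. This is the origin of the
      weights, and it turns the conjugated input into negative powers whose means pick out the
      coefficients of the output.\<close>
    have cz: "cnj z ^ k = complex_of_real (r ^ (2 * k)) * inverse z ^ k" for k
    proof -
      have "z \<noteq> 0" using z r by auto
      moreover have "z * cnj z = of_real (r\<^sup>2)" using z by (metis complex_norm_square)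
      ultimately have "cnj z = of_real (r\<^sup>2) * inverse z" by (simp add: field_simps)
      then show ?thesis by (simp add: power_mult_distrib power_mult)
    qed
    have "?F z = conjugate (uh z) \<bullet> (cmat C *\<^sub>v xh z + cmat D *\<^sub>v uh z)"
      by (simp add: scalar_prod_def uh_def atLeast0LessThan cz sum_distrib_right mult.assoc
          conjugate_complex_def del: index_mult_mat_vec)
    then show ?thesis using freq_z[of z] z r by simp
  qed
  ultimately have "Re ?S \<ge> 0" using circle_mean_Re_nonneg[OF _ r(1)] by blast
  also have "Re ?S = (\<Sum>k<N. r ^ (2 * k) * (u k \<bullet> out (state (0\<^sub>v n) u k) (u k)))"
    by (subst sum.swap) (simp add: scalar_prod_def atLeast0LessThan sum_distrib_left algebra_simps)
  finally show ?thesis .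
qed

end

context descriptor
begin

text \<open>The frequency condition is stated through solutions of the pencil equation, which keeps
  transfer matrices out of the argument. The point \<open>s = 1\<close> of the half plane provides
  the inverse of \<open>E - A\<close> for the Cayley transform.\<close>

theorem port_Hamiltonian_if_half_plane_passive:
  assumes nosing: "\<And>s. Re s > 0 \<Longrightarrow> det (pencil s 1 E A) \<noteq> 0"
    and freq: "\<And>s x u. Re s > 0 \<Longrightarrow> x \<in> carrier_vec n \<Longrightarrow> u \<in> carrier_vec m \<Longrightarrow>
      pencil s 1 E A *\<^sub>v x = cmat B *\<^sub>v u \<Longrightarrow>
      Re (conjugate u \<bullet> (cmat C *\<^sub>v x + cmat D *\<^sub>v u)) \<ge> 0"
    and ctrl: "hautus_controllable n m E A B" and obs: "hautus_observable n m E A C"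
    and D: "\<And>u. u \<in> carrier_vec m \<Longrightarrow> u \<bullet> (D *\<^sub>v u) \<ge> 0"
  shows "port_Hamiltonian n m E A B C D"
proof -
  have EA: "E - A \<in> carrier_mat n n" by (rule carrier_matI) simp_all
  have "cmat (E - A) = pencil 1 1 E A" by (rule eq_matI) (auto simp: pencil_def)
  then have det: "det (E - A) \<noteq> 0"
    using nosing[of 1] of_real_hom.hom_det[of "E - A", where ?'a = complex] by auto
  obtain R where R: "R \<in> carrier_mat n n" "(E - A) * R = 1\<^sub>m n" "R * (E - A) = 1\<^sub>m n"
    using inverse_mat_exists[OF EA det] .
  interpret cayley_descriptor n m E A B C D R
    by unfold_locales (rule R)+
  \<comment> \<open>The horizon is finite, so the weights tend to 1 term by term as \<open>r\<close>
    increases to 1.\<close>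
  have dissipative: "supplied N (0\<^sub>v n) u \<ge> 0" if u: "input u" for N u
  proof -
    define a where "a k = u k \<bullet> out (state (0\<^sub>v n) u k) (u k)" for k
    have "((\<lambda>r. \<Sum>k<N. r ^ (2 * k) * a k) \<longlongrightarrow> (\<Sum>k<N. 1 ^ (2 * k) * a k)) (at_left 1)"
      by (intro tendsto_intros)
    moreover have "eventually (\<lambda>r. (\<Sum>k<N. r ^ (2 * k) * a k) \<ge> 0) (at_left (1::real))"
      using passivity_weighted[OF nosing freq u] unfolding a_def
      by (intro eventually_at_leftI[of 0]) auto
    ultimately have "(\<Sum>k<N. 1 ^ (2 * k) * a k) \<ge> 0"
      by (intro tendsto_lowerbound[of _ _ "at_left (1::real)"]) auto
    then show ?thesis by (simp add: supplied_def a_def)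
  qed
  obtain P where P: "P \<in> carrier_mat n n" "P\<^sup>T = P"
    "\<And>w. w \<in> carrier_vec n \<Longrightarrow> w \<bullet> (P *\<^sub>v w) \<ge> 0"
    "\<And>w. w \<in> carrier_vec n \<Longrightarrow> E *\<^sub>v w = 0\<^sub>v n \<Longrightarrow> P *\<^sub>v w = 0\<^sub>v n"
    "\<And>x u w. x \<in> carrier_vec n \<Longrightarrow> u \<in> carrier_vec m \<Longrightarrow> w \<in> carrier_vec n \<Longrightarrow>
      A *\<^sub>v x + B *\<^sub>v u = E *\<^sub>v w \<Longrightarrow> x \<bullet> (P *\<^sub>v w) \<le> u \<bullet> (C *\<^sub>v x + D *\<^sub>v u)"
    using storage_from_passivity[OF dissipative reachable[OF ctrl]] by blast
  obtain X where X: "X \<in> carrier_mat n n" "E\<^sup>T * X = X\<^sup>T * E"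
    "\<And>x. x \<in> carrier_vec n \<Longrightarrow> (X *\<^sub>v x) \<bullet> (E *\<^sub>v x) \<ge> 0"
    "\<And>x u. x \<in> carrier_vec n \<Longrightarrow> u \<in> carrier_vec m \<Longrightarrow>
      (X *\<^sub>v x) \<bullet> (A *\<^sub>v x + B *\<^sub>v u) \<le> u \<bullet> (C *\<^sub>v x + D *\<^sub>v u)"
    using lmi_solution_from_storage[OF ctrl P D] by blast
  have "det X \<noteq> 0" by (rule lmi_solution_invertible[OF det obs X])
  then show ?thesis using port_Hamiltonian_if_lmi[OF X(1) _ X(2-4)] by blast
qed

end

section \<open>Transfer functions\<close>

lemma mat_inverse_nonsingular:
  fixes A :: "'a :: field mat"
  assumes A: "A \<in> carrier_mat n n" and det: "det A \<noteq> 0"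
  obtains R where "mat_inverse A = Some R" "R \<in> carrier_mat n n" "A * R = 1\<^sub>m n" "R * A = 1\<^sub>m n"
proof (cases "mat_inverse A")
  case None
  then have "A \<notin> Units (ring_mat TYPE('a) n ())" by (rule mat_inverse(1)[OF A])
  then show thesis using det_non_zero_imp_unit[OF A det, of "()"] by blast
next
  case (Some R)
  then show thesis using mat_inverse(2)[OF A] that by blast
qed

context descriptor
begin

lemma transfer_formula_carrier: "det (pencil s 1 E A) \<noteq> 0 \<Longrightarrow> transfer_formula E A B C D s \<in> carrier_mat m m"
  unfolding transfer_formula_def
  using mat_inverse_nonsingular[OF pencil_carrier] by (intro carrier_matI) auto

lemma transfer_formula_mult_vec:
  assumes det: "det (pencil s 1 E A) \<noteq> 0" and u: "u \<in> carrier_vec m" and x: "x \<in> carrier_vec n"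
    and eq: "pencil s 1 E A *\<^sub>v x = cmat B *\<^sub>v u"
  shows "transfer_formula E A B C D s *\<^sub>v u = cmat C *\<^sub>v x + cmat D *\<^sub>v u"
proof -
  obtain R where R: "mat_inverse (pencil s 1 E A) = Some R" "R \<in> carrier_mat n n"
    "pencil s 1 E A * R = 1\<^sub>m n" "R * pencil s 1 E A = 1\<^sub>m n"
    using mat_inverse_nonsingular[OF pencil_carrier det] .
  have [simp]: "dim_row R = n" "dim_col R = n" using R by auto
  have "R *\<^sub>v (cmat B *\<^sub>v u) = (R * pencil s 1 E A) *\<^sub>v x"
    unfolding eq[symmetric] using x by (simp add: mult_mult_mat_vec)
  also have "\<dots> = x" unfolding R(4) using x by simp
  finally have "R *\<^sub>v (cmat B *\<^sub>v u) = x" .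
  then show ?thesis using u unfolding transfer_formula_def R(1)
    by (simp add: add_mult_mat_vec mult_mult_mat_vec)
qed

lemma pencil_solution:
  assumes det: "det (pencil s 1 E A) \<noteq> 0" and u: "u \<in> carrier_vec m"
  obtains x where "x \<in> carrier_vec n" "pencil s 1 E A *\<^sub>v x = cmat B *\<^sub>v u"
proof -
  obtain R where R: "R \<in> carrier_mat n n" "pencil s 1 E A * R = 1\<^sub>m n"
    using inverse_mat_exists[OF pencil_carrier det] by metis
  show thesis
  proof (rule that[of "R *\<^sub>v (cmat B *\<^sub>v u)"])
    show "R *\<^sub>v (cmat B *\<^sub>v u) \<in> carrier_vec n" using R by (intro carrier_vecI) simp
    have "pencil s 1 E A *\<^sub>v (R *\<^sub>v (cmat B *\<^sub>v u)) = (pencil s 1 E A * R) *\<^sub>v (cmat B *\<^sub>v u)"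
      using R(1) u by (subst mult_mult_mat_vec) auto
    then show "pencil s 1 E A *\<^sub>v (R *\<^sub>v (cmat B *\<^sub>v u)) = cmat B *\<^sub>v u"
      unfolding R(2) by (simp add: one_mult_mat_vec')
  qed
qed

lemma pencil_adjugate:
  obtains Adj d where "Adj \<in> carrier_mat n n"
    "\<And>z. pencil z 1 E A * map_mat (\<lambda>p. poly p z) Adj = poly d z \<cdot>\<^sub>m 1\<^sub>m n"
    "\<And>z. map_mat (\<lambda>p. poly p z) Adj * pencil z 1 E A = poly d z \<cdot>\<^sub>m 1\<^sub>m n"
    "\<And>z. det (pencil z 1 E A) = poly d z"
proof -
  have "- cmat A \<in> carrier_mat n n" "cmat E \<in> carrier_mat n n" by (rule carrier_matI; simp)+
  moreover have "- cmat A + z \<cdot>\<^sub>m cmat E = pencil z 1 E A" for z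
    by (rule eq_matI) (auto simp: pencil_def)
  ultimately show thesis
    using linear_matrix_polynomial_adjugate[of "- cmat A" n "cmat E"] that by metis
qed

text \<open>The determinant is a nonzero polynomial in \<open>z\<close>, and its finitely many roots
  have no limit point.\<close>

lemma eventually_pencil_nonsingular:
  assumes "regular E A"
  shows "eventually (\<lambda>z. det (pencil z 1 E A) \<noteq> 0) (at s)"
proof -
  have scale: "det (pencil \<alpha> \<beta> E A) = \<beta> ^ n * det (pencil (\<alpha> / \<beta>) 1 E A)" if "\<beta> \<noteq> 0" for \<alpha> \<beta>
  proof -
    have "pencil \<alpha> \<beta> E A = \<beta> \<cdot>\<^sub>m pencil (\<alpha> / \<beta>) 1 E A"
      using that by (intro eq_matI) (auto simp: pencil_def field_simps)
    then show ?thesis by simp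
  qed
  obtain \<alpha> \<beta> where ab: "det (pencil \<alpha> \<beta> E A) \<noteq> 0" using assms by (auto simp: regular_def)
  \<comment> \<open>A witness with \<open>\<beta> = 0\<close> lies at infinity, outside the affine
    pencil. As a polynomial in \<open>\<beta>\<close> the determinant is then nonzero, so the
    witness can be moved to some \<open>\<beta>' \<noteq> 0\<close> and rescaled.\<close>
  obtain \<beta>' where b': "\<beta>' \<noteq> 0" "det (pencil \<alpha> \<beta>' E A) \<noteq> 0"
  proof (cases "\<beta> = 0")
    case True
    have c: "\<alpha> \<cdot>\<^sub>m cmat E \<in> carrier_mat n n" "- cmat A \<in> carrier_mat n n" by (rule carrier_matI; simp)+
    have e: "\<alpha> \<cdot>\<^sub>m cmat E + z \<cdot>\<^sub>m (- cmat A) = pencil \<alpha> z E A" for z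
      by (rule eq_matI) (auto simp: pencil_def)
    obtain d where d: "\<And>z. det (pencil \<alpha> z E A) = poly d z"
      using linear_matrix_polynomial_adjugate[OF c] unfolding e by metis
    then have "d \<noteq> 0" using ab True by auto
    then have "finite ({z. poly d z = 0} \<union> {0})" by (simp add: poly_roots_finite)
    then obtain z where "z \<notin> {z. poly d z = 0} \<union> {0}"
      using ex_new_if_finite[OF infinite_UNIV_char_0] by blast
    then show thesis using that[of z] d by auto
  qed (use ab that in auto)
  obtain d where d: "\<And>z. det (pencil z 1 E A) = poly d z" using pencil_adjugate by metis
  have "d \<noteq> 0" using b' scale[of \<beta>' \<alpha>] d by auto
  then have "finite {z. poly d z = 0}" by (rule poly_roots_finite)
  then have "\<not> s islimpt {z. poly d z = 0}" by (rule islimpt_finite)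
  then show ?thesis by (simp add: islimpt_iff_eventually d)
qed

lemma transfer_formula_rational:
  assumes Adj: "Adj \<in> carrier_mat n n"
    and left: "\<And>z. pencil z 1 E A * map_mat (\<lambda>p. poly p z) Adj = poly d z \<cdot>\<^sub>m 1\<^sub>m n"
    and det: "\<And>z. det (pencil z 1 E A) = poly d z"
    and z: "poly d z \<noteq> 0" and ij: "i < m" "j < m"
  shows "transfer_formula E A B C D z $$ (i, j) =
    (\<Sum>a<n. complex_of_real (C $$ (i, a)) * (\<Sum>b<n. poly (Adj $$ (a, b)) z * complex_of_real (B $$ (b, j)))) / poly d z
    + complex_of_real (D $$ (i, j))"
proof -
  have [simp]: "dim_row Adj = n" "dim_col Adj = n" using Adj by auto
  define u where "u = (unit_vec m j :: complex vec)"
  have u: "u \<in> carrier_vec m" by (simp add: u_def)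
  have Mu: "(M *\<^sub>v u) $ i = M $$ (i, j)" if "i < dim_row M" "dim_col M = m" for M i
    using that ij by (simp add: u_def)
  define x where "x = (1 / poly d z) \<cdot>\<^sub>v (map_mat (\<lambda>p. poly p z) Adj *\<^sub>v (cmat B *\<^sub>v u))"
  have x: "x \<in> carrier_vec n" unfolding x_def by (rule carrier_vecI) simp
  have "pencil z 1 E A *\<^sub>v x = (1 / poly d z) \<cdot>\<^sub>v ((pencil z 1 E A * map_mat (\<lambda>p. poly p z) Adj) *\<^sub>v (cmat B *\<^sub>v u))"
    unfolding x_def using u by (simp add: mult_mat_vec_smult mult_mult_mat_vec)
  also have "\<dots> = cmat B *\<^sub>v u" unfolding left using z u
    by (simp add: smult_mult_mat_vec one_mult_mat_vec' smult_smult_assoc)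
  finally have "transfer_formula E A B C D z *\<^sub>v u = cmat C *\<^sub>v x + cmat D *\<^sub>v u"
    using det z by (intro transfer_formula_mult_vec u x) auto
  then have "(transfer_formula E A B C D z *\<^sub>v u) $ i = (cmat C *\<^sub>v x) $ i + (cmat D *\<^sub>v u) $ i"
    using ij by (simp del: index_mult_mat_vec)
  moreover have "(transfer_formula E A B C D z *\<^sub>v u) $ i = transfer_formula E A B C D z $$ (i, j)"
    using transfer_formula_carrier[of z] det z ij by (intro Mu) auto
  moreover have "(cmat D *\<^sub>v u) $ i = complex_of_real (D $$ (i, j))"
    using ij by (subst Mu) auto
  moreover have "(cmat C *\<^sub>v x) $ i =
      (\<Sum>a<n. complex_of_real (C $$ (i, a)) * (\<Sum>b<n. poly (Adj $$ (a, b)) z * complex_of_real (B $$ (b, j)))) / poly d z"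
  proof -
    have xa: "x $ a = (\<Sum>b<n. poly (Adj $$ (a, b)) z * complex_of_real (B $$ (b, j))) / poly d z" if a: "a < n" for a
    proof -
      have "x $ a = 1 / poly d z * (\<Sum>b<n. poly (Adj $$ (a, b)) z * (cmat B *\<^sub>v u) $ b)"
        unfolding x_def using a by (simp add: index_mult_mat_vec_sum del: index_mult_mat_vec)
      also have "(\<Sum>b<n. poly (Adj $$ (a, b)) z * (cmat B *\<^sub>v u) $ b) =
          (\<Sum>b<n. poly (Adj $$ (a, b)) z * complex_of_real (B $$ (b, j)))"
      proof (rule sum.cong[OF refl])
        fix b assume "b \<in> {..<n}"
        then have "(cmat B *\<^sub>v u) $ b = cmat B $$ (b, j)" by (intro Mu) auto
        then show "poly (Adj $$ (a, b)) z * (cmat B *\<^sub>v u) $ b = poly (Adj $$ (a, b)) z * complex_of_real (B $$ (b, j))"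
          using \<open>b \<in> {..<n}\<close> ij by simp
      qed
      finally show ?thesis by simp
    qed
    have "(cmat C *\<^sub>v x) $ i = (\<Sum>a<n. complex_of_real (C $$ (i, a)) * x $ a)"
      using ij x by (simp add: index_mult_mat_vec_sum del: index_mult_mat_vec)
    then show ?thesis by (simp add: xa flip: sum_divide_distrib)
  qed
  ultimately show ?thesis by simp
qed

text \<open>By the adjugate formula the entries are holomorphic on the open set of nonsingular
  points, where removing singularities changes nothing.\<close>

lemma transfer_eq_formula:
  assumes det: "det (pencil z 1 E A) \<noteq> 0" and ij: "i < m" "j < m"
  shows "transfer E A B C D z $$ (i, j) = transfer_formula E A B C D z $$ (i, j)"
proof -
  obtain Adj d where Adj: "Adj \<in> carrier_mat n n"
    and left: "\<And>z. pencil z 1 E A * map_mat (\<lambda>p. poly p z) Adj = poly d z \<cdot>\<^sub>m 1\<^sub>m n"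
    and dd: "\<And>z. det (pencil z 1 E A) = poly d z"
    using pencil_adjugate by metis
  define g where "g w = (\<Sum>a<n. complex_of_real (C $$ (i, a)) * (\<Sum>b<n. poly (Adj $$ (a, b)) w * complex_of_real (B $$ (b, j)))) / poly d w
    + complex_of_real (D $$ (i, j))" for w
  have op: "open {w. poly d w \<noteq> 0}"
    by (intro open_Collect_neq continuous_intros)
  have "g holomorphic_on {w. poly d w \<noteq> 0}" unfolding g_def by (auto intro!: holomorphic_intros)
  then have "(\<lambda>w. transfer_formula E A B C D w $$ (i, j)) holomorphic_on {w. poly d w \<noteq> 0}"
    by (rule holomorphic_transform) (use transfer_formula_rational[OF Adj left dd _ ij] in \<open>simp add: g_def\<close>)
  then have "(\<lambda>w. transfer_formula E A B C D w $$ (i, j)) analytic_on {z}"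
    using op det dd by (auto simp: analytic_at)
  then show ?thesis using ij by (simp add: transfer_def)
qed

text \<open>Removing singularities depends only on a punctured neighbourhood, so agreement where the
  first pencil is nonsingular is enough. There, the formulas agree if for every input both systems
  have solutions with equal outputs.\<close>

lemma transfer_eqI:
  assumes "regular E A" and sys': "descriptor_system n' m E' A' B' C' D'"
    and eq: "\<And>s. det (pencil s 1 E A) \<noteq> 0 \<Longrightarrow> det (pencil s 1 E' A') \<noteq> 0 \<and>
      (\<forall>u \<in> carrier_vec m. \<exists>x \<in> carrier_vec n. \<exists>x' \<in> carrier_vec n'.
        pencil s 1 E A *\<^sub>v x = cmat B *\<^sub>v u \<and> pencil s 1 E' A' *\<^sub>v x' = cmat B' *\<^sub>v u \<and>
        cmat C *\<^sub>v x + cmat D *\<^sub>v u = cmat C' *\<^sub>v x' + cmat D' *\<^sub>v u)"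
  shows "transfer E A B C D = transfer E' A' B' C' D'"
proof
  fix s
  interpret s': descriptor n' m E' A' B' C' D' by unfold_locales (rule sys')
  have "transfer_formula E A B C D z = transfer_formula E' A' B' C' D' z"
    if z: "det (pencil z 1 E A) \<noteq> 0" for z
  proof (rule mat_eq_if_mult_vec_eq)
    show "transfer_formula E A B C D z \<in> carrier_mat m m" by (rule transfer_formula_carrier[OF z])
    show "transfer_formula E' A' B' C' D' z \<in> carrier_mat m m"
      using eq[OF z] by (intro s'.transfer_formula_carrier) simp
    fix u :: "complex vec" assume u: "u \<in> carrier_vec m"
    with eq[OF z] obtain x x' where "x \<in> carrier_vec n" "x' \<in> carrier_vec n'"
        "pencil z 1 E A *\<^sub>v x = cmat B *\<^sub>v u" "pencil z 1 E' A' *\<^sub>v x' = cmat B' *\<^sub>v u"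
        "cmat C *\<^sub>v x + cmat D *\<^sub>v u = cmat C' *\<^sub>v x' + cmat D' *\<^sub>v u" by blast
    then show "transfer_formula E A B C D z *\<^sub>v u = transfer_formula E' A' B' C' D' z *\<^sub>v u"
      using eq[OF z] z u transfer_formula_mult_vec s'.transfer_formula_mult_vec by metis
  qed
  then have "eventually (\<lambda>z. transfer_formula E A B C D z = transfer_formula E' A' B' C' D' z) (at s)"
    using eventually_pencil_nonsingular[OF assms(1), of s] by (rule eventually_mono[rotated])
  then have "remove_sings (\<lambda>z. transfer_formula E A B C D z $$ ij) s =
      remove_sings (\<lambda>z. transfer_formula E' A' B' C' D' z $$ ij) s" for ij
    by (intro remove_sings_cong) (auto elim: eventually_mono)
  then show "transfer E A B C D s = transfer E' A' B' C' D' s"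
    by (simp add: transfer_def)
qed

text \<open>The Hermitian form of \<open>T + T\<^sup>H\<close> at \<open>u\<close> is twice the real
  part of that of \<open>T\<close>, and \<open>T u\<close> is the output belonging to
  \<open>x\<close>.\<close>

lemma half_plane_passive:
  assumes pr: "positive_real E A B C D" and det: "det (pencil s 1 E A) \<noteq> 0" and s: "Re s > 0"
    and x: "x \<in> carrier_vec n" and u: "u \<in> carrier_vec m" and eq: "pencil s 1 E A *\<^sub>v x = cmat B *\<^sub>v u"
  shows "Re (conjugate u \<bullet> (cmat C *\<^sub>v x + cmat D *\<^sub>v u)) \<ge> 0"
proof -
  define T where "T = transfer E A B C D s"
  have T: "T \<in> carrier_mat m m" by (simp add: T_def transfer_def)
  have "T = transfer_formula E A B C D s"
    using transfer_formula_carrier[OF det] transfer_eq_formula[OF det] T unfolding T_def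
    by (intro eq_matI) auto
  then have Tu: "T *\<^sub>v u = cmat C *\<^sub>v x + cmat D *\<^sub>v u"
    using transfer_formula_mult_vec[OF det u x eq] by simp
  have "psd (T + mat_adjoint T)" using pr s by (simp add: positive_real_def T_def)
  moreover have adj: "mat_adjoint T \<in> carrier_mat m m" using T by (auto simp: mat_adjoint_def)
  ultimately have "((T + mat_adjoint T) *\<^sub>v u) \<bullet>c u \<ge> 0" using T u by (auto simp: psd_def)
  also have "((T + mat_adjoint T) *\<^sub>v u) \<bullet>c u = (T *\<^sub>v u) \<bullet>c u + (mat_adjoint T *\<^sub>v u) \<bullet>c u"
    using T adj u by (subst add_mult_mat_vec) (auto simp: scalar_prod_distribs)
  also have "(mat_adjoint T *\<^sub>v u) \<bullet>c u = cnj ((T *\<^sub>v u) \<bullet>c u)"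
  proof -
    have "(mat_adjoint T *\<^sub>v u) \<bullet>c u = (\<Sum>i<m. \<Sum>j<m. cnj (T $$ (j, i)) * u $ j * cnj (u $ i))"
      using T adj u by (auto simp: scalar_prod_def atLeast0LessThan mat_adjoint_def mat_of_rows_def
          conjugate_complex_def sum_distrib_right intro!: sum.cong)
    also have "\<dots> = (\<Sum>j<m. \<Sum>i<m. cnj (T $$ (j, i)) * u $ j * cnj (u $ i))" by (rule sum.swap)
    also have "\<dots> = cnj ((T *\<^sub>v u) \<bullet>c u)"
      using T u by (auto simp: scalar_prod_def atLeast0LessThan conjugate_complex_def
          sum_distrib_left sum_distrib_right algebra_simps intro!: sum.cong)
    finally show ?thesis .
  qed
  finally have "Re ((T *\<^sub>v u) \<bullet>c u) \<ge> 0" by (simp add: less_eq_complex_def)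
  moreover have "(T *\<^sub>v u) \<bullet>c u = conjugate u \<bullet> (T *\<^sub>v u)"
    by (rule scalar_prod_commute) (use T u in auto)
  ultimately show ?thesis unfolding Tu by simp
qed

end

section \<open>Eigenvalues of a minimal system are poles\<close>

lemma isCont_eq_at_limit:
  fixes f g :: "complex \<Rightarrow> complex"
  assumes "isCont f a" "isCont g a" "eventually (\<lambda>z. f z = g z) (at a)"
  shows "f a = g a"
proof -
  have "(f \<longlongrightarrow> f a) (at a)" "(g \<longlongrightarrow> g a) (at a)" using assms by (auto simp: isCont_def)
  then have "(f \<longlongrightarrow> g a) (at a)" using assms(3) tendsto_cong[of f g "at a"] by blast
  then show ?thesis using \<open>(f \<longlongrightarrow> f a) (at a)\<close> tendsto_unique[of "at a"] by (metis trivial_limit_at)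
qed

context descriptor
begin

text \<open>Near an eigenvalue \<open>s\<^sub>0\<close> the resolvent behaves like \<open>(s - s\<^sub>0)\<^sup>-\<^sup>p K\<close> with \<open>p > 0\<close>, \<open>K \<noteq> 0\<close> and
  \<open>(s\<^sub>0 E - A) K = 0 = K (s\<^sub>0 E - A)\<close>. If the transfer function had no pole at \<open>s\<^sub>0\<close>, then \<open>C K B = 0\<close>;
  observability would give \<open>K B = 0\<close> and controllability \<open>K = 0\<close>.\<close>

lemma nonsingular_if_transfer_analytic:
  assumes reg: "regular E A"
    and ana: "\<And>i j. i < m \<Longrightarrow> j < m \<Longrightarrow> (\<lambda>s. transfer E A B C D s $$ (i, j)) analytic_on {s0}"
    and ctrl: "hautus_controllable n m E A B" and obs: "hautus_observable n m E A C"
  shows "det (pencil s0 1 E A) \<noteq> 0"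
proof
  assume det0: "det (pencil s0 1 E A) = 0"
  obtain Adj d where Adj: "Adj \<in> carrier_mat n n"
    and left: "\<And>z. pencil z 1 E A * map_mat (\<lambda>p. poly p z) Adj = poly d z \<cdot>\<^sub>m 1\<^sub>m n"
    and right: "\<And>z. map_mat (\<lambda>p. poly p z) Adj * pencil z 1 E A = poly d z \<cdot>\<^sub>m 1\<^sub>m n"
    and dd: "\<And>z. det (pencil z 1 E A) = poly d z"
    using pencil_adjugate by metis
  have [simp]: "dim_row Adj = n" "dim_col Adj = n" using Adj by auto
  have ev: "eventually (\<lambda>z. poly d z \<noteq> 0) (at s0)"
    using eventually_pencil_nonsingular[OF reg, of s0] by (simp add: dd)
  have d0: "d \<noteq> 0"
    using eventually_happens[OF ev] by auto
  define t where "t = [:- s0, 1:]"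
  define q where "q = Polynomial.order s0 d"
  obtain h where h: "d = t ^ q * h" "\<not> t dvd h"
    using order_decomp[OF d0, of s0] unfolding t_def q_def by blast
  have tz: "poly t z = z - s0" for z by (simp add: t_def)
  have h0: "poly h s0 \<noteq> 0" using h(2) by (simp add: t_def poly_eq_0_iff_dvd)
  \<comment> \<open>Here \<open>K\<close> is a set of exponents: the powers of
    \<open>z - s0\<close>, up to its order in \<open>d\<close>, that divide every entry of the
    adjugate. Cancelling the largest one leaves the resolvent as \<open>Az z\<close> divided by
    \<open>e z\<close>, and \<open>Az s0\<close> is a nonzero multiple of the leading coefficient of
    the resolvent.\<close>
  define K where "K = {k. k \<le> q \<and> (\<forall>a<n. \<forall>b<n. t ^ k dvd Adj $$ (a, b))}"
  have K: "finite K" "0 \<in> K" by (auto simp: K_def)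
  define k where "k = Max K"
  have kK: "k \<in> K" unfolding k_def using K by (intro Max_in) auto
  have k_max: "j \<le> k" if "j \<in> K" for j unfolding k_def using K that by (intro Max_ge) auto
  define H where "H a b = Adj $$ (a, b) div t ^ k" for a b
  have AH: "Adj $$ (a, b) = t ^ k * H a b" if "a < n" "b < n" for a b
    using kK that by (simp add: K_def H_def)
  define e where "e z = (z - s0) ^ (q - k) * poly h z" for z
  have dz: "poly d z = (z - s0) ^ k * e z" for z
    using kK unfolding h(1) e_def K_def by (simp add: tz flip: power_add mult.assoc)
  have at_neq: "eventually (\<lambda>z. z \<noteq> s0) (at s0)" by (simp add: eventually_at_filter)
  define Az where "Az z = mat n n (\<lambda>(a, b). poly (H a b) z)" for z
  have Az: "Az z \<in> carrier_mat n n" and [simp]: "dim_row (Az z) = n" "dim_col (Az z) = n" for z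
    by (auto simp: Az_def)
  have ev_Adj: "map_mat (\<lambda>p. poly p z) Adj = (z - s0) ^ k \<cdot>\<^sub>m Az z" for z
    by (rule eq_matI) (auto simp: Az_def AH tz)
  have e_cont: "isCont e s0" unfolding e_def by (intro continuous_intros)
  have limit: "F s0 = e s0 \<cdot>\<^sub>m 1\<^sub>m n"
    if F: "\<And>z. F z \<in> carrier_mat n n" and cont: "\<And>i j. i < n \<Longrightarrow> j < n \<Longrightarrow> isCont (\<lambda>z. F z $$ (i, j)) s0"
      and eq: "\<And>z. (z - s0) ^ k \<cdot>\<^sub>m F z = poly d z \<cdot>\<^sub>m 1\<^sub>m n" for F
  proof (rule eq_matI)
    fix i j assume "i < dim_row (e s0 \<cdot>\<^sub>m 1\<^sub>m n)" "j < dim_col (e s0 \<cdot>\<^sub>m 1\<^sub>m n)"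
    then have ij: "i < n" "j < n" by auto
    have dF: "dim_row (F z) = n" "dim_col (F z) = n" for z using F[of z] by auto
    have "F s0 $$ (i, j) = e s0 * (if i = j then 1 else 0)"
    proof (rule isCont_eq_at_limit[where a = s0 and g = "\<lambda>z. e z * (if i = j then 1 else 0)", OF cont[OF ij]])
      show "isCont (\<lambda>z. e z * (if i = j then 1 else 0)) s0" by (intro continuous_intros e_cont)
      show "eventually (\<lambda>z. F z $$ (i, j) = e z * (if i = j then 1 else 0)) (at s0)"
        using at_neq
      proof eventually_elim
        case (elim z)
        have "((z - s0) ^ k \<cdot>\<^sub>m F z) $$ (i, j) = (poly d z \<cdot>\<^sub>m 1\<^sub>m n) $$ (i, j)" using eq by simp
        then have "(z - s0) ^ k * F z $$ (i, j) = (z - s0) ^ k * (e z * (if i = j then 1 else 0))"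
          using ij dF by (simp add: dz)
        then show ?case using elim by simp
      qed
    qed
    then show "F s0 $$ (i, j) = (e s0 \<cdot>\<^sub>m 1\<^sub>m n) $$ (i, j)" using ij by simp
  qed (use F[of s0] in auto)
  have PA: "pencil s0 1 E A * Az s0 = e s0 \<cdot>\<^sub>m 1\<^sub>m n"
  proof (rule limit[of "\<lambda>z. pencil z 1 E A * Az z"])
    show "isCont (\<lambda>z. (pencil z 1 E A * Az z) $$ (i, j)) s0" if "i < n" "j < n" for i j
      using that by (simp add: scalar_prod_def Az_def pencil_def atLeast0LessThan continuous_intros)
    show "(z - s0) ^ k \<cdot>\<^sub>m (pencil z 1 E A * Az z) = poly d z \<cdot>\<^sub>m 1\<^sub>m n" for z
      using left[of z] unfolding ev_Adj using mult_smult_distrib[OF pencil_carrier Az] by metis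
  qed (auto intro: carrier_matI)
  have AP: "Az s0 * pencil s0 1 E A = e s0 \<cdot>\<^sub>m 1\<^sub>m n"
  proof (rule limit[of "\<lambda>z. Az z * pencil z 1 E A"])
    show "isCont (\<lambda>z. (Az z * pencil z 1 E A) $$ (i, j)) s0" if "i < n" "j < n" for i j
      using that by (simp add: scalar_prod_def Az_def pencil_def atLeast0LessThan continuous_intros)
    show "(z - s0) ^ k \<cdot>\<^sub>m (Az z * pencil z 1 E A) = poly d z \<cdot>\<^sub>m 1\<^sub>m n" for z
      using right[of z] unfolding ev_Adj using mult_smult_assoc_mat[OF Az pencil_carrier] by metis
  qed (auto intro: carrier_matI)
  \<comment> \<open>With \<open>k = q\<close> the cancelled denominator would be nonzero at
    \<open>s0\<close>, and the pencil would be invertible there.\<close>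
  have "k \<noteq> q"
  proof
    assume "k = q"
    then have e0: "e s0 \<noteq> 0" using h0 by (simp add: e_def)
    have "det (pencil s0 1 E A * Az s0) = det (pencil s0 1 E A) * det (Az s0)"
      by (rule det_mult[OF pencil_carrier Az])
    then have "e s0 ^ n = 0" unfolding PA det0 by simp
    then show False using e0 by simp
  qed
  then have kq: "k < q" using kK by (simp add: K_def)
  then have e0: "e s0 = 0" by (simp add: e_def)
  \<comment> \<open>Maximality of \<open>k\<close> yields an entry without a further factor
    \<open>z - s0\<close>, so \<open>Az s0\<close> is not zero; this is what the end
    contradicts.\<close>
  have "Suc k \<notin> K" using k_max[of "Suc k"] by auto
  then obtain a b where ab: "a < n" "b < n" "\<not> t ^ Suc k dvd Adj $$ (a, b)"
    using kq by (auto simp: K_def)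
  then have "\<not> t dvd H a b" using AH[OF ab(1,2)] by auto
  then have Hab: "poly (H a b) s0 \<noteq> 0" by (simp add: t_def poly_eq_0_iff_dvd)
  \<comment> \<open>Away from \<open>s0\<close> the cancelled numerator is transfer function minus
    \<open>D\<close>, times \<open>e\<close>. By analyticity the first factor stays bounded at
    \<open>s0\<close>, while \<open>e\<close> vanishes.\<close>
  have CAB: "(\<Sum>a<n. complex_of_real (C $$ (i, a)) * (\<Sum>b<n. poly (H a b) s0 * complex_of_real (B $$ (b, j)))) = 0"
    if ij: "i < m" "j < m" for i j
  proof -
    define G where "G z = (\<Sum>a<n. complex_of_real (C $$ (i, a)) * (\<Sum>b<n. poly (H a b) z * complex_of_real (B $$ (b, j))))" for z
    have "G s0 = (transfer E A B C D s0 $$ (i, j) - complex_of_real (D $$ (i, j))) * e s0"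
    proof (rule isCont_eq_at_limit[where f = G and a = s0 and g = "\<lambda>z. (transfer E A B C D z $$ (i, j) - complex_of_real (D $$ (i, j))) * e z"])
      show "isCont G s0" unfolding G_def by (intro continuous_intros)
      have "isCont (\<lambda>z. transfer E A B C D z $$ (i, j)) s0"
        using ana[OF ij] by (rule analytic_at_imp_isCont)
      then show "isCont (\<lambda>z. (transfer E A B C D z $$ (i, j) - complex_of_real (D $$ (i, j))) * e z) s0"
        by (intro continuous_intros e_cont)
      show "eventually (\<lambda>z. G z = (transfer E A B C D z $$ (i, j) - complex_of_real (D $$ (i, j))) * e z) (at s0)"
        using ev at_neq
      proof eventually_elim
        case (elim z)
        have "(\<Sum>a<n. complex_of_real (C $$ (i, a)) * (\<Sum>b<n. poly (Adj $$ (a, b)) z * complex_of_real (B $$ (b, j)))) =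
            (z - s0) ^ k * G z"
          by (simp add: G_def AH tz sum_distrib_left mult.assoc mult.left_commute)
        then have "transfer E A B C D z $$ (i, j) = (z - s0) ^ k * G z / poly d z + complex_of_real (D $$ (i, j))"
          using transfer_eq_formula[of z i j] transfer_formula_rational[OF Adj left dd elim(1) ij] elim ij dd by simp
        then show ?case using elim unfolding dz by (simp add: field_simps)
      qed
    qed
    then show ?thesis by (simp add: e0 G_def)
  qed
  have ABv: "Az s0 *\<^sub>v (cmat B *\<^sub>v v) = 0\<^sub>v n" if v: "v \<in> carrier_vec m" for v
  proof -
    define x where "x = Az s0 *\<^sub>v (cmat B *\<^sub>v v)"
    have x: "x \<in> carrier_vec n" unfolding x_def by (rule carrier_vecI) simp
    have "pencil s0 1 E A *\<^sub>v x = (pencil s0 1 E A * Az s0) *\<^sub>v (cmat B *\<^sub>v v)"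
      unfolding x_def by (rule mult_mult_mat_vec[symmetric]) auto
    also have "\<dots> = 0\<^sub>v n"
      unfolding PA e0 by (simp add: smult_mult_mat_vec one_mult_mat_vec') (auto simp: vec_eq_iff)
    finally have Px: "pencil s0 1 E A *\<^sub>v x = 0\<^sub>v n" .
    have "cmat C *\<^sub>v x = 0\<^sub>v m"
    proof (rule eq_vecI)
      fix i assume "i < dim_vec (0\<^sub>v m :: complex vec)"
      then have i: "i < m" by simp
      have "(cmat C *\<^sub>v x) $ i = (\<Sum>a<n. complex_of_real (C $$ (i, a)) *
          (\<Sum>b<n. poly (H a b) s0 * (\<Sum>j<m. complex_of_real (B $$ (b, j)) * v $ j)))"
        using i v x by (simp add: index_mult_mat_vec_sum x_def Az_def del: index_mult_mat_vec)
      also have "\<dots> = (\<Sum>a<n. \<Sum>j<m. v $ j * (complex_of_real (C $$ (i, a)) *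
          (\<Sum>b<n. poly (H a b) s0 * complex_of_real (B $$ (b, j)))))"
      proof (rule sum.cong[OF refl])
        fix a
        have "(\<Sum>b<n. poly (H a b) s0 * (\<Sum>j<m. complex_of_real (B $$ (b, j)) * v $ j)) =
            (\<Sum>j<m. v $ j * (\<Sum>b<n. poly (H a b) s0 * complex_of_real (B $$ (b, j))))"
          unfolding sum_distrib_left by (subst sum.swap) (simp add: mult_ac)
        then show "complex_of_real (C $$ (i, a)) * (\<Sum>b<n. poly (H a b) s0 * (\<Sum>j<m. complex_of_real (B $$ (b, j)) * v $ j)) =
          (\<Sum>j<m. v $ j * (complex_of_real (C $$ (i, a)) * (\<Sum>b<n. poly (H a b) s0 * complex_of_real (B $$ (b, j)))))"
          by (simp add: sum_distrib_left mult_ac)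
      qed
      also have "\<dots> = (\<Sum>j<m. v $ j * (\<Sum>a<n. complex_of_real (C $$ (i, a)) *
          (\<Sum>b<n. poly (H a b) s0 * complex_of_real (B $$ (b, j)))))"
        by (subst sum.swap) (simp add: sum_distrib_left)
      also have "\<dots> = 0" using CAB[OF i] by simp
      finally show "(cmat C *\<^sub>v x) $ i = 0\<^sub>v m $ i" using i by simp
    qed simp
    moreover have "(s0, 1) \<noteq> (0, 0::complex)" by simp
    ultimately show ?thesis using obs x Px unfolding hautus_observable_def x_def by blast
  qed
  have "(Az s0)\<^sup>T *\<^sub>v w = 0\<^sub>v n" if w: "w \<in> carrier_vec n" for w
  proof -
    define y where "y = (Az s0)\<^sup>T *\<^sub>v w"
    have y: "y \<in> carrier_vec n" unfolding y_def by (rule carrier_vecI) simp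
    have "x \<bullet> ((pencil s0 1 E A)\<^sup>T *\<^sub>v y) = 0" if x: "x \<in> carrier_vec n" for x
    proof -
      have "x \<bullet> ((pencil s0 1 E A)\<^sup>T *\<^sub>v y) = y \<bullet> (pencil s0 1 E A *\<^sub>v x)"
        by (rule transpose_mult_scalar_prod) (use x y in auto)
      also have "\<dots> = w \<bullet> (Az s0 *\<^sub>v (pencil s0 1 E A *\<^sub>v x))"
        unfolding y_def by (rule transpose_mult_scalar_prod) (use x w in auto)
      also have "Az s0 *\<^sub>v (pencil s0 1 E A *\<^sub>v x) = (Az s0 * pencil s0 1 E A) *\<^sub>v x"
        using x by (intro mult_mult_mat_vec[symmetric]) auto
      also have "\<dots> = 0\<^sub>v n" unfolding AP e0 using x
        by (simp add: smult_mult_mat_vec one_mult_mat_vec') (auto simp: vec_eq_iff)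
      finally show ?thesis using w by simp
    qed
    then have 1: "(pencil s0 1 E A)\<^sup>T *\<^sub>v y = 0\<^sub>v n"
      by (intro vec_eq_zero_if_orthogonal) (auto intro: carrier_vecI)
    have "v \<bullet> ((cmat B)\<^sup>T *\<^sub>v y) = 0" if v: "v \<in> carrier_vec m" for v
    proof -
      have "v \<bullet> ((cmat B)\<^sup>T *\<^sub>v y) = y \<bullet> (cmat B *\<^sub>v v)"
        by (rule transpose_mult_scalar_prod) (use v y in auto)
      also have "\<dots> = w \<bullet> (Az s0 *\<^sub>v (cmat B *\<^sub>v v))"
        unfolding y_def by (rule transpose_mult_scalar_prod) (use v w in auto)
      finally show ?thesis using w ABv[OF v] by simp
    qed
    then have 2: "(cmat B)\<^sup>T *\<^sub>v y = 0\<^sub>v m"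
      by (intro vec_eq_zero_if_orthogonal) (auto intro: carrier_vecI)
    have "(s0, 1) \<noteq> (0, 0::complex)" by simp
    then show ?thesis using ctrl y 1 2 unfolding hautus_controllable_def y_def by blast
  qed
  then have "(Az s0)\<^sup>T = 0\<^sub>m n n"
    by (intro mat_eq_if_mult_vec_eq[of _ n n]) (auto simp: zero_mult_mat_vec intro: carrier_matI)
  then have "(Az s0)\<^sup>T $$ (b, a) = 0" using ab by simp
  then show False using Hab ab by (simp add: Az_def)
qed

theorem port_Hamiltonian_if_positive_real:
  assumes reg: "regular E A" and pr: "positive_real E A B C D"
    and ctrl: "hautus_controllable n m E A B" and obs: "hautus_observable n m E A C"
    and psd: "psd (D + D\<^sup>T)"
  shows "port_Hamiltonian n m E A B C D"
proof (rule port_Hamiltonian_if_half_plane_passive)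
  show nosing: "det (pencil s 1 E A) \<noteq> 0" if s: "Re s > 0" for s
  proof (rule nonsingular_if_transfer_analytic[OF reg _ ctrl obs])
    fix i j assume ij: "i < m" "j < m"
    then have "(\<lambda>s. transfer E A B C D s $$ (i, j)) analytic_on {s. Re s > 0}"
      using pr by (simp add: positive_real_def)
    then show "(\<lambda>s. transfer E A B C D s $$ (i, j)) analytic_on {s}"
      by (rule analytic_on_subset) (use s in auto)
  qed
  show "Re (conjugate u \<bullet> (cmat C *\<^sub>v x + cmat D *\<^sub>v u)) \<ge> 0"
    if "Re s > 0" "x \<in> carrier_vec n" "u \<in> carrier_vec m" "pencil s 1 E A *\<^sub>v x = cmat B *\<^sub>v u" for s x u
    using half_plane_passive[OF pr nosing] that by blast
  show "u \<bullet> (D *\<^sub>v u) \<ge> 0" if u: "u \<in> carrier_vec m" for u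
  proof -
    have "u \<bullet> ((D + D\<^sup>T) *\<^sub>v u) \<ge> 0" using psd u by (simp add: psd_real_iff)
    also have "u \<bullet> ((D + D\<^sup>T) *\<^sub>v u) = 2 * (u \<bullet> (D *\<^sub>v u))"
      using u transpose_mult_scalar_prod(2)[of u D u] by (simp add: add_mult_mat_vec scalar_prod_distribs)
    finally show ?thesis by simp
  qed
qed (use ctrl obs in auto)

end

section \<open>Staircase forms\<close>

lemma append_cols_empty: "append_cols M (0\<^sub>m 0 0) = M"
  by (rule eq_matI) (auto simp: append_cols_def)

lemma append_rows_empty: "M @\<^sub>r (0\<^sub>m 0 0) = M"
  by (rule eq_matI) (auto simp: append_rows_def)

lemma dim_append_cols [simp]: "dim_row (append_cols M N) = dim_row M"
  "dim_col (append_cols M N) = dim_col M + dim_col N"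
  by (auto simp: append_cols_def)

lemma dim_append_rows [simp]: "dim_row (M @\<^sub>r N) = dim_row M + dim_row N"
  "dim_col (M @\<^sub>r N) = dim_col M"
  by (auto simp: append_rows_def)

lemma cmat_append_cols: "dim_row M = dim_row N \<Longrightarrow> cmat (append_cols M N) = append_cols (cmat M) (cmat N)"
  by (rule eq_matI) (auto simp: append_cols_def)

lemma cmat_append_rows: "dim_col M = dim_col N \<Longrightarrow> cmat (M @\<^sub>r N) = cmat M @\<^sub>r cmat N"
  by (rule eq_matI) (auto simp: append_rows_def)

lemma cmat_zero: "cmat (0\<^sub>m p q) = 0\<^sub>m p q"
  by (rule eq_matI) auto

lemma smult_append_vec: "k \<cdot>\<^sub>v (a @\<^sub>v b) = k \<cdot>\<^sub>v a @\<^sub>v k \<cdot>\<^sub>v b"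
  by (auto simp: vec_eq_iff)

lemma minus_append_vec:
  "dim_vec a = dim_vec a' \<Longrightarrow> dim_vec b = dim_vec b' \<Longrightarrow>
    (a @\<^sub>v b) - (a' @\<^sub>v b') = (a - a') @\<^sub>v (b - b')"
  by (auto simp: vec_eq_iff)

lemma vec_split:
  assumes "v \<in> carrier_vec (p + q)"
  obtains a b where "a \<in> carrier_vec p" "b \<in> carrier_vec q" "v = a @\<^sub>v b"
  using assms vec_first_last_append[of v p q] that[of "vec_first v p" "vec_last v q"] by auto

text \<open>A left kernel vector is orthogonal to the range, hence to every vector.\<close>

lemma det_nonzero_if_surj:
  fixes M :: "'a :: field mat"
  assumes M: "M \<in> carrier_mat n n"
    and surj: "\<And>b. b \<in> carrier_vec n \<Longrightarrow> \<exists>x \<in> carrier_vec n. M *\<^sub>v x = b"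
  shows "det M \<noteq> 0"
proof
  assume "det M = 0"
  then have "det M\<^sup>T = 0" using det_transpose[OF M] by simp
  then obtain y where y: "y \<in> carrier_vec n" "y \<noteq> 0\<^sub>v n" "M\<^sup>T *\<^sub>v y = 0\<^sub>v n"
    using det_0_iff_vec_prod_zero_field[of "M\<^sup>T" n] M by auto
  have "b \<bullet> y = 0" if b: "b \<in> carrier_vec n" for b
  proof -
    obtain x where x: "x \<in> carrier_vec n" "M *\<^sub>v x = b" using surj[OF b] by blast
    have "y \<bullet> b = (M\<^sup>T *\<^sub>v y) \<bullet> x"
      unfolding x(2)[symmetric] by (rule transpose_mult_scalar_prod(1)[symmetric]) (use M x y in auto)
    then show ?thesis using x y b by (simp add: scalar_prod_commute[of b])
  qed
  then show False using vec_eq_zero_if_orthogonal[OF y(1)] y(2) by blast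
qed

lemma kernel_trivial_if_invertible_mat:
  fixes M :: "'a :: field mat"
  assumes M: "M \<in> carrier_mat n n" and inv: "invertible_mat M"
    and x: "x \<in> carrier_vec n" "M *\<^sub>v x = 0\<^sub>v n"
  shows "x = 0\<^sub>v n"
proof -
  obtain N where N: "inverts_mat M N" "inverts_mat N M" using inv by (auto simp: invertible_mat_def)
  have NM: "N * M = 1\<^sub>m (dim_row N)" and MN: "M * N = 1\<^sub>m n" using N M by (auto simp: inverts_mat_def)
  have "dim_col N = n" using arg_cong[OF MN, of dim_col] by simp
  moreover have "dim_row N = n" using arg_cong[OF NM, of dim_col] M by simp
  ultimately have Nc: "N \<in> carrier_mat n n" by auto
  have "x = (N * M) *\<^sub>v x" unfolding NM using Nc x by simp
  also have "\<dots> = N *\<^sub>v (M *\<^sub>v x)" using Nc M x by simp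
  also have "\<dots> = 0\<^sub>v n" unfolding x(2) using Nc by (simp add: mult_mat_vec_zero)
  finally show ?thesis .
qed

lemma completely_observable_imp_hautus_observable:
  assumes "E \<in> carrier_mat n n" "A \<in> carrier_mat n n" "C \<in> carrier_mat m n"
    and co: "completely_observable n m E A C"
  shows "hautus_observable n m E A C"
  unfolding hautus_observable_def
proof (intro allI impI)
  fix \<alpha> \<beta> :: complex and x :: "complex vec"
  assume ab: "(\<alpha>, \<beta>) \<noteq> (0, 0)" and x: "x \<in> carrier_vec n"
    and 0: "pencil \<alpha> \<beta> E A *\<^sub>v x = 0\<^sub>v n" "cmat C *\<^sub>v x = 0\<^sub>v m"
  have P: "pencil \<alpha> \<beta> E A \<in> carrier_mat n n" and C: "cmat C \<in> carrier_mat m n"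
    using assms by (auto simp: pencil_def)
  let ?M = "pencil \<alpha> \<beta> E A @\<^sub>r cmat C"
  have M: "?M \<in> carrier_mat (n + m) n" using P C by simp
  have "vec_space.rank (n + m) ?M = n"
    using co ab by (auto simp: completely_observable_def block_mat_def append_cols_empty append_rows_empty)
  moreover have "?M *\<^sub>v x = 0\<^sub>v (n + m)"
    unfolding append_rows_mult_vec[OF P C x] 0 by (auto simp: vec_eq_iff)
  ultimately show "x = 0\<^sub>v n"
    using vec_space.kernel_trivial_if_full_column_rank[OF M _ x] by blast
qed

lemma append_cols5_mult_vec:
  fixes M1 :: "'a :: comm_ring_1 mat"
  assumes "M1 \<in> carrier_mat p n1" "M2 \<in> carrier_mat p n2" "M3 \<in> carrier_mat p n3"
    "M4 \<in> carrier_mat p n4" "M5 \<in> carrier_mat p n5"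
    "x1 \<in> carrier_vec n1" "x2 \<in> carrier_vec n2" "x3 \<in> carrier_vec n3" "x4 \<in> carrier_vec n4" "x5 \<in> carrier_vec n5"
  shows "append_cols M1 (append_cols M2 (append_cols M3 (append_cols M4 M5))) *\<^sub>v
      (x1 @\<^sub>v (x2 @\<^sub>v (x3 @\<^sub>v (x4 @\<^sub>v x5)))) =
    M1 *\<^sub>v x1 + (M2 *\<^sub>v x2 + (M3 *\<^sub>v x3 + (M4 *\<^sub>v x4 + M5 *\<^sub>v x5)))"
  using assms
  by (simp add: append_cols_mult_vec[where n = p and p = n1 and q = "n2 + (n3 + (n4 + n5))"]
      append_cols_mult_vec[where n = p and p = n2 and q = "n3 + (n4 + n5)"]
      append_cols_mult_vec[where n = p and p = n3 and q = "n4 + n5"]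
      append_cols_mult_vec[where n = p and p = n4 and q = n5])

lemma append_rows5_mult_vec:
  fixes M1 :: "'a :: comm_ring_1 mat"
  assumes "M1 \<in> carrier_mat n1 p" "M2 \<in> carrier_mat n2 p" "M3 \<in> carrier_mat n3 p"
    "M4 \<in> carrier_mat n4 p" "M5 \<in> carrier_mat n5 p" "x \<in> carrier_vec p"
  shows "(M1 @\<^sub>r M2 @\<^sub>r M3 @\<^sub>r M4 @\<^sub>r M5) *\<^sub>v x =
    M1 *\<^sub>v x @\<^sub>v (M2 *\<^sub>v x @\<^sub>v (M3 *\<^sub>v x @\<^sub>v (M4 *\<^sub>v x @\<^sub>v M5 *\<^sub>v x)))"
  using assms
  by (simp add: append_rows_mult_vec[where n = p and p = n1 and q = "n2 + (n3 + (n4 + n5))"]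
      append_rows_mult_vec[where n = p and p = n2 and q = "n3 + (n4 + n5)"]
      append_rows_mult_vec[where n = p and p = n3 and q = "n4 + n5"]
      append_rows_mult_vec[where n = p and p = n4 and q = n5])

text \<open>The common shape of both transformed matrices, with the distinguished first block as a
  separate argument, so that one computation serves \<open>E\<close> and \<open>A\<close>.\<close>

definition staircase_mat :: "(nat \<Rightarrow> nat) \<Rightarrow> real mat \<Rightarrow> (nat \<Rightarrow> nat \<Rightarrow> real mat) \<Rightarrow> real mat" where
  "staircase_mat d M X = block_mat
          [[M,     0\<^sub>m (d 1) (d 2), 0\<^sub>m (d 1) (d 3), X 1 4, X 1 5],
           [X 2 1, X 2 2, 0\<^sub>m (d 2) (d 3), X 2 4, X 2 5],
           [X 3 1, X 3 2, X 3 3, X 3 4, X 3 5],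
           [0\<^sub>m (d 4) (d 1), 0\<^sub>m (d 4) (d 2), 0\<^sub>m (d 4) (d 3), X 4 4, X 4 5],
           [0\<^sub>m (d 5) (d 1), 0\<^sub>m (d 5) (d 2), 0\<^sub>m (d 5) (d 3), 0\<^sub>m (d 5) (d 4), X 5 5]]"

text \<open>Rows 2 and 3 stay anonymous: they determine the states \<open>x2\<close> and
  \<open>x3\<close>, which enter neither the other rows nor the output.\<close>

lemma staircase_rows:
  fixes X :: "nat \<Rightarrow> nat \<Rightarrow> real mat"
  assumes X: "\<And>i j. i \<in> {1..5} \<Longrightarrow> j \<in> {1..5} \<Longrightarrow> X i j \<in> carrier_mat (d i) (d j)"
    and E: "E1 \<in> carrier_mat (d 1) (d 1)"
    and x: "x1 \<in> carrier_vec (d 1)" "x2 \<in> carrier_vec (d 2)" "x3 \<in> carrier_vec (d 3)"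
      "x4 \<in> carrier_vec (d 4)" "x5 \<in> carrier_vec (d 5)"
  obtains y2 y3 where "y2 \<in> carrier_vec (d 2)" "y3 \<in> carrier_vec (d 3)"
    "cmat (staircase_mat d E1 X) *\<^sub>v
      (x1 @\<^sub>v (x2 @\<^sub>v (x3 @\<^sub>v (x4 @\<^sub>v x5)))) =
     (cmat E1 *\<^sub>v x1 + (cmat (X 1 4) *\<^sub>v x4 + cmat (X 1 5) *\<^sub>v x5)) @\<^sub>v (y2 @\<^sub>v (y3 @\<^sub>v
      ((cmat (X 4 4) *\<^sub>v x4 + cmat (X 4 5) *\<^sub>v x5) @\<^sub>v (cmat (X 5 5) *\<^sub>v x5))))"
proof -
  let ?x = "x1 @\<^sub>v (x2 @\<^sub>v (x3 @\<^sub>v (x4 @\<^sub>v x5)))"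
  let ?p = "d 1 + (d 2 + (d 3 + (d 4 + d 5)))"
  have Xc: "cmat (X i j) \<in> carrier_mat (d i) (d j)" if "i \<in> {1..5}" "j \<in> {1..5}" for i j
    using X[OF that] by simp
  have Ec: "cmat E1 \<in> carrier_mat (d 1) (d 1)" using E by simp
  have xc: "?x \<in> carrier_vec ?p" using x by simp
  define r where "r = (\<lambda>a b c dd e. append_cols a (append_cols b (append_cols c (append_cols dd (e :: complex mat)))))"
  have rc: "r a b c dd e \<in> carrier_mat k ?p"
    if "a \<in> carrier_mat k (d 1)" "b \<in> carrier_mat k (d 2)" "c \<in> carrier_mat k (d 3)" "dd \<in> carrier_mat k (d 4)"
      "e \<in> carrier_mat k (d 5)" for a b c dd e k
    unfolding r_def using that by (intro append_cols_carrier)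
  have rv: "r a b c dd e *\<^sub>v ?x = a *\<^sub>v x1 + (b *\<^sub>v x2 + (c *\<^sub>v x3 + (dd *\<^sub>v x4 + e *\<^sub>v x5)))"
    if "a \<in> carrier_mat k (d 1)" "b \<in> carrier_mat k (d 2)" "c \<in> carrier_mat k (d 3)" "dd \<in> carrier_mat k (d 4)"
      "e \<in> carrier_mat k (d 5)" for a b c dd e k
    unfolding r_def by (rule append_cols5_mult_vec[OF that x])
  have dX: "dim_row (X i j) = d i" "dim_col (X i j) = d j" if "i \<in> {1..5}" "j \<in> {1..5}" for i j
    using X[OF that] by auto
  note c = Xc[of 1 4] Xc[of 1 5] Xc[of 2 1] Xc[of 2 2] Xc[of 2 4] Xc[of 2 5] Xc[of 3 1] Xc[of 3 2] Xc[of 3 3]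
    Xc[of 3 4] Xc[of 3 5] Xc[of 4 4] Xc[of 4 5] Xc[of 5 5]
  define R1 where "R1 = r (cmat E1) (0\<^sub>m (d 1) (d 2)) (0\<^sub>m (d 1) (d 3)) (cmat (X 1 4)) (cmat (X 1 5))"
  define R2 where "R2 = r (cmat (X 2 1)) (cmat (X 2 2)) (0\<^sub>m (d 2) (d 3)) (cmat (X 2 4)) (cmat (X 2 5))"
  define R3 where "R3 = r (cmat (X 3 1)) (cmat (X 3 2)) (cmat (X 3 3)) (cmat (X 3 4)) (cmat (X 3 5))"
  define R4 where "R4 = r (0\<^sub>m (d 4) (d 1)) (0\<^sub>m (d 4) (d 2)) (0\<^sub>m (d 4) (d 3)) (cmat (X 4 4)) (cmat (X 4 5))"
  define R5 where "R5 = r (0\<^sub>m (d 5) (d 1)) (0\<^sub>m (d 5) (d 2)) (0\<^sub>m (d 5) (d 3)) (0\<^sub>m (d 5) (d 4)) (cmat (X 5 5))"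
  have Rc: "R1 \<in> carrier_mat (d 1) ?p" "R2 \<in> carrier_mat (d 2) ?p" "R3 \<in> carrier_mat (d 3) ?p"
    "R4 \<in> carrier_mat (d 4) ?p" "R5 \<in> carrier_mat (d 5) ?p"
    unfolding R1_def R2_def R3_def R4_def R5_def by (rule rc; use c Ec in simp)+
  have v1: "R1 *\<^sub>v ?x = cmat E1 *\<^sub>v x1 + (cmat (X 1 4) *\<^sub>v x4 + cmat (X 1 5) *\<^sub>v x5)"
    unfolding R1_def by (subst rv[where k = "d 1"]) (use c Ec x in \<open>auto simp: zero_mult_mat_vec\<close>)
  have v4: "R4 *\<^sub>v ?x = cmat (X 4 4) *\<^sub>v x4 + cmat (X 4 5) *\<^sub>v x5"
    unfolding R4_def by (subst rv[where k = "d 4"]) (use c Ec x in \<open>auto simp: zero_mult_mat_vec\<close>)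
  have v5: "R5 *\<^sub>v ?x = cmat (X 5 5) *\<^sub>v x5"
    unfolding R5_def by (subst rv[where k = "d 5"]) (use c Ec x in \<open>auto simp: zero_mult_mat_vec\<close>)
  show thesis
  proof (rule that[of "R2 *\<^sub>v ?x" "R3 *\<^sub>v ?x"])
    show "R2 *\<^sub>v ?x \<in> carrier_vec (d 2)" "R3 *\<^sub>v ?x \<in> carrier_vec (d 3)"
      using Rc xc by (auto intro: mult_mat_vec_carrier)
  next
    have "cmat (staircase_mat d E1 X) =
        R1 @\<^sub>r R2 @\<^sub>r R3 @\<^sub>r R4 @\<^sub>r R5"
      unfolding R1_def R2_def R3_def R4_def R5_def r_def
      using E
      by (simp add: dX staircase_mat_def block_mat_def append_cols_empty append_rows_empty cmat_append_cols cmat_append_rows cmat_zero)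
    then show "cmat (staircase_mat d E1 X) *\<^sub>v ?x =
     (cmat E1 *\<^sub>v x1 + (cmat (X 1 4) *\<^sub>v x4 + cmat (X 1 5) *\<^sub>v x5)) @\<^sub>v (R2 *\<^sub>v ?x @\<^sub>v (R3 *\<^sub>v ?x @\<^sub>v
      ((cmat (X 4 4) *\<^sub>v x4 + cmat (X 4 5) *\<^sub>v x5) @\<^sub>v (cmat (X 5 5) *\<^sub>v x5))))"
      using append_rows5_mult_vec[OF Rc xc] unfolding v1 v4 v5 by simp
  qed
qed

section \<open>Reduction of a staircase form to its first block\<close>

lemma cmat_mult: "A \<in> carrier_mat p q \<Longrightarrow> B \<in> carrier_mat q r \<Longrightarrow> cmat (A * B) = cmat A * cmat B"
  by (rule of_real_hom.mat_hom_mult)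

lemma cmat_one: "cmat (1\<^sub>m n) = 1\<^sub>m n"
  by (rule eq_matI) auto

lemma pencil_carrier_mat:
  "X \<in> carrier_mat p q \<Longrightarrow> Y \<in> carrier_mat p q \<Longrightarrow> pencil \<alpha> \<beta> X Y \<in> carrier_mat p q"
  by (auto simp: pencil_def)

lemma pencil_mult_vec':
  assumes "X \<in> carrier_mat p q" "Y \<in> carrier_mat p q" "x \<in> carrier_vec q"
  shows "pencil s 1 X Y *\<^sub>v x = s \<cdot>\<^sub>v (cmat X *\<^sub>v x) - cmat Y *\<^sub>v x"
  using assms by (auto simp: pencil_def minus_mult_mat_vec smult_mult_mat_vec)

text \<open>The first block row is zero between its pencil and its input block. A left kernel vector
  of those two, padded by zeros, is therefore a left kernel vector of the whole matrix, which has
  full row rank.\<close>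

lemma hautus_controllable_if_staircase_rank:
  fixes X Y :: "nat \<Rightarrow> nat \<Rightarrow> real mat"
  assumes c: "E1 \<in> carrier_mat n1 n1" "A1 \<in> carrier_mat n1 n1" "B1 \<in> carrier_mat n1 m"
    "B2 \<in> carrier_mat n2 m" "B3 \<in> carrier_mat n3 m"
    "X21 \<in> carrier_mat n2 n1" "Y21 \<in> carrier_mat n2 n1" "X22 \<in> carrier_mat n2 n2" "Y22 \<in> carrier_mat n2 n2"
    "X31 \<in> carrier_mat n3 n1" "Y31 \<in> carrier_mat n3 n1" "X32 \<in> carrier_mat n3 n2" "Y32 \<in> carrier_mat n3 n2"
    "X33 \<in> carrier_mat n3 n3" "Y33 \<in> carrier_mat n3 n3"
    and rank: "\<And>\<alpha> \<beta>. (\<alpha>, \<beta>) \<noteq> (0, 0) \<Longrightarrow> vec_space.rank (n1 + n2 + n3) (block_mat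
             [[pencil \<alpha> \<beta> E1 A1, 0\<^sub>m n1 n2, 0\<^sub>m n1 n3, cmat B1],
              [pencil \<alpha> \<beta> X21 Y21, pencil \<alpha> \<beta> X22 Y22, 0\<^sub>m n2 n3, cmat B2],
              [pencil \<alpha> \<beta> X31 Y31, pencil \<alpha> \<beta> X32 Y32, pencil \<alpha> \<beta> X33 Y33, cmat B3]]) = n1 + n2 + n3"
  shows "hautus_controllable n1 m E1 A1 B1"
  unfolding hautus_controllable_def
proof (intro allI impI)
  fix \<alpha> \<beta> :: complex and y :: "complex vec"
  assume ab: "(\<alpha>, \<beta>) \<noteq> (0, 0)" and y: "y \<in> carrier_vec n1"
    and 0: "(pencil \<alpha> \<beta> E1 A1)\<^sup>T *\<^sub>v y = 0\<^sub>v n1" "(cmat B1)\<^sup>T *\<^sub>v y = 0\<^sub>v m"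
  let ?q = "n1 + (n2 + (n3 + m))"
  define R1 where "R1 = append_cols (pencil \<alpha> \<beta> E1 A1) (append_cols (0\<^sub>m n1 n2) (append_cols (0\<^sub>m n1 n3) (cmat B1)))"
  define R2 where "R2 = append_cols (pencil \<alpha> \<beta> X21 Y21) (append_cols (pencil \<alpha> \<beta> X22 Y22) (append_cols (0\<^sub>m n2 n3) (cmat B2)))"
  define R3 where "R3 = append_cols (pencil \<alpha> \<beta> X31 Y31) (append_cols (pencil \<alpha> \<beta> X32 Y32) (append_cols (pencil \<alpha> \<beta> X33 Y33) (cmat B3)))"
  have cB: "cmat B1 \<in> carrier_mat n1 m" "cmat B2 \<in> carrier_mat n2 m" "cmat B3 \<in> carrier_mat n3 m"
    using c by simp_all
  have cP: "pencil \<alpha> \<beta> E1 A1 \<in> carrier_mat n1 n1"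
    "pencil \<alpha> \<beta> X21 Y21 \<in> carrier_mat n2 n1" "pencil \<alpha> \<beta> X22 Y22 \<in> carrier_mat n2 n2"
    "pencil \<alpha> \<beta> X31 Y31 \<in> carrier_mat n3 n1" "pencil \<alpha> \<beta> X32 Y32 \<in> carrier_mat n3 n2"
    "pencil \<alpha> \<beta> X33 Y33 \<in> carrier_mat n3 n3"
    using c by (auto intro: pencil_carrier_mat)
  have R: "R1 \<in> carrier_mat n1 ?q" "R2 \<in> carrier_mat n2 ?q" "R3 \<in> carrier_mat n3 ?q"
    unfolding R1_def R2_def R3_def by (intro append_cols_carrier cB cP zero_carrier_mat)+
  define M where "M = R1 @\<^sub>r R2 @\<^sub>r R3"
  have R23: "R2 @\<^sub>r R3 \<in> carrier_mat (n2 + n3) ?q" using R by simp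
  have M: "M \<in> carrier_mat (n1 + (n2 + n3)) ?q" unfolding M_def using R(1) R23 by (rule carrier_append_rows)
  have "vec_space.rank (n1 + (n2 + n3)) M = n1 + (n2 + n3)"
    using rank[OF ab] unfolding M_def R1_def R2_def R3_def
    by (simp add: block_mat_def append_cols_empty append_rows_empty add.assoc)
  moreover have "M\<^sup>T *\<^sub>v (y @\<^sub>v 0\<^sub>v (n2 + n3)) = 0\<^sub>v ?q"
  proof -
    have "M\<^sup>T *\<^sub>v (y @\<^sub>v 0\<^sub>v (n2 + n3)) = R1\<^sup>T *\<^sub>v y + (R2 @\<^sub>r R3)\<^sup>T *\<^sub>v 0\<^sub>v (n2 + n3)"
      unfolding M_def by (rule append_rows_transpose_mult_vec[OF R(1) R23 y]) simp
    also have "R1\<^sup>T *\<^sub>v y = 0\<^sub>v n1 @\<^sub>v (0\<^sub>v n2 @\<^sub>v (0\<^sub>v n3 @\<^sub>v 0\<^sub>v m))"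
    proof -
      have Z: "(0\<^sub>m n1 n2 :: complex mat) \<in> carrier_mat n1 n2" "(0\<^sub>m n1 n3 :: complex mat) \<in> carrier_mat n1 n3" by auto
      have t: "(0\<^sub>m n1 k :: complex mat)\<^sup>T *\<^sub>v y = 0\<^sub>v k" for k
        using y by (simp add: zero_mult_mat_vec)
      show ?thesis unfolding R1_def
        append_cols_transpose_mult_vec[OF cP(1) append_cols_carrier[OF Z(1) append_cols_carrier[OF Z(2) cB(1)]] y]
        append_cols_transpose_mult_vec[OF Z(1) append_cols_carrier[OF Z(2) cB(1)] y]
        append_cols_transpose_mult_vec[OF Z(2) cB(1) y] t 0 ..
    qed
    also have "(R2 @\<^sub>r R3)\<^sup>T *\<^sub>v 0\<^sub>v (n2 + n3) = 0\<^sub>v ?q"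
      using carrier_matD[OF R23] by (simp add: mult_mat_vec_zero del: dim_append_rows)
    also have "(0\<^sub>v n1 @\<^sub>v (0\<^sub>v n2 @\<^sub>v (0\<^sub>v n3 @\<^sub>v 0\<^sub>v m))) + 0\<^sub>v ?q = (0\<^sub>v ?q :: complex vec)"
      by (auto simp: vec_eq_iff)
    finally show ?thesis .
  qed
  moreover have "y @\<^sub>v 0\<^sub>v (n2 + n3) \<in> carrier_vec (n1 + (n2 + n3))" using y by simp
  ultimately have "y @\<^sub>v 0\<^sub>v (n2 + n3) = 0\<^sub>v (n1 + (n2 + n3))"
    using vec_space.left_kernel_trivial_if_full_row_rank[OF M] by blast
  then show "y = 0\<^sub>v n1" using append_vec_eq_zero_iff[OF y] by blast
qed

text \<open>Back substitution. The input does not enter rows 4 and 5, so nonsingularity of the last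
  block gives \<open>x5 = 0\<close>, then row 4 gives \<open>x4 = 0\<close>, and the first row
  becomes the reduced system, whose output is the full output.\<close>

lemma staircase_form_reduction:
  assumes sys: "descriptor_system n m E A B C D" and reg: "regular E A"
    and sf: "staircase_form n m E A B C d U V E1 A1 B1 C1"
  shows "descriptor_system (d 1) m E1 A1 B1 C1 D" "regular E1 A1"
    "transfer E A B C D = transfer E1 A1 B1 C1 D"
    "hautus_controllable (d 1) m E1 A1 B1" "completely_observable (d 1) m E1 A1 C1"
proof -
  interpret descriptor n m E A B C D by unfold_locales (rule sys)
  obtain X Y B2 B3 C4 C5 where n: "n = d 1 + d 2 + d 3 + d 4 + d 5"
    and UV: "U \<in> carrier_mat n n" "U\<^sup>T * U = 1\<^sub>m n" "V \<in> carrier_mat n n" "V\<^sup>T * V = 1\<^sub>m n"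
    and c1: "E1 \<in> carrier_mat (d 1) (d 1)" "A1 \<in> carrier_mat (d 1) (d 1)"
      "B1 \<in> carrier_mat (d 1) m" "C1 \<in> carrier_mat m (d 1)"
    and XY: "\<forall>i \<in> {1..5}. \<forall>j \<in> {1..5}.
      X i j \<in> carrier_mat (d i) (d j) \<and> Y i j \<in> carrier_mat (d i) (d j)"
    and BC: "B2 \<in> carrier_mat (d 2) m" "B3 \<in> carrier_mat (d 3) m"
      "C4 \<in> carrier_mat m (d 4)" "C5 \<in> carrier_mat m (d 5)"
    and UEV: "U * E * V = staircase_mat d E1 X"
    and UAV: "U * A * V = staircase_mat d A1 Y"
    and UB: "U * B = block_mat [[B1], [B2], [B3], [0\<^sub>m (d 4) m], [0\<^sub>m (d 5) m]]"
    and CV: "C * V = block_mat [[C1, 0\<^sub>m m (d 2), 0\<^sub>m m (d 3), C4, C5]]"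
    and inv5: "\<forall>s. invertible_mat (pencil s 1 (X 5 5) (Y 5 5))"
    and rank: "\<forall>\<alpha> \<beta>. (\<alpha>, \<beta>) \<noteq> (0, 0) \<longrightarrow> vec_space.rank (d 1 + d 2 + d 3) (block_mat
             [[pencil \<alpha> \<beta> E1 A1, 0\<^sub>m (d 1) (d 2), 0\<^sub>m (d 1) (d 3), cmat B1],
              [pencil \<alpha> \<beta> (X 2 1) (Y 2 1), pencil \<alpha> \<beta> (X 2 2) (Y 2 2), 0\<^sub>m (d 2) (d 3), cmat B2],
              [pencil \<alpha> \<beta> (X 3 1) (Y 3 1), pencil \<alpha> \<beta> (X 3 2) (Y 3 2), pencil \<alpha> \<beta> (X 3 3) (Y 3 3), cmat B3]])
              = d 1 + d 2 + d 3"
    and co: "completely_observable (d 1) m E1 A1 C1"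
    using sf unfolding staircase_form_def Let_def by (elim conjE exE) (rule that[unfolded staircase_mat_def], assumption+)
  have X: "X i j \<in> carrier_mat (d i) (d j)" and Y: "Y i j \<in> carrier_mat (d i) (d j)"
    if "i \<in> {1..5}" "j \<in> {1..5}" for i j
    using XY that by blast+
  show "completely_observable (d 1) m E1 A1 C1" by (rule co)
  show sys1: "descriptor_system (d 1) m E1 A1 B1 C1 D"
    using c1 carriers by (simp add: descriptor_system_def)
  interpret r: descriptor "d 1" m E1 A1 B1 C1 D by unfold_locales (rule sys1)
  show "hautus_controllable (d 1) m E1 A1 B1"
    by (rule hautus_controllable_if_staircase_rank[OF c1(1-3) BC(1,2) _ _ _ _ _ _ _ _ _ _ rank[rule_format]])
       (auto intro: X Y)
  have n': "n = d 1 + (d 2 + (d 3 + (d 4 + d 5)))" using n by simp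
  have UUT: "U * U\<^sup>T = 1\<^sub>m n" and VVT: "V * V\<^sup>T = 1\<^sub>m n"
    using mat_mult_left_right_inverse[of "U\<^sup>T" n U] mat_mult_left_right_inverse[of "V\<^sup>T" n V] UV by auto
  have Uc: "cmat U \<in> carrier_mat n n" "cmat (U\<^sup>T) \<in> carrier_mat n n"
    "cmat V \<in> carrier_mat n n" "cmat (V\<^sup>T) \<in> carrier_mat n n" using UV by auto
  have [simp]: "dim_row U = n" "dim_col U = n" "dim_row V = n" "dim_col V = n" using UV by auto
  have orth: "cmat U *\<^sub>v (cmat (U\<^sup>T) *\<^sub>v v) = v" "cmat V *\<^sub>v (cmat (V\<^sup>T) *\<^sub>v v) = v"
    if v: "v \<in> carrier_vec n" for v
  proof -
    have "cmat U * cmat (U\<^sup>T) = 1\<^sub>m n" using cmat_mult[of U n n "U\<^sup>T" n] UV UUT cmat_one by simp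
    then show "cmat U *\<^sub>v (cmat (U\<^sup>T) *\<^sub>v v) = v"
      using v mult_mult_mat_vec[of "cmat U" "cmat (U\<^sup>T)" v] by simp
    have "cmat V * cmat (V\<^sup>T) = 1\<^sub>m n" using cmat_mult[of V n n "V\<^sup>T" n] UV VVT cmat_one by simp
    then show "cmat V *\<^sub>v (cmat (V\<^sup>T) *\<^sub>v v) = v"
      using v mult_mult_mat_vec[of "cmat V" "cmat (V\<^sup>T)" v] by simp
  qed
  let ?p = "\<lambda>s i j. pencil s 1 (X i j) (Y i j)"
  have pc: "?p s i j \<in> carrier_mat (d i) (d j)" if "i \<in> {1..5}" "j \<in> {1..5}" for s i j
    using X[OF that] Y[OF that] by (rule pencil_carrier_mat)
  have p11: "pencil s 1 E1 A1 \<in> carrier_mat (d 1) (d 1)" for s by (rule r.pencil_carrier)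
  have UMV: "cmat (U * M * V) *\<^sub>v x = cmat U *\<^sub>v (cmat M *\<^sub>v (cmat V *\<^sub>v x))"
    if "M \<in> carrier_mat n n" "x \<in> carrier_vec n" for M x
    using that UV cmat_mult[of "U * M" n n V n] cmat_mult[of U n n M n]
    by (simp add: mult_mult_mat_vec)
  have rows: "pencil s 1 E1 A1 *\<^sub>v x1 + (?p s 1 4 *\<^sub>v x4 + ?p s 1 5 *\<^sub>v x5) = b1 \<and>
      ?p s 4 4 *\<^sub>v x4 + ?p s 4 5 *\<^sub>v x5 = b4 \<and> ?p s 5 5 *\<^sub>v x5 = b5"
    if x: "x1 \<in> carrier_vec (d 1)" "x2 \<in> carrier_vec (d 2)" "x3 \<in> carrier_vec (d 3)"
      "x4 \<in> carrier_vec (d 4)" "x5 \<in> carrier_vec (d 5)"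
    and b: "b1 \<in> carrier_vec (d 1)" "b2 \<in> carrier_vec (d 2)" "b3 \<in> carrier_vec (d 3)"
      "b4 \<in> carrier_vec (d 4)" "b5 \<in> carrier_vec (d 5)"
    and eq: "cmat U *\<^sub>v (pencil s 1 E A *\<^sub>v (cmat V *\<^sub>v (x1 @\<^sub>v (x2 @\<^sub>v (x3 @\<^sub>v (x4 @\<^sub>v x5)))))) =
      b1 @\<^sub>v (b2 @\<^sub>v (b3 @\<^sub>v (b4 @\<^sub>v b5)))"
    for s x1 x2 x3 x4 x5 b1 b2 b3 b4 b5
  proof -
    let ?x = "x1 @\<^sub>v (x2 @\<^sub>v (x3 @\<^sub>v (x4 @\<^sub>v x5)))"
    have xc: "?x \<in> carrier_vec n" unfolding n' using x by simp
    obtain y2 y3 where y: "y2 \<in> carrier_vec (d 2)" "y3 \<in> carrier_vec (d 3)"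
      "cmat (U * E * V) *\<^sub>v ?x = (cmat E1 *\<^sub>v x1 + (cmat (X 1 4) *\<^sub>v x4 + cmat (X 1 5) *\<^sub>v x5)) @\<^sub>v (y2 @\<^sub>v (y3 @\<^sub>v
        ((cmat (X 4 4) *\<^sub>v x4 + cmat (X 4 5) *\<^sub>v x5) @\<^sub>v (cmat (X 5 5) *\<^sub>v x5))))"
      unfolding UEV using staircase_rows[of X d E1, OF X c1(1) x] by blast
    obtain z2 z3 where z: "z2 \<in> carrier_vec (d 2)" "z3 \<in> carrier_vec (d 3)"
      "cmat (U * A * V) *\<^sub>v ?x = (cmat A1 *\<^sub>v x1 + (cmat (Y 1 4) *\<^sub>v x4 + cmat (Y 1 5) *\<^sub>v x5)) @\<^sub>v (z2 @\<^sub>v (z3 @\<^sub>v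
        ((cmat (Y 4 4) *\<^sub>v x4 + cmat (Y 4 5) *\<^sub>v x5) @\<^sub>v (cmat (Y 5 5) *\<^sub>v x5))))"
      unfolding UAV using staircase_rows[of Y d A1, OF Y c1(2) x] by blast
    have dX: "dim_row (X i j) = d i" "dim_col (X i j) = d j" "dim_row (Y i j) = d i" "dim_col (Y i j) = d j"
      if "i \<in> {1..5}" "j \<in> {1..5}" for i j
      using X[OF that] Y[OF that] by auto
    have "cmat U *\<^sub>v (pencil s 1 E A *\<^sub>v (cmat V *\<^sub>v ?x)) =
        s \<cdot>\<^sub>v (cmat (U * E * V) *\<^sub>v ?x) - cmat (U * A * V) *\<^sub>v ?x"
    proof -
      have "dim_vec (cmat V *\<^sub>v ?x) = n" by simp
      then show ?thesis
        unfolding UMV[OF carriers(1) xc] UMV[OF carriers(2) xc] pencil_mult_vec[OF \<open>dim_vec (cmat V *\<^sub>v ?x) = n\<close>]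
        by (simp add: mult_mat_vec_minus mult_mat_vec_smult)
    qed
    also have "\<dots> = (pencil s 1 E1 A1 *\<^sub>v x1 + (?p s 1 4 *\<^sub>v x4 + ?p s 1 5 *\<^sub>v x5)) @\<^sub>v
        ((s \<cdot>\<^sub>v y2 - z2) @\<^sub>v ((s \<cdot>\<^sub>v y3 - z3) @\<^sub>v
        ((?p s 4 4 *\<^sub>v x4 + ?p s 4 5 *\<^sub>v x5) @\<^sub>v (?p s 5 5 *\<^sub>v x5))))"
    proof -
      have dx: "dim_vec x1 = d 1" "dim_vec x4 = d 4" "dim_vec x5 = d 5" "dim_vec y2 = d 2" "dim_vec y3 = d 3"
        "dim_vec z2 = d 2" "dim_vec z3 = d 3" using x y z by auto
      have pm: "?p s i j *\<^sub>v v = s \<cdot>\<^sub>v (cmat (X i j) *\<^sub>v v) - cmat (Y i j) *\<^sub>v v"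
        if "i \<in> {1..5}" "j \<in> {1..5}" "v \<in> carrier_vec (d j)" for i j v
        by (rule pencil_mult_vec'[OF X Y]) (use that in auto)
      have p14: "?p s 1 4 *\<^sub>v x4 = s \<cdot>\<^sub>v (cmat (X 1 4) *\<^sub>v x4) - cmat (Y 1 4) *\<^sub>v x4"
        and p15: "?p s 1 5 *\<^sub>v x5 = s \<cdot>\<^sub>v (cmat (X 1 5) *\<^sub>v x5) - cmat (Y 1 5) *\<^sub>v x5"
        and p44: "?p s 4 4 *\<^sub>v x4 = s \<cdot>\<^sub>v (cmat (X 4 4) *\<^sub>v x4) - cmat (Y 4 4) *\<^sub>v x4"
        and p45: "?p s 4 5 *\<^sub>v x5 = s \<cdot>\<^sub>v (cmat (X 4 5) *\<^sub>v x5) - cmat (Y 4 5) *\<^sub>v x5"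
        and p55: "?p s 5 5 *\<^sub>v x5 = s \<cdot>\<^sub>v (cmat (X 5 5) *\<^sub>v x5) - cmat (Y 5 5) *\<^sub>v x5"
        by (rule pm; use x in simp)+
      have e: "s \<cdot>\<^sub>v (cmat E1 *\<^sub>v x1 + (cmat (X 1 4) *\<^sub>v x4 + cmat (X 1 5) *\<^sub>v x5)) -
          (cmat A1 *\<^sub>v x1 + (cmat (Y 1 4) *\<^sub>v x4 + cmat (Y 1 5) *\<^sub>v x5)) =
          pencil s 1 E1 A1 *\<^sub>v x1 + (?p s 1 4 *\<^sub>v x4 + ?p s 1 5 *\<^sub>v x5)"
        unfolding pencil_mult_vec'[OF c1(1,2) x(1)] p14 p15
        by (auto simp: vec_eq_iff dX dx algebra_simps simp del: index_mult_mat_vec)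
      have e4: "s \<cdot>\<^sub>v (cmat (X 4 4) *\<^sub>v x4 + cmat (X 4 5) *\<^sub>v x5) - (cmat (Y 4 4) *\<^sub>v x4 + cmat (Y 4 5) *\<^sub>v x5) =
          ?p s 4 4 *\<^sub>v x4 + ?p s 4 5 *\<^sub>v x5"
        unfolding p44 p45
        by (auto simp: vec_eq_iff dX dx algebra_simps simp del: index_mult_mat_vec)
      have e5: "s \<cdot>\<^sub>v (cmat (X 5 5) *\<^sub>v x5) - cmat (Y 5 5) *\<^sub>v x5 = ?p s 5 5 *\<^sub>v x5"
        by (rule p55[symmetric])
      show ?thesis unfolding y(3) z(3) e[symmetric] e4[symmetric] e5[symmetric]
        by (simp add: smult_append_vec minus_append_vec dX dx)
    qed
    finally have main: "(pencil s 1 E1 A1 *\<^sub>v x1 + (?p s 1 4 *\<^sub>v x4 + ?p s 1 5 *\<^sub>v x5)) @\<^sub>v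
        ((s \<cdot>\<^sub>v y2 - z2) @\<^sub>v ((s \<cdot>\<^sub>v y3 - z3) @\<^sub>v
        ((?p s 4 4 *\<^sub>v x4 + ?p s 4 5 *\<^sub>v x5) @\<^sub>v (?p s 5 5 *\<^sub>v x5)))) =
        b1 @\<^sub>v (b2 @\<^sub>v (b3 @\<^sub>v (b4 @\<^sub>v b5)))" using eq by simp
    have c: "pencil s 1 E1 A1 *\<^sub>v x1 + (?p s 1 4 *\<^sub>v x4 + ?p s 1 5 *\<^sub>v x5) \<in> carrier_vec (d 1)"
      "s \<cdot>\<^sub>v y2 - z2 \<in> carrier_vec (d 2)" "s \<cdot>\<^sub>v y3 - z3 \<in> carrier_vec (d 3)"
      "?p s 4 4 *\<^sub>v x4 + ?p s 4 5 *\<^sub>v x5 \<in> carrier_vec (d 4)"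
      by (rule carrier_vecI; use y z in \<open>simp add: pencil_def dX\<close>)+
    show ?thesis using main
      unfolding append_vec_eq[OF c(1) b(1)] append_vec_eq[OF c(2) b(2)] append_vec_eq[OF c(3) b(3)]
        append_vec_eq[OF c(4) b(4)] by blast
  qed
  have x5_0: "x5 = 0\<^sub>v (d 5)" if "x5 \<in> carrier_vec (d 5)" "?p s 5 5 *\<^sub>v x5 = 0\<^sub>v (d 5)" for s x5
    by (rule kernel_trivial_if_invertible_mat[OF pc inv5[rule_format] that]) auto
  have p0: "?p s i 5 *\<^sub>v 0\<^sub>v (d 5) = 0\<^sub>v (d i)" "?p s i 4 *\<^sub>v 0\<^sub>v (d 4) = 0\<^sub>v (d i)" if "i \<in> {1..5}" for s i
    using pc[OF that, of 5 s] pc[OF that, of 4 s] by (auto simp: mult_mat_vec_zero)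
  have split5: thesis if v: "v \<in> carrier_vec n"
    and ex: "\<And>x1 x2 x3 x4 x5. x1 \<in> carrier_vec (d 1) \<Longrightarrow> x2 \<in> carrier_vec (d 2) \<Longrightarrow> x3 \<in> carrier_vec (d 3) \<Longrightarrow>
      x4 \<in> carrier_vec (d 4) \<Longrightarrow> x5 \<in> carrier_vec (d 5) \<Longrightarrow> v = x1 @\<^sub>v (x2 @\<^sub>v (x3 @\<^sub>v (x4 @\<^sub>v x5))) \<Longrightarrow> thesis"
    for v :: "complex vec" and thesis
    using v unfolding n' by (elim vec_split) (use ex in blast)
  have reduced: "det (pencil s 1 E1 A1) \<noteq> 0 \<and>
      (\<forall>u \<in> carrier_vec m. \<exists>x \<in> carrier_vec n. \<exists>x' \<in> carrier_vec (d 1).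
        pencil s 1 E A *\<^sub>v x = cmat B *\<^sub>v u \<and> pencil s 1 E1 A1 *\<^sub>v x' = cmat B1 *\<^sub>v u \<and>
        cmat C *\<^sub>v x + cmat D *\<^sub>v u = cmat C1 *\<^sub>v x' + cmat D *\<^sub>v u)"
    if det: "det (pencil s 1 E A) \<noteq> 0" for s
  proof -
    obtain P where P: "P \<in> carrier_mat n n" "pencil s 1 E A * P = 1\<^sub>m n"
      using inverse_mat_exists[OF pencil_carrier det] by metis
    \<comment> \<open>The full pencil is solved for right-hand sides supported in blocks 1 and 4;
      rows 1, 4 and 5 of the solution are kept.\<close>
    have solve: "\<exists>x1 x4 x5. x1 \<in> carrier_vec (d 1) \<and> x4 \<in> carrier_vec (d 4) \<and> x5 \<in> carrier_vec (d 5) \<and>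
      pencil s 1 E1 A1 *\<^sub>v x1 + (?p s 1 4 *\<^sub>v x4 + ?p s 1 5 *\<^sub>v x5) = b1 \<and>
      ?p s 4 4 *\<^sub>v x4 + ?p s 4 5 *\<^sub>v x5 = b4 \<and> ?p s 5 5 *\<^sub>v x5 = 0\<^sub>v (d 5)"
      if b: "b1 \<in> carrier_vec (d 1)" "b4 \<in> carrier_vec (d 4)" for b1 b4
    proof -
      let ?b = "b1 @\<^sub>v (0\<^sub>v (d 2) @\<^sub>v (0\<^sub>v (d 3) @\<^sub>v (b4 @\<^sub>v 0\<^sub>v (d 5))))"
      have bc: "?b \<in> carrier_vec n" unfolding n' using b by simp
      define x where "x = P *\<^sub>v (cmat (U\<^sup>T) *\<^sub>v ?b)"
      have x: "x \<in> carrier_vec n" using P by (auto simp: x_def intro: carrier_vecI)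
      have UTb: "cmat (U\<^sup>T) *\<^sub>v ?b \<in> carrier_vec n" by (rule carrier_vecI) simp
      have "pencil s 1 E A *\<^sub>v x = (pencil s 1 E A * P) *\<^sub>v (cmat (U\<^sup>T) *\<^sub>v ?b)"
        unfolding x_def using P(1) by (intro mult_mult_mat_vec[symmetric]) auto
      then have Px: "pencil s 1 E A *\<^sub>v x = cmat (U\<^sup>T) *\<^sub>v ?b" unfolding P(2) using UTb by simp
      have VTx: "cmat (V\<^sup>T) *\<^sub>v x \<in> carrier_vec n" by (rule carrier_vecI) simp
      have eqb: "cmat U *\<^sub>v (pencil s 1 E A *\<^sub>v (cmat V *\<^sub>v (cmat (V\<^sup>T) *\<^sub>v x))) = ?b"
        unfolding orth(2)[OF x] Px orth(1)[OF bc] ..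
      show ?thesis
      proof (rule split5[OF VTx])
        fix x1 x2 x3 x4 x5
        assume xs: "x1 \<in> carrier_vec (d 1)" "x2 \<in> carrier_vec (d 2)" "x3 \<in> carrier_vec (d 3)"
          "x4 \<in> carrier_vec (d 4)" "x5 \<in> carrier_vec (d 5)"
          and dec: "cmat (V\<^sup>T) *\<^sub>v x = x1 @\<^sub>v (x2 @\<^sub>v (x3 @\<^sub>v (x4 @\<^sub>v x5)))"
        from rows[OF xs b(1) zero_carrier_vec zero_carrier_vec b(2) zero_carrier_vec eqb[unfolded dec]]
        show ?thesis using xs(1,4,5) by blast
      qed
    qed
    \<comment> \<open>Only the leading coefficient of this block is given as nonsingular, which does
      not settle a particular \<open>s\<close>. Surjectivity at \<open>s\<close> is inherited from
      the full pencil, because \<open>x5\<close> must vanish.\<close>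
    have det4: "det (?p s 4 4) \<noteq> 0"
    proof (rule det_nonzero_if_surj[OF pc])
      fix b4 :: "complex vec" assume b4: "b4 \<in> carrier_vec (d 4)"
      obtain x4 x5 where x: "x4 \<in> carrier_vec (d 4)" "x5 \<in> carrier_vec (d 5)"
        "?p s 4 4 *\<^sub>v x4 + ?p s 4 5 *\<^sub>v x5 = b4" "?p s 5 5 *\<^sub>v x5 = 0\<^sub>v (d 5)"
        using solve[OF zero_carrier_vec b4] by blast
      have "?p s 4 4 *\<^sub>v x4 \<in> carrier_vec (d 4)" using pc[of 4 4 s] x by simp
      then have "?p s 4 4 *\<^sub>v x4 = b4" using x(3) unfolding x5_0[OF x(2,4)] by (simp add: p0)
      then show "\<exists>x \<in> carrier_vec (d 4). ?p s 4 4 *\<^sub>v x = b4" using x by blast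
    qed auto
    have x4_0: "x4 = 0\<^sub>v (d 4)" if "x4 \<in> carrier_vec (d 4)" "?p s 4 4 *\<^sub>v x4 = 0\<^sub>v (d 4)" for x4
      using det_0_iff_vec_prod_zero_field[OF pc[of 4 4 s]] det4 that by auto
    have first: "pencil s 1 E1 A1 *\<^sub>v x1 = b1 \<and> x4 = 0\<^sub>v (d 4) \<and> x5 = 0\<^sub>v (d 5)"
      if x: "x1 \<in> carrier_vec (d 1)" "x4 \<in> carrier_vec (d 4)" "x5 \<in> carrier_vec (d 5)"
      and eq: "pencil s 1 E1 A1 *\<^sub>v x1 + (?p s 1 4 *\<^sub>v x4 + ?p s 1 5 *\<^sub>v x5) = b1"
        "?p s 4 4 *\<^sub>v x4 + ?p s 4 5 *\<^sub>v x5 = 0\<^sub>v (d 4)" "?p s 5 5 *\<^sub>v x5 = 0\<^sub>v (d 5)" for x1 x4 x5 b1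
    proof -
      have x5: "x5 = 0\<^sub>v (d 5)" by (rule x5_0[OF x(3) eq(3)])
      have p4c: "?p s 4 4 *\<^sub>v x4 \<in> carrier_vec (d 4)" using pc[of 4 4 s] x by simp
      have "?p s 4 5 *\<^sub>v x5 = 0\<^sub>v (d 4)" unfolding x5 by (rule p0) simp
      then have "?p s 4 4 *\<^sub>v x4 = 0\<^sub>v (d 4)" using eq(2) right_zero_vec[OF p4c] by simp
      then have x4: "x4 = 0\<^sub>v (d 4)" by (rule x4_0[OF x(2)])
      have p1c: "pencil s 1 E1 A1 *\<^sub>v x1 \<in> carrier_vec (d 1)" by (rule mult_mat_vec_carrier[OF p11 x(1)])
      have "?p s 1 4 *\<^sub>v x4 = 0\<^sub>v (d 1)" "?p s 1 5 *\<^sub>v x5 = 0\<^sub>v (d 1)"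
        unfolding x4 x5 by (rule p0; simp)+
      then have "pencil s 1 E1 A1 *\<^sub>v x1 + (0\<^sub>v (d 1) + 0\<^sub>v (d 1)) = b1" using eq(1) by simp
      moreover have "pencil s 1 E1 A1 *\<^sub>v x1 + (0\<^sub>v (d 1) + 0\<^sub>v (d 1)) = pencil s 1 E1 A1 *\<^sub>v x1"
        using p1c by (auto simp: vec_eq_iff simp del: index_mult_mat_vec)
      ultimately show ?thesis using x4 x5 by simp
    qed
    have "det (pencil s 1 E1 A1) \<noteq> 0"
    proof (rule det_nonzero_if_surj[OF p11])
      fix b1 :: "complex vec" assume b1: "b1 \<in> carrier_vec (d 1)"
      show "\<exists>x \<in> carrier_vec (d 1). pencil s 1 E1 A1 *\<^sub>v x = b1"
        using solve[OF b1 zero_carrier_vec] first by blast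
    qed
    moreover have "\<exists>x \<in> carrier_vec n. \<exists>x' \<in> carrier_vec (d 1).
        pencil s 1 E A *\<^sub>v x = cmat B *\<^sub>v u \<and> pencil s 1 E1 A1 *\<^sub>v x' = cmat B1 *\<^sub>v u \<and>
        cmat C *\<^sub>v x + cmat D *\<^sub>v u = cmat C1 *\<^sub>v x' + cmat D *\<^sub>v u"
      if u: "u \<in> carrier_vec m" for u
    proof -
      obtain x where x: "x \<in> carrier_vec n" "pencil s 1 E A *\<^sub>v x = cmat B *\<^sub>v u"
        using pencil_solution[OF det u] .
      have VTx: "cmat (V\<^sup>T) *\<^sub>v x \<in> carrier_vec n" by (rule carrier_vecI) simp
      show ?thesis
      proof (rule split5[OF VTx])
        fix x1 x2 x3 x4 x5
        assume xs: "x1 \<in> carrier_vec (d 1)" "x2 \<in> carrier_vec (d 2)" "x3 \<in> carrier_vec (d 3)"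
          "x4 \<in> carrier_vec (d 4)" "x5 \<in> carrier_vec (d 5)"
          and dec: "cmat (V\<^sup>T) *\<^sub>v x = x1 @\<^sub>v (x2 @\<^sub>v (x3 @\<^sub>v (x4 @\<^sub>v x5)))"
        let ?x = "x1 @\<^sub>v (x2 @\<^sub>v (x3 @\<^sub>v (x4 @\<^sub>v x5)))"
        have Vx: "cmat V *\<^sub>v ?x = x" unfolding dec[symmetric] by (rule orth(2)[OF x(1)])
        have "cmat U *\<^sub>v (cmat B *\<^sub>v u) = cmat (U * B) *\<^sub>v u"
          using u cmat_mult[OF UV(1) carriers(3)] by (simp add: mult_mult_mat_vec)
        also have "\<dots> = cmat B1 *\<^sub>v u @\<^sub>v (cmat B2 *\<^sub>v u @\<^sub>v (cmat B3 *\<^sub>v u @\<^sub>v (0\<^sub>v (d 4) @\<^sub>v 0\<^sub>v (d 5))))"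
        proof -
          have e: "cmat (U * B) = cmat B1 @\<^sub>r cmat B2 @\<^sub>r cmat B3 @\<^sub>r 0\<^sub>m (d 4) m @\<^sub>r 0\<^sub>m (d 5) m"
            unfolding UB using c1 BC
            by (simp add: block_mat_def append_cols_empty append_rows_empty cmat_append_rows cmat_zero)
          have cs: "cmat B1 \<in> carrier_mat (d 1) m" "cmat B2 \<in> carrier_mat (d 2) m" "cmat B3 \<in> carrier_mat (d 3) m"
            "(0\<^sub>m (d 4) m :: complex mat) \<in> carrier_mat (d 4) m" "(0\<^sub>m (d 5) m :: complex mat) \<in> carrier_mat (d 5) m"
            using c1 BC by auto
          show ?thesis unfolding e append_rows5_mult_vec[OF cs u]
            using u by (simp add: zero_mult_mat_vec)
        qed
        finally have "cmat U *\<^sub>v (pencil s 1 E A *\<^sub>v (cmat V *\<^sub>v ?x)) =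
            cmat B1 *\<^sub>v u @\<^sub>v (cmat B2 *\<^sub>v u @\<^sub>v (cmat B3 *\<^sub>v u @\<^sub>v (0\<^sub>v (d 4) @\<^sub>v 0\<^sub>v (d 5))))"
          unfolding Vx x(2) .
        moreover have bs: "cmat B1 *\<^sub>v u \<in> carrier_vec (d 1)" "cmat B2 *\<^sub>v u \<in> carrier_vec (d 2)" "cmat B3 *\<^sub>v u \<in> carrier_vec (d 3)"
          using c1 BC by (auto intro: carrier_vecI)
        ultimately have *: "pencil s 1 E1 A1 *\<^sub>v x1 = cmat B1 *\<^sub>v u" "x4 = 0\<^sub>v (d 4)" "x5 = 0\<^sub>v (d 5)"
          using first[OF xs(1,4,5)] rows[OF xs bs zero_carrier_vec zero_carrier_vec] by blast+
        have "cmat C *\<^sub>v x = cmat (C * V) *\<^sub>v ?x"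
        proof -
          have "dim_vec ?x = n" using xs n' by simp
          then show ?thesis using cmat_mult[OF carriers(4) UV(3)] unfolding Vx[symmetric]
            by (simp add: mult_mult_mat_vec)
        qed
        also have "\<dots> = cmat C1 *\<^sub>v x1"
        proof -
          have e: "cmat (C * V) = append_cols (cmat C1) (append_cols (0\<^sub>m m (d 2)) (append_cols (0\<^sub>m m (d 3)) (append_cols (cmat C4) (cmat C5))))"
            unfolding CV using c1 BC
            by (simp add: block_mat_def append_cols_empty append_rows_empty cmat_append_cols cmat_zero)
          have cs: "cmat C1 \<in> carrier_mat m (d 1)" "(0\<^sub>m m (d 2) :: complex mat) \<in> carrier_mat m (d 2)"
            "(0\<^sub>m m (d 3) :: complex mat) \<in> carrier_mat m (d 3)" "cmat C4 \<in> carrier_mat m (d 4)" "cmat C5 \<in> carrier_mat m (d 5)"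
            using c1 BC by auto
          have "cmat (C * V) *\<^sub>v ?x = cmat C1 *\<^sub>v x1 + (0\<^sub>m m (d 2) *\<^sub>v x2 + (0\<^sub>m m (d 3) *\<^sub>v x3 +
              (cmat C4 *\<^sub>v x4 + cmat C5 *\<^sub>v x5)))"
            unfolding e by (rule append_cols5_mult_vec[OF cs xs])
          also have "\<dots> = cmat C1 *\<^sub>v x1 + (0\<^sub>v m + (0\<^sub>v m + (0\<^sub>v m + 0\<^sub>v m)))"
            unfolding *(2,3) using xs(2,3) BC by (simp add: zero_mult_mat_vec mult_mat_vec_zero)
          also have "\<dots> = cmat C1 *\<^sub>v x1"
            by (auto simp: vec_eq_iff simp del: index_mult_mat_vec)
          finally show ?thesis .
        qed
        finally show ?thesis using x xs(1) *(1) by metis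
      qed
    qed
    ultimately show ?thesis by blast
  qed
  show "transfer E A B C D = transfer E1 A1 B1 C1 D"
    by (rule transfer_eqI[OF reg sys1 reduced])
  obtain s where "det (pencil s 1 E A) \<noteq> 0"
    using eventually_happens[OF eventually_pencil_nonsingular[OF reg, of 0]] by auto
  then show "regular E1 A1" using reduced unfolding regular_def by blast
qed

lemma positive_real_cong:
  assumes "transfer E A B C D = transfer E' A' B' C' D'"
    and "dim_row D = dim_row D'" "dim_col D = dim_col D'"
  shows "positive_real E A B C D \<longleftrightarrow> positive_real E' A' B' C' D'"
  using assms by (simp add: positive_real_def)

context descriptor
begin

lemma transfer_shift:
  assumes reg: "regular E A" and W: "W \<in> carrier_mat n m" and EW: "E\<^sup>T * W = 0\<^sub>m n m"
  shows "transfer E A B C D = transfer E A B (C - W\<^sup>T * A) (D - W\<^sup>T * B)"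
proof (rule transfer_eqI[OF reg])
  have [simp]: "dim_row W = n" "dim_col W = m" using W by auto
  show "descriptor_system n m E A B (C - W\<^sup>T * A) (D - W\<^sup>T * B)"
    unfolding descriptor_system_def using carriers by (auto intro!: carrier_matI)
  fix s assume det: "det (pencil s 1 E A) \<noteq> 0"
  have WE: "W\<^sup>T * E = 0\<^sub>m m n"
  proof -
    have "(E\<^sup>T * W)\<^sup>T = W\<^sup>T * E" by (subst transpose_mult) (use W carriers in auto)
    then show ?thesis unfolding EW by simp
  qed
  have cWE: "cmat (W\<^sup>T) * cmat E = 0\<^sub>m m n"
    using cmat_mult[of "W\<^sup>T" m n E n] W carriers WE cmat_zero by simp
  have "\<exists>x \<in> carrier_vec n. \<exists>x' \<in> carrier_vec n. pencil s 1 E A *\<^sub>v x = cmat B *\<^sub>v u \<and>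
      pencil s 1 E A *\<^sub>v x' = cmat B *\<^sub>v u \<and>
      cmat C *\<^sub>v x + cmat D *\<^sub>v u = cmat (C - W\<^sup>T * A) *\<^sub>v x' + cmat (D - W\<^sup>T * B) *\<^sub>v u"
    if u: "u \<in> carrier_vec m" for u
  proof -
    obtain x where x: "x \<in> carrier_vec n" "pencil s 1 E A *\<^sub>v x = cmat B *\<^sub>v u"
      using pencil_solution[OF det u] .
    define w where "w = cmat (W\<^sup>T) *\<^sub>v (cmat A *\<^sub>v x)"
    define w' where "w' = cmat (W\<^sup>T) *\<^sub>v (cmat B *\<^sub>v u)"
    \<comment> \<open>Applying \<open>W\<^sup>T\<close> to the pencil equation removes the
      \<open>E\<close> term, so the corrections to the output through \<open>A\<close> and through
      \<open>B\<close> are opposite.\<close>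
    have "w' = s \<cdot>\<^sub>v (cmat (W\<^sup>T) *\<^sub>v (cmat E *\<^sub>v x)) - w"
      unfolding w'_def w_def x(2)[symmetric] using x(1)
      by (simp add: pencil_mult_vec mult_mat_vec_minus mult_mat_vec_smult)
    also have "cmat (W\<^sup>T) *\<^sub>v (cmat E *\<^sub>v x) = (cmat (W\<^sup>T) * cmat E) *\<^sub>v x"
      using x(1) by (intro mult_mult_mat_vec[symmetric]) auto
    also have "\<dots> = 0\<^sub>v m" unfolding cWE using x(1) by (simp add: zero_mult_mat_vec)
    finally have w': "w' = 0\<^sub>v m - w" by simp
    have "cmat (C - W\<^sup>T * A) = cmat C - cmat (W\<^sup>T) * cmat A" "cmat (D - W\<^sup>T * B) = cmat D - cmat (W\<^sup>T) * cmat B"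
      using cmat_mult[of "W\<^sup>T" m n A n] cmat_mult[of "W\<^sup>T" m n B m] W carriers by (auto simp: mat_eq_iff)
    then have "cmat (C - W\<^sup>T * A) *\<^sub>v x + cmat (D - W\<^sup>T * B) *\<^sub>v u = cmat C *\<^sub>v x - w + (cmat D *\<^sub>v u - w')"
      using x u by (simp add: minus_mult_mat_vec mult_mult_mat_vec w_def w'_def)
    also have "\<dots> = cmat C *\<^sub>v x + cmat D *\<^sub>v u"
      unfolding w' by (auto simp: vec_eq_iff w_def simp del: index_mult_mat_vec)
    finally show ?thesis using x by metis
  qed
  then show "det (pencil s 1 E A) \<noteq> 0 \<and> (\<forall>u\<in>carrier_vec m. \<exists>x \<in> carrier_vec n. \<exists>x' \<in> carrier_vec n. pencil s 1 E A *\<^sub>v x = cmat B *\<^sub>v u \<and>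
      pencil s 1 E A *\<^sub>v x' = cmat B *\<^sub>v u \<and>
      cmat C *\<^sub>v x + cmat D *\<^sub>v u = cmat (C - W\<^sup>T * A) *\<^sub>v x' + cmat (D - W\<^sup>T * B) *\<^sub>v u)"
    using det by blast
qed

end

theorem corollary17:
  fixes n m :: nat and d :: "nat \<Rightarrow> nat"
    and E A B C D U V \<E> \<A> \<B> \<C> :: "real mat"
  assumes "descriptor_system n m E A B C D"
    and "regular E A"
    and "positive_real E A B C D"
    and "staircase_form n m E A B C d U V \<E> \<A> \<B> \<C>"
  shows "(psd (D + D\<^sup>T) \<longrightarrow> pH_realization (d 1) m \<E> \<A> \<B> \<C> D E A B C D) \<and>
    (\<not> psd (D + D\<^sup>T) \<longrightarrow>
      (\<forall>\<W> \<in> carrier_mat (d 1) m.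
         \<E>\<^sup>T * \<W> = 0\<^sub>m (d 1) m \<and>
         psd (D + D\<^sup>T - \<B>\<^sup>T * \<W> - \<W>\<^sup>T * \<B>) \<and>
         completely_observable (d 1) m \<E> \<A> (\<C> - \<W>\<^sup>T * \<A>) \<longrightarrow>
         pH_realization (d 1) m \<E> \<A> \<B> (\<C> - \<W>\<^sup>T * \<A>) (D - \<W>\<^sup>T * \<B>) E A B C D))"
proof -
  note red = staircase_form_reduction[OF assms(1,2,4)]
  interpret descriptor "d 1" m \<E> \<A> \<B> \<C> D by unfold_locales (rule red(1))
  \<comment> \<open>Both claims are instances, with \<open>(C', D')\<close> either the original pair
    or its shift by \<open>\<W>\<close>. Positive realness carries over because it depends only on
    the transfer function and the size of \<open>D\<close>.\<close>
  have realization: "pH_realization (d 1) m \<E> \<A> \<B> C' D' E A B C D"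
    if sys: "descriptor_system (d 1) m \<E> \<A> \<B> C' D'" and tr: "transfer \<E> \<A> \<B> \<C> D = transfer \<E> \<A> \<B> C' D'"
      and co: "completely_observable (d 1) m \<E> \<A> C'" and psd: "psd (D' + D'\<^sup>T)" for C' D'
  proof -
    interpret s: descriptor "d 1" m \<E> \<A> \<B> C' D' by unfold_locales (rule sys)
    have tr': "transfer E A B C D = transfer \<E> \<A> \<B> C' D'" using red(3) tr by simp
    have "positive_real \<E> \<A> \<B> C' D'"
      using assms(1,3) positive_real_cong[OF tr'] by (simp add: descriptor_system_def)
    then have "port_Hamiltonian (d 1) m \<E> \<A> \<B> C' D'"
      using red(2,4) psd completely_observable_imp_hautus_observable[OF s.carriers(1,2,4) co]
      by (intro s.port_Hamiltonian_if_positive_real)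
    then show ?thesis using red(2) tr' by (simp add: pH_realization_def)
  qed
  have "pH_realization (d 1) m \<E> \<A> \<B> (\<C> - W\<^sup>T * \<A>) (D - W\<^sup>T * \<B>) E A B C D"
    if W: "W \<in> carrier_mat (d 1) m" and EW: "\<E>\<^sup>T * W = 0\<^sub>m (d 1) m"
      and psd: "psd (D + D\<^sup>T - \<B>\<^sup>T * W - W\<^sup>T * \<B>)"
      and co: "completely_observable (d 1) m \<E> \<A> (\<C> - W\<^sup>T * \<A>)" for W
  proof (rule realization[OF _ transfer_shift[OF red(2) W EW] co])
    show "descriptor_system (d 1) m \<E> \<A> \<B> (\<C> - W\<^sup>T * \<A>) (D - W\<^sup>T * \<B>)"
      unfolding descriptor_system_def using carriers W by (auto intro!: carrier_matI)
    have "(W\<^sup>T * \<B>)\<^sup>T = \<B>\<^sup>T * W" by (subst transpose_mult) (use W carriers in auto)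
    \<comment> \<open>The symmetrized shifted feedthrough is exactly the matrix that is assumed to
      be semidefinite.\<close>
    then have "D - W\<^sup>T * \<B> + (D - W\<^sup>T * \<B>)\<^sup>T = D + D\<^sup>T - \<B>\<^sup>T * W - W\<^sup>T * \<B>"
      using W carriers by (subst transpose_minus[of _ m m]) (auto simp: mat_eq_iff)
    then show "psd (D - W\<^sup>T * \<B> + (D - W\<^sup>T * \<B>)\<^sup>T)" using psd by simp
  qed
  then show ?thesis using realization[OF red(1) refl red(5)] by blast
qed

end
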